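(* Let $\bm{a}\in\mathbb{N}^m_+$ with $|\bm{a}|=d$, let $(\Delta,\kappa)$ be an $\bm{a}$-balanced simplicial complex, let $\mathbbm{k}$ be a field of characteristic $2$, and let $\mu$ be a simplicial cycle of $\Delta$ over $\mathbbm{k}$. Let $A=\widetilde{\mathbbm{k}}[\Delta]/(\Theta)$ be the generic $\mathbb{N}^m$-graded Artinian reduction of $\mathbbm{k}[\Delta]$ and let $B(\mu)$ be the Gorensteinification of $A$ with respect to $\mu$. Then for generic elements $\ell_j\in B(\mu)_{\bm{e}_j}$, $j=1,\ldots,m$, the multiplication map $\times\bm{\ell}^{\bm{a}-2\bm{b}}:B(\mu)_{\bm{b}}\to B(\mu)_{\bm{a}-\bm{b}}$ is an isomorphism for every $\bm{b}\in\mathbb{N}^m$ with $\bm{b}\le\frac{\bm{a}}{2}$.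
   Context: $\bm{e}_j$ is the $j$-th unit vector, $\le$ componentwise, $\bm{\ell}^{\bm{c}}=\prod_j\ell_j^{c_j}$. $(\Delta,\kappa)$ is $\bm{a}$-balanced if $\Delta$ is a $(d-1)$-dimensional simplicial complex on $[n]$, $\kappa:V(\Delta)\to[m]$, and every face $\tau$ has $|\tau\cap\kappa^{-1}(j)|\le a_j$. A simplicial cycle is a nonzero element $\mu\in\widetilde H_{d-1}(\Delta;\mathbbm{k})$, with coefficient $\mu_\sigma$ on each facet $\sigma$. $\mathbbm{k}[\Delta]=\mathbbm{k}[x_1,\ldots,x_n]/I_\Delta$ is $\mathbb{N}^m$-graded by $\deg x_v=\bm{e}_{\kappa(v)}$. Generic $\mathbb{N}^m$-graded Artinian reduction: fix a partition $[d]=\mathcal{I}_1\sqcup\cdots\sqcup\mathcal{I}_m$ with $|\mathcal{I}_j|=a_j$; indeterminates $p_{k,v}$ for $k\in\mathcal{I}_{\kappa(v)}$; $\widetilde{\mathbbm{k}}=\mathbbm{k}(p_{k,v})$; $\theta_k=\sum_vP_{k,v}x_v$ with $P_{k,v}=p_{k,v}$ if $k\in\mathcal{I}_{\kappa(v)}$ and $0$ otherwise; $A=\widetilde{\mathbbm{k}}[\Delta]/(\Theta)$. For a facet $\sigma=\{v_1,\ldots,v_d\}$ let $[\sigma]=\det(p(v_1)\cdots p(v_d))$ where $p(v)=(P_{1,v},\ldots,P_{d,v})^T$. There is a (unique) linear function $\Psi_\mu:A_d\to\widetilde{\mathbbm{k}}$ with $\Psi_\mu(x_\sigma)=\mu_\sigma/[\sigma]$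 for every facet $\sigma$; compose it with the projection $\widetilde{\mathbbm{k}}[x]_d\to A_d$. The Gorensteinification $B(\mu)=\widetilde{\mathbbm{k}}[x_1,\ldots,x_n]/I$, where a homogeneous $f$ of degree $k$ lies in $I$ iff $k\ge d+1$ or $\Psi_\mu(fg)=0$ for all $g\in\widetilde{\mathbbm{k}}[x]_{d-k}$; it inherits the $\mathbb{N}^m$-grading. "Generic" means for all $(\ell_1,\ldots,\ell_m)$ in a nonempty Zariski-open subset. *)

theory Defs
  imports
    "HOL-Library.Poly_Mapping"
    "HOL-Library.Nat_Bijection"
    "HOL-Library.FuncSet"
    "HOL-Library.Disjoint_Sets"
    "HOL-Computational_Algebra.Fraction_Field"
    "HOL-Algebra.QuotRing"
    "Jordan_Normal_Form.Determinant"
begin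

text \<open>Conventions: the index sets \<open>[n]\<close>, \<open>[m]\<close>, \<open>[d]\<close> are \<open>{..<n}\<close>, \<open>{..<m}\<close>, \<open>{..<d}\<close>; an
  element of \<open>\<nat>\<^sup>m\<close> is a function on \<open>nat\<close> of which only the values below \<open>m\<close> matter.\<close>

subsection \<open>Balanced complexes and simplicial cycles\<close>

definition simplicial_complex :: "nat \<Rightarrow> nat set set \<Rightarrow> bool" where
  "simplicial_complex n \<Delta> \<longleftrightarrow>
     \<Delta> \<subseteq> Pow {..<n} \<and> {} \<in> \<Delta> \<and> (\<forall>\<sigma>\<in>\<Delta>. \<forall>\<tau>. \<tau> \<subseteq> \<sigma> \<longrightarrow> \<tau> \<in> \<Delta>)"

definition verts :: "nat set set \<Rightarrow> nat set" where
  "verts \<Delta> = {v. {v} \<in> \<Delta>}"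

text \<open>Dimension \<open>d - 1\<close> means that the largest face has \<open>d\<close> elements.\<close>

definition balanced ::
  "nat \<Rightarrow> nat \<Rightarrow> nat \<Rightarrow> (nat \<Rightarrow> nat) \<Rightarrow> nat set set \<Rightarrow> (nat \<Rightarrow> nat) \<Rightarrow> bool" where
  "balanced n m d a \<Delta> \<kappa> \<longleftrightarrow>
     simplicial_complex n \<Delta> \<and> Max (card ` \<Delta>) = d \<and>
     (\<forall>v\<in>verts \<Delta>. \<kappa> v < m) \<and>
     (\<forall>\<tau>\<in>\<Delta>. \<forall>j<m. card {v\<in>\<tau>. \<kappa> v = j} \<le> a j)"

definition facets :: "nat \<Rightarrow> nat set set \<Rightarrow> nat set set" where
  "facets d \<Delta> = {\<sigma>\<in>\<Delta>. card \<sigma> = d}"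

text \<open>The coefficient at \<open>\<tau>\<close> of the boundary of the chain \<open>c\<close>, each simplex being oriented by the
  increasing order of its vertices.\<close>

definition boundary :: "nat set set \<Rightarrow> (nat set \<Rightarrow> 'k::comm_ring_1) \<Rightarrow> nat set \<Rightarrow> 'k" where
  "boundary \<Delta> c \<tau> =
     (\<Sum>v\<in>{v. v \<notin> \<tau> \<and> insert v \<tau> \<in> \<Delta>}. (-1) ^ card {w\<in>\<tau>. w < v} * c (insert v \<tau>))"

text \<open>Nonzero elements of the reduced homology group in degree \<open>d - 1\<close>. As \<open>\<Delta>\<close> has no faces of
  dimension \<open>d\<close>, there are no boundaries to divide out. For \<open>d = 1\<close>, \<open>\<tau> = {}\<close> gives the
  augmentation.\<close>

definition simplicial_cycle ::
  "nat \<Rightarrow> nat set set \<Rightarrow> (nat set \<Rightarrow> 'k::comm_ring_1) \<Rightarrow> bool" where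
  "simplicial_cycle d \<Delta> \<mu> \<longleftrightarrow>
     (\<forall>\<sigma>. \<mu> \<sigma> \<noteq> 0 \<longrightarrow> \<sigma> \<in> facets d \<Delta>) \<and>
     (\<forall>\<tau>\<in>\<Delta>. Suc (card \<tau>) = d \<longrightarrow> boundary \<Delta> \<mu> \<tau> = 0) \<and>
     (\<exists>\<sigma>. \<mu> \<sigma> \<noteq> 0)"

subsection \<open>Polynomials and the field of rational functions\<close>

type_synonym 'a mpoly = "(nat \<Rightarrow>\<^sub>0 nat) \<Rightarrow>\<^sub>0 'a"

definition const :: "'a::zero \<Rightarrow> 'a mpoly" where
  "const c = Poly_Mapping.single 0 c"

definition X :: "nat \<Rightarrow> 'a::zero_neq_one mpoly" where
  "X v = Poly_Mapping.single (Poly_Mapping.single v 1) 1"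

definition indets :: "'a::zero mpoly \<Rightarrow> nat set" where
  "indets f = (\<Union>\<alpha>\<in>Poly_Mapping.keys f. Poly_Mapping.keys \<alpha>)"

text \<open>The indeterminate \<open>p\<^bsub>k,v\<^esub>\<close> is the variable number \<open>prod_encode (k, v)\<close>.\<close>

definition pvar :: "nat \<Rightarrow> nat \<Rightarrow> 'k::field mpoly fract" where
  "pvar k v = Fract (X (prod_encode (k, v))) 1"

definition of_base :: "'k::field \<Rightarrow> 'k mpoly fract" where
  "of_base c = Fract (const c) 1"

definition pindices :: "nat set set \<Rightarrow> (nat \<Rightarrow> nat) \<Rightarrow> (nat \<Rightarrow> nat set) \<Rightarrow> (nat \<times> nat) set" where
  "pindices \<Delta> \<kappa> \<I> = {(k, v). v \<in> verts \<Delta> \<and> k \<in> \<I> (\<kappa> v)}"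

text \<open>The field \<open>k(p\<^bsub>k,v\<^esub>)\<close>, as a subfield of the rational functions in countably many variables:
  only the \<open>p\<^bsub>k,v\<^esub>\<close> with \<open>v\<close> a vertex and \<open>k \<in> \<I> (\<kappa> v)\<close> occur.\<close>

definition ktilde ::
  "nat set set \<Rightarrow> (nat \<Rightarrow> nat) \<Rightarrow> (nat \<Rightarrow> nat set) \<Rightarrow> 'k::field mpoly fract set" where
  "ktilde \<Delta> \<kappa> \<I> =
     {Fract f g | f g. g \<noteq> 0 \<and> indets f \<subseteq> prod_encode ` pindices \<Delta> \<kappa> \<I>
                             \<and> indets g \<subseteq> prod_encode ` pindices \<Delta> \<kappa> \<I>}"

definition Pcoeff ::
  "nat set set \<Rightarrow> (nat \<Rightarrow> nat) \<Rightarrow> (nat \<Rightarrow> nat set) \<Rightarrow> nat \<Rightarrow> nat \<Rightarrow> 'k::field mpoly fract" where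
  "Pcoeff \<Delta> \<kappa> \<I> k v = (if (k, v) \<in> pindices \<Delta> \<kappa> \<I> then pvar k v else 0)"

text \<open>The columns of the matrix are taken in the increasing order of the vertices, matching the
  orientation used in \<^const>\<open>boundary\<close>.\<close>

definition bracket ::
  "nat \<Rightarrow> nat set set \<Rightarrow> (nat \<Rightarrow> nat) \<Rightarrow> (nat \<Rightarrow> nat set) \<Rightarrow> nat set \<Rightarrow> 'k::field mpoly fract" where
  "bracket d \<Delta> \<kappa> \<I> \<sigma> =
     det (mat d d (\<lambda>(i, j). Pcoeff \<Delta> \<kappa> \<I> i (sorted_list_of_set \<sigma> ! j)))"

definition poly_ring :: "nat \<Rightarrow> 'a::field set \<Rightarrow> 'a mpoly ring" where
  "poly_ring n F =
     \<lparr>carrier = {f. indets f \<subseteq> {..<n} \<and> (\<forall>\<alpha>. Poly_Mapping.lookup f \<alpha> \<in> F)},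
      monoid.mult = (*), one = 1, zero = 0, add = (+)\<rparr>"

definition total_deg :: "(nat \<Rightarrow>\<^sub>0 nat) \<Rightarrow> nat" where
  "total_deg \<alpha> = (\<Sum>v\<in>Poly_Mapping.keys \<alpha>. Poly_Mapping.lookup \<alpha> v)"

definition deg_part :: "nat \<Rightarrow> 'a::field set \<Rightarrow> nat \<Rightarrow> 'a mpoly set" where
  "deg_part n F k = {f \<in> carrier (poly_ring n F). \<forall>\<alpha>\<in>Poly_Mapping.keys f. total_deg \<alpha> = k}"

definition hom_component :: "nat \<Rightarrow> 'a::field mpoly \<Rightarrow> 'a mpoly" where
  "hom_component k f =
     (\<Sum>\<alpha>\<in>{\<alpha>\<in>Poly_Mapping.keys f. total_deg \<alpha> = k}. Poly_Mapping.single \<alpha> (Poly_Mapping.lookup f \<alpha>))"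

text \<open>Polynomials of multidegree \<open>b\<close>, where \<open>X v\<close> has degree \<open>e\<^bsub>\<kappa> v\<^esub>\<close>. The values of \<open>\<kappa>\<close> off the
  vertex set are irrelevant below, since the variables of non-vertices vanish in \<open>k[\<Delta>]\<close>.\<close>

definition multideg_part ::
  "nat \<Rightarrow> nat \<Rightarrow> (nat \<Rightarrow> nat) \<Rightarrow> 'a::field set \<Rightarrow> (nat \<Rightarrow> nat) \<Rightarrow> 'a mpoly set" where
  "multideg_part n m \<kappa> F b =
     {f \<in> carrier (poly_ring n F).
        \<forall>\<alpha>\<in>Poly_Mapping.keys f. \<forall>j<m. (\<Sum>v\<in>{v\<in>{..<n}. \<kappa> v = j}. Poly_Mapping.lookup \<alpha> v) = b j}"

definition unit_vec_nat :: "nat \<Rightarrow> nat \<Rightarrow> nat" where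
  "unit_vec_nat j = (\<lambda>i. if i = j then 1 else 0)"

subsection \<open>Linear maps over a subfield\<close>

text \<open>Here \<open>Q\<close> is an algebra over the field \<open>F\<close> with structure map \<open>\<eta>\<close>, and \<open>V\<close>, \<open>W\<close> are
  \<open>F\<close>-subspaces of \<open>Q\<close>.\<close>

definition linear_functional ::
  "('q, 'x) ring_scheme \<Rightarrow> 'a::field set \<Rightarrow> ('a \<Rightarrow> 'q) \<Rightarrow> 'q set \<Rightarrow> ('q \<Rightarrow> 'a) \<Rightarrow> bool" where
  "linear_functional Q F \<eta> V \<phi> \<longleftrightarrow>
     \<phi> \<in> V \<rightarrow>\<^sub>E F \<and>
     (\<forall>x\<in>V. \<forall>y\<in>V. \<phi> (x \<oplus>\<^bsub>Q\<^esub> y) = \<phi> x + \<phi> y) \<and>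
     (\<forall>c\<in>F. \<forall>x\<in>V. \<phi> (\<eta> c \<otimes>\<^bsub>Q\<^esub> x) = c * \<phi> x)"

definition linear_iso ::
  "('q, 'x) ring_scheme \<Rightarrow> 'a::field set \<Rightarrow> ('a \<Rightarrow> 'q) \<Rightarrow> 'q set \<Rightarrow> 'q set \<Rightarrow> ('q \<Rightarrow> 'q) \<Rightarrow> bool" where
  "linear_iso Q F \<eta> V W T \<longleftrightarrow>
     bij_betw T V W \<and>
     (\<forall>x\<in>V. \<forall>y\<in>V. T (x \<oplus>\<^bsub>Q\<^esub> y) = T x \<oplus>\<^bsub>Q\<^esub> T y) \<and>
     (\<forall>c\<in>F. \<forall>x\<in>V. T (\<eta> c \<otimes>\<^bsub>Q\<^esub> x) = \<eta> c \<otimes>\<^bsub>Q\<^esub> T x)"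

text \<open>Polynomial functions on the product of the vector spaces \<open>V j\<close>, \<open>j < m\<close>: the \<open>F\<close>-algebra of
  functions generated by the linear functionals of the factors. This defines the Zariski topology
  without a choice of bases.\<close>

inductive_set poly_funs ::
  "('q, 'x) ring_scheme \<Rightarrow> 'a::field set \<Rightarrow> ('a \<Rightarrow> 'q) \<Rightarrow> nat \<Rightarrow> (nat \<Rightarrow> 'q set) \<Rightarrow>
   ((nat \<Rightarrow> 'q) \<Rightarrow> 'a) set"
  for Q F \<eta> m V where
  scalar: "c \<in> F \<Longrightarrow> (\<lambda>\<l>. c) \<in> poly_funs Q F \<eta> m V"
| linear: "j < m \<Longrightarrow> linear_functional Q F \<eta> (V j) \<phi> \<Longrightarrow> (\<lambda>\<l>. \<phi> (\<l> j)) \<in> poly_funs Q F \<eta> m V"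
| add: "P \<in> poly_funs Q F \<eta> m V \<Longrightarrow> P' \<in> poly_funs Q F \<eta> m V \<Longrightarrow>
    (\<lambda>\<l>. P \<l> + P' \<l>) \<in> poly_funs Q F \<eta> m V"
| mult: "P \<in> poly_funs Q F \<eta> m V \<Longrightarrow> P' \<in> poly_funs Q F \<eta> m V \<Longrightarrow>
    (\<lambda>\<l>. P \<l> * P' \<l>) \<in> poly_funs Q F \<eta> m V"

definition zariski_open ::
  "('q, 'x) ring_scheme \<Rightarrow> 'a::field set \<Rightarrow> ('a \<Rightarrow> 'q) \<Rightarrow> nat \<Rightarrow> (nat \<Rightarrow> 'q set) \<Rightarrow>
   (nat \<Rightarrow> 'q) set \<Rightarrow> bool" where
  "zariski_open Q F \<eta> m V U \<longleftrightarrow>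
     (\<exists>S \<subseteq> poly_funs Q F \<eta> m V. U = {\<l> \<in> (\<Pi>\<^sub>E j\<in>{..<m}. V j). \<exists>P\<in>S. P \<l> \<noteq> 0})"

subsection \<open>The generic graded Artinian reduction\<close>

definition sr_ideal :: "nat \<Rightarrow> 'a::field set \<Rightarrow> nat set set \<Rightarrow> 'a mpoly set" where
  "sr_ideal n F \<Delta> =
     genideal (poly_ring n F) {\<Prod>v\<in>\<tau>. X v | \<tau>. \<tau> \<subseteq> {..<n} \<and> \<tau> \<notin> \<Delta>}"

definition sr_ring :: "nat \<Rightarrow> 'a::field set \<Rightarrow> nat set set \<Rightarrow> 'a mpoly set ring" where
  "sr_ring n F \<Delta> = poly_ring n F Quot sr_ideal n F \<Delta>"

definition sr_proj :: "nat \<Rightarrow> 'a::field set \<Rightarrow> nat set set \<Rightarrow> 'a mpoly \<Rightarrow> 'a mpoly set" where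
  "sr_proj n F \<Delta> f = sr_ideal n F \<Delta> +>\<^bsub>poly_ring n F\<^esub> f"

definition theta ::
  "nat set set \<Rightarrow> (nat \<Rightarrow> nat) \<Rightarrow> (nat \<Rightarrow> nat set) \<Rightarrow> nat \<Rightarrow> 'k::field mpoly fract mpoly" where
  "theta \<Delta> \<kappa> \<I> k = (\<Sum>v\<in>verts \<Delta>. const (Pcoeff \<Delta> \<kappa> \<I> k v) * X v)"

definition theta_ideal ::
  "nat \<Rightarrow> nat \<Rightarrow> nat set set \<Rightarrow> (nat \<Rightarrow> nat) \<Rightarrow> (nat \<Rightarrow> nat set) \<Rightarrow>
   'k::field mpoly fract mpoly set set" where
  "theta_ideal n d \<Delta> \<kappa> \<I> =
     genideal (sr_ring n (ktilde \<Delta> \<kappa> \<I>) \<Delta>)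
       {sr_proj n (ktilde \<Delta> \<kappa> \<I>) \<Delta> (theta \<Delta> \<kappa> \<I> k) | k. k < d}"

definition artinian_reduction ::
  "nat \<Rightarrow> nat \<Rightarrow> nat set set \<Rightarrow> (nat \<Rightarrow> nat) \<Rightarrow> (nat \<Rightarrow> nat set) \<Rightarrow>
   'k::field mpoly fract mpoly set set ring" where
  "artinian_reduction n d \<Delta> \<kappa> \<I> =
     sr_ring n (ktilde \<Delta> \<kappa> \<I>) \<Delta> Quot theta_ideal n d \<Delta> \<kappa> \<I>"

definition A_proj ::
  "nat \<Rightarrow> nat \<Rightarrow> nat set set \<Rightarrow> (nat \<Rightarrow> nat) \<Rightarrow> (nat \<Rightarrow> nat set) \<Rightarrow>
   'k::field mpoly fract mpoly \<Rightarrow> 'k mpoly fract mpoly set set" where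
  "A_proj n d \<Delta> \<kappa> \<I> f =
     theta_ideal n d \<Delta> \<kappa> \<I> +>\<^bsub>sr_ring n (ktilde \<Delta> \<kappa> \<I>) \<Delta>\<^esub> sr_proj n (ktilde \<Delta> \<kappa> \<I>) \<Delta> f"

definition A_part ::
  "nat \<Rightarrow> nat \<Rightarrow> nat set set \<Rightarrow> (nat \<Rightarrow> nat) \<Rightarrow> (nat \<Rightarrow> nat set) \<Rightarrow> nat \<Rightarrow>
   'k::field mpoly fract mpoly set set set" where
  "A_part n d \<Delta> \<kappa> \<I> k = A_proj n d \<Delta> \<kappa> \<I> ` deg_part n (ktilde \<Delta> \<kappa> \<I>) k"

subsection \<open>The Gorensteinification\<close>

definition is_Psi ::
  "nat \<Rightarrow> nat \<Rightarrow> nat set set \<Rightarrow> (nat \<Rightarrow> nat) \<Rightarrow> (nat \<Rightarrow> nat set) \<Rightarrow> (nat set \<Rightarrow> 'k::field) \<Rightarrow>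
   ('k mpoly fract mpoly set set \<Rightarrow> 'k mpoly fract) \<Rightarrow> bool" where
  "is_Psi n d \<Delta> \<kappa> \<I> \<mu> \<psi> \<longleftrightarrow>
     linear_functional (artinian_reduction n d \<Delta> \<kappa> \<I>) (ktilde \<Delta> \<kappa> \<I>)
       (\<lambda>c. A_proj n d \<Delta> \<kappa> \<I> (const c)) (A_part n d \<Delta> \<kappa> \<I> d) \<psi> \<and>
     (\<forall>\<sigma>\<in>facets d \<Delta>.
        \<psi> (A_proj n d \<Delta> \<kappa> \<I> (\<Prod>v\<in>\<sigma>. X v)) = of_base (\<mu> \<sigma>) / bracket d \<Delta> \<kappa> \<I> \<sigma>)"

definition Psi ::
  "nat \<Rightarrow> nat \<Rightarrow> nat set set \<Rightarrow> (nat \<Rightarrow> nat) \<Rightarrow> (nat \<Rightarrow> nat set) \<Rightarrow> (nat set \<Rightarrow> 'k::field) \<Rightarrow>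
   'k mpoly fract mpoly set set \<Rightarrow> 'k mpoly fract" where
  "Psi n d \<Delta> \<kappa> \<I> \<mu> = (THE \<psi>. is_Psi n d \<Delta> \<kappa> \<I> \<mu> \<psi>)"

text \<open>The condition is imposed on every homogeneous component; components of degree greater than
  \<open>d\<close> are unconstrained.\<close>

definition gor_ideal ::
  "nat \<Rightarrow> nat \<Rightarrow> nat set set \<Rightarrow> (nat \<Rightarrow> nat) \<Rightarrow> (nat \<Rightarrow> nat set) \<Rightarrow> (nat set \<Rightarrow> 'k::field) \<Rightarrow>
   'k mpoly fract mpoly set" where
  "gor_ideal n d \<Delta> \<kappa> \<I> \<mu> =
     {f \<in> carrier (poly_ring n (ktilde \<Delta> \<kappa> \<I>)).
        \<forall>k\<le>d. \<forall>g\<in>deg_part n (ktilde \<Delta> \<kappa> \<I>) (d - k).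
          Psi n d \<Delta> \<kappa> \<I> \<mu> (A_proj n d \<Delta> \<kappa> \<I> (hom_component k f * g)) = 0}"

definition gorensteinification ::
  "nat \<Rightarrow> nat \<Rightarrow> nat set set \<Rightarrow> (nat \<Rightarrow> nat) \<Rightarrow> (nat \<Rightarrow> nat set) \<Rightarrow> (nat set \<Rightarrow> 'k::field) \<Rightarrow>
   'k mpoly fract mpoly set ring" where
  "gorensteinification n d \<Delta> \<kappa> \<I> \<mu> =
     poly_ring n (ktilde \<Delta> \<kappa> \<I>) Quot gor_ideal n d \<Delta> \<kappa> \<I> \<mu>"

definition B_proj ::
  "nat \<Rightarrow> nat \<Rightarrow> nat set set \<Rightarrow> (nat \<Rightarrow> nat) \<Rightarrow> (nat \<Rightarrow> nat set) \<Rightarrow> (nat set \<Rightarrow> 'k::field) \<Rightarrow>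
   'k mpoly fract mpoly \<Rightarrow> 'k mpoly fract mpoly set" where
  "B_proj n d \<Delta> \<kappa> \<I> \<mu> f = gor_ideal n d \<Delta> \<kappa> \<I> \<mu> +>\<^bsub>poly_ring n (ktilde \<Delta> \<kappa> \<I>)\<^esub> f"

definition B_part ::
  "nat \<Rightarrow> nat \<Rightarrow> nat \<Rightarrow> nat set set \<Rightarrow> (nat \<Rightarrow> nat) \<Rightarrow> (nat \<Rightarrow> nat set) \<Rightarrow>
   (nat set \<Rightarrow> 'k::field) \<Rightarrow> (nat \<Rightarrow> nat) \<Rightarrow> 'k mpoly fract mpoly set set" where
  "B_part n m d \<Delta> \<kappa> \<I> \<mu> b =
     B_proj n d \<Delta> \<kappa> \<I> \<mu> ` multideg_part n m \<kappa> (ktilde \<Delta> \<kappa> \<I>) b"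

definition B_scalar ::
  "nat \<Rightarrow> nat \<Rightarrow> nat set set \<Rightarrow> (nat \<Rightarrow> nat) \<Rightarrow> (nat \<Rightarrow> nat set) \<Rightarrow> (nat set \<Rightarrow> 'k::field) \<Rightarrow>
   'k mpoly fract \<Rightarrow> 'k mpoly fract mpoly set" where
  "B_scalar n d \<Delta> \<kappa> \<I> \<mu> c = B_proj n d \<Delta> \<kappa> \<I> \<mu> (const c)"

text \<open>The monomial \<open>\<l>\<^sup>c\<close> in a commutative ring \<open>Q\<close>.\<close>

definition monomial_power ::
  "('q, 'x) ring_scheme \<Rightarrow> nat \<Rightarrow> (nat \<Rightarrow> 'q) \<Rightarrow> (nat \<Rightarrow> nat) \<Rightarrow> 'q" where
  "monomial_power Q m \<l> c = (\<Otimes>\<^bsub>Q\<^esub>j\<in>{..<m}. \<l> j [^]\<^bsub>Q\<^esub> c j)"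

end

theory Submission
  imports Defs
begin

text \<open>The functional \<open>\<Psi>\<close> is given on monomials by Lee's formula \<open>L\<close>, a sum over the facets evaluated
  at a generic point; it is well defined because the boundary of the cycle vanishes. Let \<open>dbl\<close> be the
  endomorphism of the field of rational functions that squares every indeterminate and fixes the
  constants, and let \<open>E\<close> vanish on monomials that are not squares, with \<open>E (x\<^sup>2\<^sup>\<beta>) = dbl (L x\<^sup>\<beta>)\<close>. In
  characteristic two \<open>f \<mapsto> E (\<theta>\<^sub>1 \<cdots> \<theta>\<^sub>d f)\<close> satisfies the relations that characterize \<open>L\<close>, so the two
  agree. As the \<open>p\<^bsub>k,v\<^esub>\<close> occur squarefree in \<open>\<theta>\<^sub>1 \<cdots> \<theta>\<^sub>d\<close> and squarefree monomials are linearly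
  independent over the image of \<open>dbl\<close>, which contains all squares, vanishing of \<open>L (h\<^sup>2 f)\<close> for all \<open>f\<close>
  forces \<open>h = 0\<close> in \<open>B(\<mu>)\<close> for \<open>h\<close> of multidegree at most \<open>a / 2\<close>. The same holds for \<open>L (h\<^sup>2 \<l>\<^sup>\<epsilon> f)\<close> with \<open>\<epsilon> \<in> {0, 1}\<^sup>m\<close> and forms \<open>\<l>\<^sub>j\<close>
  with new indeterminates as coefficients. Hence \<open>g \<l>\<^sup>e = 0\<close> implies \<open>g \<l>\<^sup>\<lfloor>\<^sup>e\<^sup>/\<^sup>2\<^sup>\<rfloor> = 0\<close>, and after
  finitely many steps \<open>g = 0\<close>. So the Gram determinants of the forms \<open>(y, z) \<mapsto> \<Psi> (\<l>\<^sup>a\<^sup>-\<^sup>2\<^sup>b y z)\<close> are nonzero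
  polynomial functions of \<open>\<l>\<close>, and they remain nonzero somewhere over the infinite field of
  coefficients.\<close>

text \<open>Two fields are at play. Anisotropy is proved over rational functions in countably many
  indeterminates, which leaves room for the generic point (the indeterminates
  \<open>pvar k n\<close>) and for generic coefficients of the forms. The coefficient field of the
  theorem is the subfield \<open>F\<close>. The values of \<open>L\<close> lie in \<open>F\<close>,
  since the facet values and the coefficients of the linear relations do. So a Gram determinant is a
  polynomial over \<open>F\<close>, evaluated outside \<open>F\<close> to see that it is nonzero.
  The map \<open>dbl\<close> is used in place of Frobenius because the facet values mu / [sigma]
  have to be reproduced: the bracket must be squared while the coefficient of the cycle stays. The
  price is that h^2 is a value of \<open>dbl\<close> but not \<open>dbl\<close> of h, so passing
  from a relation for h^2 back to h takes linear algebra. The bound b <= a/2 enters as a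
  divisibility: for M of multidegree a - b, the monomial x^(2M) must be divisible by a product of
  variables, one from each theta_k and one from each form in the squarefree part. Colour by colour
  this says a + eps <= 2(a - b).\<close>

abbreviation keys :: "('a \<Rightarrow>\<^sub>0 'b::zero) \<Rightarrow> 'a set" where
  "keys \<equiv> Poly_Mapping.keys"

abbreviation lookup :: "('a \<Rightarrow>\<^sub>0 'b::zero) \<Rightarrow> 'a \<Rightarrow> 'b" where
  "lookup \<equiv> Poly_Mapping.lookup"

subsection \<open>Determinants in characteristic two\<close>

text \<open>In characteristic two this is the determinant; it needs no order on rows and columns.\<close>

definition perm :: "('r \<Rightarrow> 'c \<Rightarrow> 'a::comm_ring_1) \<Rightarrow> 'r set \<Rightarrow> 'c set \<Rightarrow> 'a" where
  "perm q R S = (\<Sum>V\<in>{V \<in> R \<rightarrow>\<^sub>E S. bij_betw V R S}. \<Prod>k\<in>R. q k (V k))"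

lemma signof_char_2:
  assumes "(2::'a::comm_ring_1) = 0"
  shows "signof p = (1::'a)"
proof -
  have "(-1::'a) = 1"
    using assms by (metis add_eq_0_iff one_add_one)
  then show ?thesis by (simp add: sign_def)
qed

text \<open>Without signs the Leibniz sum depends only on the bijections from R to S; the lists
  enumerate the two sets, and conjugating with them turns permutations of indices into such
  bijections.\<close>

lemma det_eq_perm:
  fixes q :: "'r \<Rightarrow> 'c \<Rightarrow> 'a::comm_ring_1"
  assumes two: "(2::'a) = 0"
    and ks: "distinct ks" "length ks = r" "set ks = R"
    and xs: "distinct xs" "length xs = r" "set xs = S"
  shows "det (mat r r (\<lambda>(i, j). q (ks ! i) (xs ! j))) = perm q R S"
proof -
  define ik where "ik k = (THE i. i < r \<and> ks ! i = k)" for k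
  have ik: "ik (ks ! i) = i" if "i < r" for i
    unfolding ik_def using that ks by (auto simp: nth_eq_iff_index_eq)
  have ik2: "ik k < r \<and> ks ! ik k = k" if "k \<in> R" for k
    using that ks ik by (metis in_set_conv_nth)
  have bk: "bij_betw ((!) ks) {0..<r} R"
    using ks bij_betw_nth by (metis atLeast0LessThan)
  have bx: "bij_betw ((!) xs) {0..<r} S"
    using xs bij_betw_nth by (metis atLeast0LessThan)
  have bik: "bij_betw ik R {0..<r}"
    by (rule bij_betw_byWitness[where f' = "(!) ks"]) (use ik ik2 ks in auto)
  define ix where "ix v = (THE i. i < r \<and> xs ! i = v)" for v
  have ix: "ix (xs ! i) = i" if "i < r" for i
    unfolding ix_def using that xs by (auto simp: nth_eq_iff_index_eq)
  have ix2: "ix k < r \<and> xs ! ix k = k" if "k \<in> S" for k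
    using that xs ix by (metis in_set_conv_nth)
  have bix: "bij_betw ix S {0..<r}"
    by (rule bij_betw_byWitness[where f' = "(!) xs"]) (use ix ix2 xs in auto)
  have "det (mat r r (\<lambda>(i, j). q (ks ! i) (xs ! j)))
      = (\<Sum>p\<in>{p. p permutes {0..<r}}. \<Prod>i = 0..<r. q (ks ! i) (xs ! p i))"
    unfolding det_def using signof_char_2[OF two]
    by (auto intro!: sum.cong prod.cong)
  also have "\<dots> = perm q R S"
    unfolding perm_def
  proof (rule sum.reindex_bij_witness[where
        j = "\<lambda>p. \<lambda>k\<in>R. xs ! p (ik k)" and
        i = "\<lambda>V i. if i < r then ix (V (ks ! i)) else i"])
    fix p assume p: "p \<in> {p. p permutes {0..<r}}"
    then have p': "p permutes {0..<r}" by simp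
    have pb: "bij_betw p {0..<r} {0..<r}" using p' by (rule permutes_imp_bij)
    have pl: "p i < r" if "i < r" for i using p' that by (metis atLeastLessThan_iff permutes_in_image zero_le)
    show "(\<lambda>i. if i < r then ix ((\<lambda>k\<in>R. xs ! p (ik k)) (ks ! i)) else i) = p"
    proof
      fix i
      show "(if i < r then ix ((\<lambda>k\<in>R. xs ! p (ik k)) (ks ! i)) else i) = p i"
        using ik ix pl ks p' by (auto simp: permutes_def)
    qed
    have "bij_betw ((!) xs \<circ> (p \<circ> ik)) R S"
      using bik pb bx by (blast intro: bij_betw_trans)
    then have "bij_betw (\<lambda>k\<in>R. xs ! p (ik k)) R S"
      by (simp add: bij_betw_restrict_eq comp_def)
    then show "(\<lambda>k\<in>R. xs ! p (ik k)) \<in> {V \<in> R \<rightarrow>\<^sub>E S. bij_betw V R S}"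
      by (auto simp: bij_betw_def)
    show "(\<Prod>k\<in>R. q k ((\<lambda>k\<in>R. xs ! p (ik k)) k)) = (\<Prod>i = 0..<r. q (ks ! i) (xs ! p i))"
      unfolding prod.reindex_bij_betw[OF bk, symmetric]
      by (rule prod.cong) (use ik ks in auto)
  next
    fix V assume V: "V \<in> {V \<in> R \<rightarrow>\<^sub>E S. bij_betw V R S}"
    then have Vb: "bij_betw V R S" and Ve: "V \<in> R \<rightarrow>\<^sub>E S" by auto
    show "(\<lambda>k\<in>R. xs ! (if ik k < r then ix (V (ks ! ik k)) else ik k)) = V"
    proof
      fix k
      show "(\<lambda>k\<in>R. xs ! (if ik k < r then ix (V (ks ! ik k)) else ik k)) k = V k"
        using ik2 ix2 Ve by (auto simp: PiE_def extensional_def Pi_def)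
    qed
    have "bij_betw (ix \<circ> (V \<circ> (!) ks)) {0..<r} {0..<r}"
      using bix Vb bk by (blast intro: bij_betw_trans)
    then have "bij_betw (\<lambda>i. if i < r then ix (V (ks ! i)) else i) {0..<r} {0..<r}"
      by (subst bij_betw_cong[where g = "ix \<circ> (V \<circ> (!) ks)"]) auto
    then show "(\<lambda>i. if i < r then ix (V (ks ! i)) else i) \<in> {p. p permutes {0..<r}}"
      by (auto intro!: bij_imp_permutes)
  qed
  finally show ?thesis .
qed

lemma enumerate_finite:
  assumes "finite A"
  obtains xs where "distinct xs" "set xs = A" "length xs = card A"
  using finite_distinct_list[OF assms] distinct_card by metis

text \<open>Serves to refute a singular Gram matrix at the generic forms, where the kernel vector
  may have entries anywhere in the big field.\<close>

lemma perm_zero_kernel: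
  fixes q :: "'r \<Rightarrow> 'c \<Rightarrow> 'a::field"
  assumes two: "(2::'a) = 0" and fin: "finite R" "finite S" "card R = card S"
    and z: "perm q R S = 0"
  obtains c where "\<exists>v\<in>S. c v \<noteq> 0" "\<And>k. k \<in> R \<Longrightarrow> (\<Sum>v\<in>S. q k v * c v) = 0"
proof -
  obtain ks where ks: "distinct ks" "set ks = R" "length ks = card R"
    using enumerate_finite fin by metis
  obtain xs where xs: "distinct xs" "set xs = S" "length xs = card S"
    using enumerate_finite fin by metis
  define r where "r = card S"
  let ?A = "mat r r (\<lambda>(i, j). q (ks ! i) (xs ! j))"
  have "det ?A = 0"
    using det_eq_perm[OF two ks(1) _ ks(2) xs(1) _ xs(2), of r q] ks xs fin z r_def by auto
  then obtain v where v: "v \<in> carrier_vec r" "v \<noteq> 0\<^sub>v r" "?A *\<^sub>v v = 0\<^sub>v r"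
    using det_0_iff_vec_prod_zero_field[of ?A r] by auto
  have bx: "bij_betw ((!) xs) {0..<r} S"
    using xs bij_betw_nth r_def by (metis atLeast0LessThan)
  define c where "c x = v $ (THE i. i < r \<and> xs ! i = x)" for x
  have c: "c (xs ! i) = v $ i" if "i < r" for i
  proof -
    have "(THE j. j < r \<and> xs ! j = xs ! i) = i"
      using that xs r_def by (auto simp: nth_eq_iff_index_eq)
    then show ?thesis by (simp add: c_def)
  qed
  obtain i where "i < r" "v $ i \<noteq> 0"
    using v(1,2) by (metis eq_vecI carrier_vecD index_zero_vec)
  then have "\<exists>v\<in>S. c v \<noteq> 0" using c xs r_def by (metis nth_mem)
  moreover have "(\<Sum>v\<in>S. q k v * c v) = 0" if k: "k \<in> R" for k
  proof -
    obtain i where i: "i < r" "ks ! i = k" using k ks fin r_def by (metis in_set_conv_nth)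
    have "(\<Sum>v\<in>S. q k v * c v) = (\<Sum>j = 0..<r. q k (xs ! j) * v $ j)"
      unfolding sum.reindex_bij_betw[OF bx, symmetric] using c by (intro sum.cong) auto
    also have "\<dots> = (?A *\<^sub>v v) $ i"
      using i v(1) by (auto simp: scalar_prod_def intro!: sum.cong)
    also have "\<dots> = 0" using v(3) i by simp
    finally show ?thesis .
  qed
  ultimately show ?thesis using that by blast
qed

section \<open>Linear algebra over a subfield\<close>

locale subfield_set =
  fixes F :: "'a::field set"
  assumes zero_closed: "0 \<in> F" and one_closed: "1 \<in> F"
    and add_closed: "x \<in> F \<Longrightarrow> y \<in> F \<Longrightarrow> x + y \<in> F"
    and mult_closed: "x \<in> F \<Longrightarrow> y \<in> F \<Longrightarrow> x * y \<in> F"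
    and uminus_closed: "x \<in> F \<Longrightarrow> - x \<in> F"
    and inverse_closed: "x \<in> F \<Longrightarrow> inverse x \<in> F"
begin

lemma diff_closed: "x \<in> F \<Longrightarrow> y \<in> F \<Longrightarrow> x - y \<in> F"
  using add_closed[of x "- y"] uminus_closed by simp

lemma divide_closed: "x \<in> F \<Longrightarrow> y \<in> F \<Longrightarrow> x / y \<in> F"
  using mult_closed inverse_closed by (simp add: divide_inverse)

lemma sum_closed: "(\<And>i. i \<in> A \<Longrightarrow> f i \<in> F) \<Longrightarrow> sum f A \<in> F"
  by (induction A rule: infinite_finite_induct) (auto intro: zero_closed add_closed)

lemma prod_closed: "(\<And>i. i \<in> A \<Longrightarrow> f i \<in> F) \<Longrightarrow> prod f A \<in> F"
  by (induction A rule: infinite_finite_induct) (auto intro: one_closed mult_closed)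

lemma power_closed: "x \<in> F \<Longrightarrow> x ^ (i::nat) \<in> F"
  by (induction i) (auto intro: one_closed mult_closed)

lemma det_closed:
  assumes "\<And>i j. i < r \<Longrightarrow> j < r \<Longrightarrow> A $$ (i, j) \<in> F" "A \<in> carrier_mat r r"
  shows "det A \<in> F"
proof -
  have "(signof p :: 'a) \<in> F" for p :: "nat \<Rightarrow> nat"
    using one_closed uminus_closed by (auto simp: sign_def)
  then show ?thesis
    unfolding det_def'[OF assms(2)]
    by (intro sum_closed mult_closed prod_closed)
      (use assms in \<open>auto simp: permutes_in_image dest: permutes_in_image\<close>)
qed

lemma perm_closed:
  assumes "\<And>k v. k \<in> R \<Longrightarrow> v \<in> S \<Longrightarrow> q k v \<in> F"
  shows "perm q R S \<in> F"
  unfolding perm_def using assms by (intro sum_closed prod_closed) (auto simp: PiE_def)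

text \<open>The inverse is taken from the adjugate, whose entries are determinants, so that they
  visibly stay in F.\<close>

lemma perm_inverse:
  assumes two: "(2::'a) = 0" and fin: "finite R" "finite S" "card R = card S"
    and nz: "perm q R S \<noteq> 0"
    and qF: "\<And>k v. k \<in> R \<Longrightarrow> v \<in> S \<Longrightarrow> q k v \<in> F"
  obtains w where "\<And>v k. v \<in> S \<Longrightarrow> k \<in> R \<Longrightarrow> w v k \<in> F"
    "\<And>v v'. v \<in> S \<Longrightarrow> v' \<in> S \<Longrightarrow> (\<Sum>k\<in>R. w v k * q k v') = (if v' = v then 1 else 0)"
    "\<And>k k'. k \<in> R \<Longrightarrow> k' \<in> R \<Longrightarrow> (\<Sum>v\<in>S. q k v * w v k') = (if k' = k then 1 else 0)"
proof -
  obtain ks where ks: "distinct ks" "set ks = R" "length ks = card R"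
    using enumerate_finite fin by metis
  obtain xs where xs: "distinct xs" "set xs = S" "length xs = card S"
    using enumerate_finite fin by metis
  define r where "r = card S"
  define A where "A = mat r r (\<lambda>(i, j). q (ks ! i) (xs ! j))"
  have A: "A \<in> carrier_mat r r" by (simp add: A_def)
  have det: "det A = perm q R S"
    using det_eq_perm[OF two ks(1) _ ks(2) xs(1) _ xs(2), of r q] ks xs fin r_def A_def by auto
  have AF: "A $$ (i, j) \<in> F" if "i < r" "j < r" for i j
    using that qF ks xs fin r_def by (auto simp: A_def)
  have detF: "det A \<in> F" using det_closed AF A by blast
  have adjF: "adj_mat A $$ (i, j) \<in> F" if ij: "i < r" "j < r" for i j
  proof -
    have "det (mat_delete A j i) \<in> F"
    proof (rule det_closed[where r = "r - 1"])
      show "mat_delete A j i \<in> carrier_mat (r - 1) (r - 1)"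
        using A by (rule mat_delete_carrier)
      fix i' j' assume "i' < r - 1" "j' < r - 1"
      then show "mat_delete A j i $$ (i', j') \<in> F"
        using A AF by (auto simp: mat_delete_def)
    qed
    moreover have "((- 1) ^ (j + i) :: 'a) \<in> F"
      using one_closed uminus_closed power_closed by blast
    ultimately show ?thesis
      using ij A by (auto simp: adj_mat_def cofactor_def intro: mult_closed)
  qed
  define ix where "ix x = (THE i. i < r \<and> xs ! i = x)" for x
  have ix: "ix (xs ! i) = i" if "i < r" for i
    unfolding ix_def using that xs r_def by (auto simp: nth_eq_iff_index_eq)
  define ik where "ik x = (THE i. i < r \<and> ks ! i = x)" for x
  have ik: "ik (ks ! i) = i" if "i < r" for i
    unfolding ik_def using that ks fin r_def by (auto simp: nth_eq_iff_index_eq)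
  have bk: "bij_betw ((!) ks) {0..<r} R"
    using ks bij_betw_nth fin r_def by (metis atLeast0LessThan)
  have bx: "bij_betw ((!) xs) {0..<r} S"
    using xs bij_betw_nth r_def by (metis atLeast0LessThan)
  define w where "w v k = adj_mat A $$ (ix v, ik k) / det A" for v k
  show ?thesis
  proof (rule that)
    fix v k assume vk: "v \<in> S" "k \<in> R"
    then obtain i j where "i < r" "xs ! i = v" "j < r" "ks ! j = k"
      using xs ks fin r_def by (metis in_set_conv_nth)
    then show "w v k \<in> F"
      using adjF detF ix ik by (auto simp: w_def intro: divide_closed)
  next
    fix v v' assume vk: "v \<in> S" "v' \<in> S"
    then obtain i j where ij: "i < r" "xs ! i = v" "j < r" "xs ! j = v'"
      using xs r_def by (metis in_set_conv_nth)
    have "(\<Sum>k\<in>R. w v k * q k v') = (\<Sum>k = 0..<r. adj_mat A $$ (i, k) * A $$ (k, j)) / det A"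
      unfolding sum.reindex_bij_betw[OF bk, symmetric] sum_divide_distrib
      using ij ix ik by (intro sum.cong) (auto simp: w_def A_def)
    also have "(\<Sum>k = 0..<r. adj_mat A $$ (i, k) * A $$ (k, j)) = (adj_mat A * A) $$ (i, j)"
      using ij A adj_mat(1)[OF A] by (auto simp: scalar_prod_def intro!: sum.cong)
    also have "\<dots> = (if i = j then det A else 0)"
      using adj_mat(3)[OF A] ij by simp
    finally show "(\<Sum>k\<in>R. w v k * q k v') = (if v' = v then 1 else 0)"
      using ij nz det xs r_def by (auto simp: nth_eq_iff_index_eq)
  next
    fix k k' assume "k \<in> R" "k' \<in> R"
    then obtain i j where ij: "i < r" "ks ! i = k" "j < r" "ks ! j = k'"
      using ks fin r_def by (metis in_set_conv_nth)
    have "(\<Sum>v\<in>S. q k v * w v k') = (\<Sum>v = 0..<r. A $$ (i, v) * adj_mat A $$ (v, j)) / det A"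
      unfolding sum.reindex_bij_betw[OF bx, symmetric] sum_divide_distrib
      using ij ix ik by (intro sum.cong) (auto simp: w_def A_def)
    also have "(\<Sum>v = 0..<r. A $$ (i, v) * adj_mat A $$ (v, j)) = (A * adj_mat A) $$ (i, j)"
      using ij A adj_mat(1)[OF A] by (auto simp: scalar_prod_def intro!: sum.cong)
    also have "\<dots> = (if i = j then det A else 0)"
      using adj_mat(2)[OF A] ij by simp
    finally show "(\<Sum>v\<in>S. q k v * w v k') = (if k' = k then 1 else 0)"
      using ij nz det ks fin r_def by (auto simp: nth_eq_iff_index_eq)
  qed
qed

end

lemma perm_cramer:
  fixes q :: "'r \<Rightarrow> 'c \<Rightarrow> 'a::field"
  assumes two: "(2::'a) = 0" and fin: "finite R" "finite S" "card R = Suc (card S)"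
    and notin: "v \<notin> S" "x \<notin> S"
    and eq: "\<And>k. k \<in> R \<Longrightarrow> q k x = (\<Sum>w\<in>insert v S. q k w * u w)"
  shows "perm q R (insert x S) = u v * perm q R (insert v S)"
proof -
  obtain ks where ks: "distinct ks" "set ks = R" "length ks = card R"
    using enumerate_finite fin by metis
  obtain xs where xs: "distinct xs" "set xs = S" "length xs = card S"
    using enumerate_finite fin by metis
  define r where "r = Suc (card S)"
  \<comment> \<open>The exchanged vertex occupies the last column, index \<open>card S\<close>, so
    \<open>A v\<close> and \<open>A x\<close> differ only there.\<close>
  define A where "A z = mat r r (\<lambda>(i, j). q (ks ! i) ((xs @ [z]) ! j))" for z
  have A: "A z \<in> carrier_mat r r" for z by (simp add: A_def)
  have det: "det (A z) = perm q R (insert z S)" if "z \<notin> S" for z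
    unfolding A_def
    by (rule det_eq_perm[OF two ks(1) _ ks(2)]) (use that ks xs fin r_def in auto)
  define y where "y = vec r (\<lambda>j. u ((xs @ [v]) ! j))"
  have y: "y \<in> carrier_vec r" by (simp add: y_def)
  have bx: "bij_betw ((!) (xs @ [v])) {0..<r} (insert v S)"
    using xs notin r_def by (intro bij_betw_nth) auto
  have "replace_col (A v) (A v *\<^sub>v y) (card S) = A x"
  proof (rule eq_matI)
    fix i j assume "i < dim_row (A x)" "j < dim_col (A x)"
    then have ij: "i < r" "j < r" by (auto simp: A_def)
    have kR: "ks ! i \<in> R" using ij ks fin r_def by auto
    have "(A v *\<^sub>v y) $ i = (\<Sum>j = 0..<r. q (ks ! i) ((xs @ [v]) ! j) * u ((xs @ [v]) ! j))"
      using ij by (auto simp: scalar_prod_def A_def y_def intro!: sum.cong)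
    also have "\<dots> = (\<Sum>w\<in>insert v S. q (ks ! i) w * u w)"
      by (rule sum.reindex_bij_betw[OF bx])
    also have "\<dots> = q (ks ! i) x" using eq kR by simp
    finally have e: "(A v *\<^sub>v y) $ i = q (ks ! i) x" .
    show "replace_col (A v) (A v *\<^sub>v y) (card S) $$ (i, j) = A x $$ (i, j)"
      using ij e xs r_def by (auto simp: replace_col_def A_def nth_append less_Suc_eq)
  qed (auto simp: replace_col_def A_def)
  then have "det (A x) = y $ card S * det (A v)"
    using cramer_lemma_mat[OF A y, of "card S" v] r_def by simp
  moreover have "y $ card S = u v" using xs r_def by (simp add: y_def nth_append)
  ultimately show ?thesis using det notin by simp
qed

section \<open>Monomials and their exponents\<close>

abbreviation mon :: "'m \<Rightarrow> 'm \<Rightarrow>\<^sub>0 'a::zero_neq_one" where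
  "mon \<alpha> \<equiv> Poly_Mapping.single \<alpha> 1"

lemma mon_add:
  "mon (\<alpha> + \<beta>) = (mon \<alpha> * mon \<beta> :: 'm::comm_monoid_add \<Rightarrow>\<^sub>0 'a::comm_semiring_1)"
  by (simp add: mult_single)

lemma mon_sum:
  "mon (sum f A) = (\<Prod>i\<in>A. mon (f i) :: 'm::comm_monoid_add \<Rightarrow>\<^sub>0 'a::comm_semiring_1)"
  by (induction A rule: infinite_finite_induct) (auto simp: mon_add)

lemma poly_mapping_expand:
  "f = (\<Sum>\<alpha>\<in>keys f. Poly_Mapping.single \<alpha> (lookup f \<alpha>))"
  by (rule poly_mapping_eqI)
    (auto simp: lookup_sum lookup_single when_def in_keys_iff sum.delta)

lemma keys_add_nat:
  fixes \<alpha> \<beta> :: "'a \<Rightarrow>\<^sub>0 nat"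
  shows "keys (\<alpha> + \<beta>) = keys \<alpha> \<union> keys \<beta>"
  by (auto simp: in_keys_iff lookup_add)

lemma keys_sum_nat:
  fixes f :: "'i \<Rightarrow> 'a \<Rightarrow>\<^sub>0 nat"
  shows "finite A \<Longrightarrow> keys (sum f A) = (\<Union>i\<in>A. keys (f i))"
  by (induction A rule: finite_induct) (auto simp: keys_add_nat)

subsection \<open>Linear functionals given by their values on monomials\<close>

text \<open>Functionals are handled through their values on exponents, so that multiplication by a
  monomial becomes a shift of \<open>l\<close>.\<close>

definition lin :: "('m \<Rightarrow> 'a) \<Rightarrow> ('m \<Rightarrow>\<^sub>0 'a::comm_ring_1) \<Rightarrow> 'a" where
  "lin l f = (\<Sum>\<alpha>\<in>keys f. lookup f \<alpha> * l \<alpha>)"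

lemma lin_superset:
  "finite A \<Longrightarrow> keys f \<subseteq> A \<Longrightarrow> lin l f = (\<Sum>\<alpha>\<in>A. lookup f \<alpha> * l \<alpha>)"
  unfolding lin_def by (rule sum.mono_neutral_left) (auto simp: in_keys_iff)

lemma lin_0 [simp]: "lin l 0 = 0"
  by (simp add: lin_def)

lemma lin_add: "lin l (f + g) = lin l f + lin l g"
proof -
  let ?A = "keys f \<union> keys g"
  have "lin l h = (\<Sum>\<alpha>\<in>?A. lookup h \<alpha> * l \<alpha>)" if "h \<in> {f, g, f + g}" for h
    using that Poly_Mapping.keys_add[of f g] by (intro lin_superset) auto
  then show ?thesis by (simp add: lookup_add distrib_right sum.distrib)
qed

lemma lin_single [simp]: "lin l (Poly_Mapping.single \<alpha> c) = c * l \<alpha>"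
  by (simp add: lin_def)

lemma lin_sum: "lin l (sum f A) = (\<Sum>i\<in>A. lin l (f i))"
  by (induction A rule: infinite_finite_induct) (auto simp: lin_add)

lemma lin_uminus: "lin l (- f) = - lin l f"
  by (simp add: lin_def sum_negf)

lemma lin_diff: "lin l (f - g) = lin l f - lin l g"
  using lin_add[of l f "- g"] by (simp add: lin_uminus)

lemma lookup_const_mult:
  fixes f :: "'a::comm_ring_1 mpoly"
  shows "lookup (const c * f) \<alpha> = c * lookup f \<alpha>"
proof -
  have "const c * f = Poly_Mapping.map ((*) c) f"
    by (simp add: const_def mult_map_scale_conv_mult)
  then show ?thesis by (simp add: map.rep_eq when_def)
qed

lemma keys_const_mult:
  fixes f :: "'a::comm_ring_1 mpoly"
  shows "keys (const c * f) \<subseteq> keys f"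
  by (auto simp: in_keys_iff lookup_const_mult)

lemma lin_const_mult: "lin l (const c * f) = c * lin l f"
proof -
  have "lin l (const c * f) = (\<Sum>\<alpha>\<in>keys f. lookup (const c * f) \<alpha> * l \<alpha>)"
    by (rule lin_superset) (auto simp: keys_const_mult)
  then show ?thesis by (simp add: lin_def lookup_const_mult sum_distrib_left mult.assoc)
qed

lemma lin_mult:
  "lin l (f * g) = (\<Sum>\<beta>\<in>keys g. lookup g \<beta> * lin (\<lambda>\<alpha>. l (\<alpha> + \<beta>)) f)"
proof -
  have "f * g = (\<Sum>\<beta>\<in>keys g. \<Sum>\<alpha>\<in>keys f.
      Poly_Mapping.single (\<alpha> + \<beta>) (lookup f \<alpha> * lookup g \<beta>))"
    by (subst poly_mapping_expand[of f], subst poly_mapping_expand[of g])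
      (simp add: sum_product mult_single sum.swap[of _ "keys f"])
  then show ?thesis
    by (simp add: lin_sum lin_def[of _ f] sum_distrib_left mult_ac)
qed

lemma lin_mult_mono: "lin l (f * mon N) = lin (\<lambda>\<alpha>. l (\<alpha> + N)) f"
  by (subst lin_mult) simp

lemma lin_mult_sum_mono:
  "lin l (f * g) = (\<Sum>\<beta>\<in>keys g. lookup g \<beta> * lin l (f * mon \<beta>))"
  by (subst lin_mult) (simp add: lin_mult_mono)

lemma lin_mult_eq_0:
  assumes "\<And>N. lin l (f * mon N) = 0"
  shows "lin l (f * g) = 0"
  using assms by (subst lin_mult_sum_mono) simp

subsection \<open>Squaring the variables\<close>

definition dbl_mpoly :: "'a::comm_ring_1 mpoly \<Rightarrow> 'a mpoly" where
  "dbl_mpoly f =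
     (\<Sum>\<alpha>\<in>keys f. Poly_Mapping.single (\<alpha> + \<alpha>) (lookup f \<alpha>))"

lemma dbl_mpoly_superset:
  "finite A \<Longrightarrow> keys f \<subseteq> A \<Longrightarrow>
    dbl_mpoly f = (\<Sum>\<alpha>\<in>A. Poly_Mapping.single (\<alpha> + \<alpha>) (lookup f \<alpha>))"
  unfolding dbl_mpoly_def by (rule sum.mono_neutral_left) (auto simp: in_keys_iff)

lemma dbl_mpoly_add: "dbl_mpoly (f + g) = dbl_mpoly f + dbl_mpoly g"
proof -
  let ?A = "keys f \<union> keys g"
  have "dbl_mpoly h = (\<Sum>\<alpha>\<in>?A. Poly_Mapping.single (\<alpha> + \<alpha>) (lookup h \<alpha>))"
    if "h \<in> {f, g, f + g}" for h
    using that Poly_Mapping.keys_add[of f g] by (intro dbl_mpoly_superset) auto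
  then show ?thesis by (simp add: lookup_add single_add sum.distrib)
qed

lemma dbl_mpoly_0 [simp]: "dbl_mpoly 0 = 0"
  by (simp add: dbl_mpoly_def)

lemma dbl_mpoly_sum: "dbl_mpoly (sum f A) = (\<Sum>i\<in>A. dbl_mpoly (f i))"
  by (induction A rule: infinite_finite_induct) (auto simp: dbl_mpoly_add)

lemma dbl_mpoly_single [simp]:
  "dbl_mpoly (Poly_Mapping.single \<alpha> c) = Poly_Mapping.single (\<alpha> + \<alpha>) c"
  by (simp add: dbl_mpoly_def)

lemma dbl_mpoly_mult: "dbl_mpoly (f * g) = dbl_mpoly f * dbl_mpoly g"
proof -
  have "f * g = (\<Sum>\<alpha>\<in>keys f. \<Sum>\<beta>\<in>keys g.
      Poly_Mapping.single (\<alpha> + \<beta>) (lookup f \<alpha> * lookup g \<beta>))"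
    by (subst poly_mapping_expand[of f], subst poly_mapping_expand[of g])
      (simp add: sum_product mult_single)
  then show ?thesis
    by (simp add: dbl_mpoly_sum dbl_mpoly_def[of f] dbl_mpoly_def[of g] sum_product mult_single
        add_ac)
qed

lemma add_self_inj: "\<alpha> + \<alpha> = \<beta> + \<beta> \<longleftrightarrow> \<alpha> = (\<beta> :: 'a \<Rightarrow>\<^sub>0 nat)"
proof
  assume *: "\<alpha> + \<alpha> = \<beta> + \<beta>"
  have "lookup \<alpha> x = lookup \<beta> x" for x
    using arg_cong[OF *, of "\<lambda>f. lookup f x"] by (simp add: lookup_add)
  then show "\<alpha> = \<beta>" by (rule poly_mapping_eqI)
qed simp

lemma lookup_mono_mult_dbl:
  "lookup (mon \<epsilon> * dbl_mpoly f) \<gamma> =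
    (\<Sum>\<alpha>\<in>keys f. lookup f \<alpha> when \<epsilon> + (\<alpha> + \<alpha>) = \<gamma>)"
  by (simp add: dbl_mpoly_def sum_distrib_left mult_single lookup_sum lookup_single)

lemma dbl_mpoly_eq_0_iff: "dbl_mpoly f = 0 \<longleftrightarrow> f = 0"
proof
  assume *: "dbl_mpoly f = 0"
  have "lookup f \<alpha> = 0" for \<alpha>
    using lookup_mono_mult_dbl[of 0 f "\<alpha> + \<alpha>"] *
    by (simp add: add_self_inj when_def in_keys_iff sum.delta' sum.delta split: if_splits)
  then show "f = 0" by (simp add: poly_mapping_eqI)
qed simp

lemma char_2_square_sum:
  assumes "(2::'a::comm_ring_1) = 0"
  shows "(\<Sum>i\<in>A. f i :: 'a)\<^sup>2 = (\<Sum>i\<in>A. (f i)\<^sup>2)"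
proof (induction A rule: infinite_finite_induct)
  case (insert x A)
  then show ?case using assms by (simp add: power2_sum)
qed auto

text \<open>Squaring is additive in characteristic two, but it also squares the coefficients, which
  \<open>dbl_mpoly\<close> leaves alone; the witness therefore carries squared coefficients.\<close>

lemma square_eq_dbl_mpoly:
  fixes f :: "'a::comm_ring_1 mpoly"
  assumes "(2::'a) = 0"
  shows "\<exists>g. f\<^sup>2 = dbl_mpoly g"
proof -
  have two: "(2::'a mpoly) = 0"
    by (metis assms single_numeral single_zero)
  have "f\<^sup>2 = (\<Sum>\<alpha>\<in>keys f. (Poly_Mapping.single \<alpha> (lookup f \<alpha>))\<^sup>2)"
    by (subst poly_mapping_expand[of f]) (rule char_2_square_sum[OF two])
  also have "\<dots> = dbl_mpoly (\<Sum>\<alpha>\<in>keys f.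
      Poly_Mapping.single \<alpha> ((lookup f \<alpha>)\<^sup>2))"
    by (simp add: dbl_mpoly_sum power2_eq_square mult_single)
  finally show ?thesis by blast
qed

text \<open>The choice of a representing fraction is harmless because \<open>dbl_mpoly\<close> is
  multiplicative and injective; see \<open>dbl_Fract\<close>.\<close>

definition dbl :: "'k::field mpoly fract \<Rightarrow> 'k mpoly fract" where
  "dbl x = (SOME y. \<exists>f g. g \<noteq> 0 \<and> x = Fract f g \<and> y = Fract (dbl_mpoly f) (dbl_mpoly g))"

lemma dbl_Fract:
  assumes "g \<noteq> 0"
  shows "dbl (Fract f g) = Fract (dbl_mpoly f) (dbl_mpoly g)"
proof -
  have "\<exists>y f' g'. g' \<noteq> 0 \<and> Fract f g = Fract f' g' \<and> y = Fract (dbl_mpoly f') (dbl_mpoly g')"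
    using assms by blast
  from someI_ex[OF this] obtain f' g' where *: "g' \<noteq> 0" "Fract f g = Fract f' g'"
      "dbl (Fract f g) = Fract (dbl_mpoly f') (dbl_mpoly g')"
    unfolding dbl_def by blast
  then have "f * g' = f' * g" using assms by (simp add: eq_fract)
  then have "dbl_mpoly f * dbl_mpoly g' = dbl_mpoly f' * dbl_mpoly g"
    by (metis dbl_mpoly_mult)
  then show ?thesis using * assms by (simp add: eq_fract dbl_mpoly_eq_0_iff)
qed

lemma dbl_0 [simp]: "dbl 0 = 0"
  by (simp add: Zero_fract_def dbl_Fract) (simp add: eq_fract dbl_mpoly_eq_0_iff)

lemma dbl_mpoly_1 [simp]: "dbl_mpoly 1 = 1"
  using dbl_mpoly_single[of 0 1] by simp

lemma dbl_1 [simp]: "dbl 1 = 1"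
  by (simp add: One_fract_def dbl_Fract)

lemma dbl_add: "dbl (x + y) = dbl x + dbl y"
  by (cases x, cases y)
    (simp add: dbl_Fract dbl_mpoly_eq_0_iff dbl_mpoly_add dbl_mpoly_mult)

lemma dbl_mult: "dbl (x * y) = dbl x * dbl y"
  by (cases x, cases y) (simp add: dbl_Fract dbl_mpoly_eq_0_iff dbl_mpoly_mult)

lemma dbl_eq_0_iff [simp]: "dbl x = 0 \<longleftrightarrow> x = 0"
proof
  assume "dbl x = 0"
  show "x = 0"
  proof (rule ccontr)
    assume "x \<noteq> 0"
    then have "dbl x * dbl (inverse x) = 1" by (simp flip: dbl_mult)
    then show False using \<open>dbl x = 0\<close> by simp
  qed
qed simp

lemma dbl_inverse: "dbl (inverse x) = inverse (dbl x)"
proof (cases "x = 0")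
  case False
  then have "dbl x * dbl (inverse x) = 1" by (simp flip: dbl_mult)
  then show ?thesis by (metis inverse_unique)
qed simp

lemma dbl_divide: "dbl (x / y) = dbl x / dbl y"
  by (simp add: divide_inverse dbl_mult dbl_inverse)

lemma dbl_sum: "dbl (sum f A) = (\<Sum>i\<in>A. dbl (f i))"
  by (induction A rule: infinite_finite_induct) (auto simp: dbl_add)

lemma dbl_prod: "dbl (prod f A) = (\<Prod>i\<in>A. dbl (f i))"
  by (induction A rule: infinite_finite_induct) (auto simp: dbl_mult)

lemma dbl_of_base [simp]: "dbl (of_base c) = of_base c"
  by (simp add: of_base_def const_def dbl_Fract)

lemma dbl_pvar: "dbl (pvar k v) = (pvar k v)\<^sup>2"
  by (simp add: pvar_def X_def dbl_Fract power2_eq_square mult_single)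

lemma of_base_0 [simp]: "of_base 0 = 0"
  by (simp add: of_base_def const_def Zero_fract_def)

lemma of_base_add: "of_base (x + y) = of_base x + of_base y"
  by (simp add: of_base_def const_def single_add)

lemma of_base_sum: "of_base (sum f A) = (\<Sum>i\<in>A. of_base (f i))"
  by (induction A rule: infinite_finite_induct) (auto simp: of_base_add)

lemma two_eq_0_fract:
  assumes "(2::'k::field) = 0"
  shows "(2::'k mpoly fract) = 0"
proof -
  have "(1::'k) + 1 = 0" using assms by simp
  moreover have "of_base (1::'k) = 1"
    by (simp add: of_base_def const_def One_fract_def)
  ultimately have "(1::'k mpoly fract) + 1 = 0"
    by (metis of_base_0 of_base_add)
  then show ?thesis by simp
qed

lemma square_eq_dbl:
  assumes "(2::'k::field) = 0"
  shows "\<exists>y. (x::'k mpoly fract)\<^sup>2 = dbl y"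
proof (cases x)
  case (Fract f g)
  obtain f' g' where fg: "f\<^sup>2 = dbl_mpoly f'" "g\<^sup>2 = dbl_mpoly g'"
    using square_eq_dbl_mpoly[OF assms] by blast
  then have "g' \<noteq> 0" using Fract by (metis dbl_mpoly_0 power_eq_0_iff)
  moreover have "x\<^sup>2 = Fract (f\<^sup>2) (g\<^sup>2)" using Fract by (simp add: power2_eq_square)
  ultimately have "x\<^sup>2 = dbl (Fract f' g')" using fg by (simp add: dbl_Fract)
  then show ?thesis by blast
qed

lemma common_denominator:
  assumes "finite A"
  shows "\<exists>b g. g \<noteq> 0 \<and> (\<forall>i\<in>A. (y i :: 'a::idom fract) = Fract (b i) g)"
  using assms
proof (induction A rule: finite_induct)
  case empty
  show ?case by (rule exI, rule exI[of _ 1]) simp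
next
  case (insert i A)
  then obtain b g where bg: "g \<noteq> 0" "\<forall>i\<in>A. y i = Fract (b i) g" by blast
  obtain c h where ch: "y i = Fract c h" "h \<noteq> 0" by (cases "y i")
  have "\<forall>j\<in>insert i A. y j = Fract (if j = i then c * g else b j * h) (g * h)"
    using bg ch insert.hyps by (auto simp: eq_fract)
  moreover have "g * h \<noteq> 0" using bg ch by simp
  ultimately show ?case by (intro exI conjI)
qed

text \<open>The squarefree monomials in the \<open>p\<^bsub>k,v\<^esub>\<close> belong to different parity classes of exponents,
  hence are linearly independent over the image of \<^const>\<open>dbl\<close>.\<close>

lemma squarefree_independent:
  fixes y :: "(nat \<Rightarrow> nat) \<Rightarrow> 'k::field mpoly fract"
  assumes fin: "finite Z" "\<And>k. k \<in> Z \<Longrightarrow> finite (C k)"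
    and sum: "(\<Sum>V\<in>Pi\<^sub>E Z C. (\<Prod>k\<in>Z. pvar k (V k)) * dbl (y V)) = 0"
    and V: "V \<in> Pi\<^sub>E Z C"
  shows "y V = 0"
proof -
  have finP: "finite (Pi\<^sub>E Z C)" using fin by (rule finite_PiE)
  obtain b g where bg: "g \<noteq> 0" "\<And>V. V \<in> Pi\<^sub>E Z C \<Longrightarrow> y V = Fract (b V) g"
    using common_denominator[OF finP] by metis
  define e :: "(nat \<Rightarrow> nat) \<Rightarrow> nat \<Rightarrow>\<^sub>0 nat" where
    "e V = (\<Sum>k\<in>Z. Poly_Mapping.single (prod_encode (k, V k)) 1)" for V
  have pe: "(\<Prod>k\<in>Z. pvar k (V k)) = Fract (mon (e V) :: 'k mpoly) 1" for V
  proof -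
    have "(\<Prod>k\<in>Z. pvar k (V k)) = Fract (\<Prod>k\<in>Z. X (prod_encode (k, V k)) :: 'k mpoly) 1"
      unfolding pvar_def
      by (induction Z rule: infinite_finite_induct) (auto simp: One_fract_def)
    then show ?thesis by (simp add: e_def mon_sum X_def)
  qed
  have le: "lookup (e V) (prod_encode (k, v)) = (if V k = v then 1 else 0)"
    if "k \<in> Z" for k v V
  proof -
    have "lookup (e V) (prod_encode (k, v)) =
      (\<Sum>k'\<in>Z. if k' = k then (if V k = v then 1 else 0) else 0)"
      unfolding e_def lookup_sum
      by (rule sum.cong) (auto simp: lookup_single when_def prod_encode_eq)
    then show ?thesis using that fin by simp
  qed
  have "Fract (\<Sum>V\<in>A. mon (e V) * dbl_mpoly (b V)) (dbl_mpoly g) =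
      (\<Sum>V\<in>A. (\<Prod>k\<in>Z. pvar k (V k)) * dbl (y V))" if "A \<subseteq> Pi\<^sub>E Z C" "finite A" for A
    using that(2,1)
  proof (induction A rule: finite_induct)
    case empty
    then show ?case using bg by (simp add: Zero_fract_def eq_fract dbl_mpoly_eq_0_iff)
  next
    case (insert V A)
    have "(\<Sum>V\<in>insert V A. (\<Prod>k\<in>Z. pvar k (V k)) * dbl (y V)) =
      Fract (mon (e V) * dbl_mpoly (b V)) (dbl_mpoly g)
      + Fract (\<Sum>V\<in>A. mon (e V) * dbl_mpoly (b V)) (dbl_mpoly g)"
      using insert bg by (simp add: pe dbl_Fract)
    then show ?case
      using insert.hyps bg
      by (simp add: dbl_mpoly_eq_0_iff eq_fract algebra_simps)
  qed
  from this[OF order_refl finP] have "(\<Sum>V\<in>Pi\<^sub>E Z C. mon (e V) * dbl_mpoly (b V)) = 0"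
    using sum bg by (simp add: Zero_fract_def eq_fract dbl_mpoly_eq_0_iff)
  then have z: "(\<Sum>W\<in>Pi\<^sub>E Z C. lookup (mon (e W) * dbl_mpoly (b W)) \<gamma>) = 0" for \<gamma>
    unfolding lookup_sum[symmetric] by simp
  have "lookup (b V) \<beta> = 0" for \<beta>
  proof -
    let ?\<gamma> = "e V + (\<beta> + \<beta>)"
    have other: "lookup (mon (e W) * dbl_mpoly (b W)) ?\<gamma> = 0"
      if W: "W \<in> Pi\<^sub>E Z C" "W \<noteq> V" for W
    proof -
      \<comment> \<open>In a row k where W and V differ, the indeterminate of (k, V k) has an even
        exponent on the left and an odd one on the right.\<close>
      obtain k where k: "k \<in> Z" "W k \<noteq> V k" using W V by (metis PiE_ext)
      have "e W + (\<alpha> + \<alpha>) \<noteq> ?\<gamma>" for \<alpha>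
      proof
        assume "e W + (\<alpha> + \<alpha>) = ?\<gamma>"
        then have "lookup (e W + (\<alpha> + \<alpha>)) (prod_encode (k, V k))
          = lookup ?\<gamma> (prod_encode (k, V k))" by simp
        then show False using k by (simp add: lookup_add le) presburger
      qed
      then show ?thesis by (simp add: lookup_mono_mult_dbl)
    qed
    have "(\<Sum>W\<in>Pi\<^sub>E Z C. lookup (mon (e W) * dbl_mpoly (b W)) ?\<gamma>)
      = lookup (mon (e V) * dbl_mpoly (b V)) ?\<gamma>"
      using V finP other by (subst sum.remove[of _ V]) (auto intro: sum.neutral)
    also have "\<dots> = lookup (b V) \<beta>"
      by (simp add: lookup_mono_mult_dbl add_self_inj when_def in_keys_iff sum.delta)
    finally show ?thesis using z by simp
  qed
  then have "b V = 0" by (simp add: poly_mapping_eqI)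
  then show ?thesis using bg V by (simp add: Zero_fract_def eq_fract)
qed

subsection \<open>The coefficient field\<close>

lemma indets_0 [simp]: "indets 0 = {}"
  by (simp add: indets_def)

lemma indets_1 [simp]: "indets (1::'a::comm_ring_1 mpoly) = {}"
  by (auto simp: indets_def)

lemma indets_const [simp]: "indets (const c) = {}"
  by (auto simp: indets_def const_def)

lemma indets_X: "indets (X v :: 'a::zero_neq_one mpoly) = {v}"
  by (auto simp: indets_def X_def)

lemma indets_uminus: "indets (- f :: 'a::comm_ring_1 mpoly) = indets f"
  by (auto simp: indets_def in_keys_iff)

lemma indets_add: "indets (f + g) \<subseteq> indets f \<union> indets g"
  using Poly_Mapping.keys_add[of f g] by (fastforce simp: indets_def)

lemma indets_mult:
  fixes f g :: "'a::comm_ring_1 mpoly"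
  shows "indets (f * g) \<subseteq> indets f \<union> indets g"
proof
  fix v assume "v \<in> indets (f * g)"
  then obtain \<gamma> where \<gamma>: "\<gamma> \<in> keys (f * g)" "v \<in> keys \<gamma>"
    by (auto simp: indets_def)
  then obtain \<alpha> \<beta> where "\<gamma> = \<alpha> + \<beta>" "\<alpha> \<in> keys f" "\<beta> \<in> keys g"
    using keys_mult[of f g] by blast
  then show "v \<in> indets f \<union> indets g"
    using \<gamma>(2) by (auto simp: indets_def keys_add_nat)
qed

lemma subfield_ktilde: "subfield_set (ktilde \<Delta> \<kappa> \<I> :: 'k::field mpoly fract set)"
proof -
  define A where "A = prod_encode ` pindices \<Delta> \<kappa> \<I>"
  have kt: "x \<in> ktilde \<Delta> \<kappa> \<I> \<longleftrightarrow>
    (\<exists>f g. x = Fract f g \<and> g \<noteq> 0 \<and> indets f \<subseteq> A \<and> indets g \<subseteq> A)" for x :: "'k mpoly fract"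
    by (auto simp: ktilde_def A_def)
  show ?thesis
  proof
    show "(0::'k mpoly fract) \<in> ktilde \<Delta> \<kappa> \<I>"
      unfolding kt Zero_fract_def by (rule exI[of _ 0], rule exI[of _ 1]) simp
    show "(1::'k mpoly fract) \<in> ktilde \<Delta> \<kappa> \<I>"
      unfolding kt One_fract_def by (rule exI[of _ 1], rule exI[of _ 1]) simp
  next
    fix x y :: "'k mpoly fract" assume "x \<in> ktilde \<Delta> \<kappa> \<I>" "y \<in> ktilde \<Delta> \<kappa> \<I>"
    then obtain f g f' g' where *: "x = Fract f g" "g \<noteq> 0" "indets f \<subseteq> A" "indets g \<subseteq> A"
      "y = Fract f' g'" "g' \<noteq> 0" "indets f' \<subseteq> A" "indets g' \<subseteq> A"
      unfolding kt by auto
    have "indets (f * g' + f' * g) \<subseteq> A"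
      using * indets_mult[of f g'] indets_mult[of f' g] indets_add[of "f * g'" "f' * g"] by blast
    then show "x + y \<in> ktilde \<Delta> \<kappa> \<I>"
      unfolding kt
      by (intro exI[of _ "f * g' + f' * g"] exI[of _ "g * g'"])
        (use * indets_mult[of g g'] in auto)
    show "x * y \<in> ktilde \<Delta> \<kappa> \<I>"
      unfolding kt
      by (rule exI[of _ "f * f'"], rule exI[of _ "g * g'"])
        (use * indets_mult[of f f'] indets_mult[of g g'] in auto)
  next
    fix x :: "'k mpoly fract" assume "x \<in> ktilde \<Delta> \<kappa> \<I>"
    then obtain f g where *: "x = Fract f g" "g \<noteq> 0" "indets f \<subseteq> A" "indets g \<subseteq> A"
      unfolding kt by auto
    then show "- x \<in> ktilde \<Delta> \<kappa> \<I>"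
      unfolding kt by (metis indets_uminus minus_fract)
    show "inverse x \<in> ktilde \<Delta> \<kappa> \<I>"
    proof (cases "f = 0")
      case True
      then have "inverse x = Fract 0 1" using * by (simp add: eq_fract)
      then show ?thesis unfolding kt by (metis indets_0 indets_1 empty_subsetI zero_neq_one)
    next
      case False
      then show ?thesis using * unfolding kt by (metis inverse_fract)
    qed
  qed
qed

lemma pvar_in_ktilde: "(k, v) \<in> pindices \<Delta> \<kappa> \<I> \<Longrightarrow> pvar k v \<in> ktilde \<Delta> \<kappa> \<I>"
  unfolding ktilde_def pvar_def by (force simp: indets_X)

lemma of_base_in_ktilde: "of_base c \<in> ktilde \<Delta> \<kappa> \<I>"
  unfolding ktilde_def of_base_def by force

lemma Pcoeff_in_ktilde: "Pcoeff \<Delta> \<kappa> \<I> k v \<in> ktilde \<Delta> \<kappa> \<I>"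
  using pvar_in_ktilde subfield_set.zero_closed[OF subfield_ktilde] by (auto simp: Pcoeff_def)

text \<open>The base field may be finite, so infinitely many elements come from the powers of one
  indeterminate.\<close>

lemma infinite_ktilde:
  assumes "(k, v) \<in> pindices \<Delta> \<kappa> \<I>"
  shows "infinite (ktilde \<Delta> \<kappa> \<I> :: 'k::field mpoly fract set)"
proof -
  let ?x = "pvar k v :: 'k mpoly fract"
  define u where "u = prod_encode (k, v)"
  have "?x ^ i = Fract (Poly_Mapping.single (Poly_Mapping.single u i) 1) 1" for i
    by (induction i) (auto simp: One_fract_def pvar_def X_def u_def mult_single
        simp flip: single_add)
  then have "inj (\<lambda>i. ?x ^ i)"
    by (auto simp: inj_def eq_fract) (metis inj_single injD lookup_single_eq one_neq_zero
        lookup_single_not_eq)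
  then have "infinite (range (\<lambda>i. ?x ^ i))" using finite_imageD by auto
  moreover have "range (\<lambda>i. ?x ^ i) \<subseteq> ktilde \<Delta> \<kappa> \<I>"
    using subfield_set.power_closed[OF subfield_ktilde] pvar_in_ktilde[OF assms] by auto
  ultimately show ?thesis using infinite_super by blast
qed

subsection \<open>Degrees of monomials\<close>

abbreviation e1 :: "nat \<Rightarrow> nat \<Rightarrow>\<^sub>0 nat" where
  "e1 v \<equiv> Poly_Mapping.single v (Suc 0)"

lemma total_deg_superset:
  "finite A \<Longrightarrow> keys \<alpha> \<subseteq> A \<Longrightarrow> total_deg \<alpha> = (\<Sum>v\<in>A. lookup \<alpha> v)"
  unfolding total_deg_def by (rule sum.mono_neutral_left) (auto simp: in_keys_iff)

lemma total_deg_add [simp]: "total_deg (\<alpha> + \<beta>) = total_deg \<alpha> + total_deg \<beta>"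
proof -
  let ?A = "keys \<alpha> \<union> keys \<beta>"
  have "total_deg \<gamma> = (\<Sum>v\<in>?A. lookup \<gamma> v)" if "\<gamma> \<in> {\<alpha>, \<beta>, \<alpha> + \<beta>}" for \<gamma>
    using that by (intro total_deg_superset) (auto simp: keys_add_nat)
  then show ?thesis by (simp add: lookup_add sum.distrib)
qed

lemma total_deg_single [simp]: "total_deg (Poly_Mapping.single v i) = i"
  by (cases "i = 0") (auto simp: total_deg_def)

lemma total_deg_0 [simp]: "total_deg 0 = 0"
  by (simp add: total_deg_def)

lemma total_deg_sum: "total_deg (sum f A) = (\<Sum>i\<in>A. total_deg (f i))"
  by (induction A rule: infinite_finite_induct) auto

definition ind :: "nat set \<Rightarrow> nat \<Rightarrow>\<^sub>0 nat" where
  "ind \<sigma> = (\<Sum>v\<in>\<sigma>. e1 v)"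

lemma lookup_ind: "finite \<sigma> \<Longrightarrow> lookup (ind \<sigma>) v = (if v \<in> \<sigma> then 1 else 0)"
  by (simp add: ind_def lookup_sum lookup_single when_def sum.delta')

lemma keys_ind: "finite \<sigma> \<Longrightarrow> keys (ind \<sigma>) = \<sigma>"
  by (auto simp: in_keys_iff lookup_ind split: if_splits)

lemma total_deg_ind: "total_deg (ind \<sigma>) = card \<sigma>"
  by (simp add: ind_def total_deg_sum)

lemma card_keys_le: "card (keys \<alpha>) \<le> total_deg \<alpha>"
proof -
  have "(\<Sum>v\<in>keys \<alpha>. 1) \<le> total_deg \<alpha>"
    unfolding total_deg_def by (rule sum_mono) (auto simp: in_keys_iff Suc_le_eq)
  then show ?thesis by simp
qed

lemma squarefree_eq_ind:
  assumes "card (keys \<alpha>) = total_deg \<alpha>"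
  shows "\<alpha> = ind (keys \<alpha>)"
proof (rule poly_mapping_eqI)
  fix v
  have "(\<Sum>v\<in>keys \<alpha>. 1) = (\<Sum>v\<in>keys \<alpha>. lookup \<alpha> v)"
    using assms by (simp add: total_deg_def)
  then have "1 = lookup \<alpha> v" if "v \<in> keys \<alpha>"
    by (rule sum_mono_inv) (use that in \<open>auto simp: in_keys_iff Suc_le_eq\<close>)
  then show "lookup \<alpha> v = lookup (ind (keys \<alpha>)) v"
    by (auto simp: lookup_ind in_keys_iff)
qed

text \<open>A repeated vertex can be split off without shrinking the support. Exchanging it for a
  vertex outside then enlarges the support, which drives the inductions in \<open>G_eq_0\<close> and
  \<open>reduction\<close>.\<close>

lemma repeated_vertex:
  assumes "card (keys \<alpha>) < total_deg \<alpha>"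
  obtains v \<gamma> where "v \<in> keys \<gamma>" "\<alpha> = \<gamma> + e1 v"
    "keys \<gamma> = keys \<alpha>"
proof -
  have "\<exists>v. 2 \<le> lookup \<alpha> v"
  proof (rule ccontr)
    assume "\<not> ?thesis"
    then have "lookup \<alpha> v \<le> 1" for v by (metis not_less_eq_eq numeral_2_eq_2 One_nat_def)
    then have "total_deg \<alpha> \<le> (\<Sum>v\<in>keys \<alpha>. 1)"
      unfolding total_deg_def by (intro sum_mono)
    then show False using assms by simp
  qed
  then obtain v where v: "2 \<le> lookup \<alpha> v" by blast
  define \<gamma> where "\<gamma> = \<alpha> - e1 v"
  have l: "lookup \<gamma> w = lookup \<alpha> w - (if v = w then 1 else 0)" for w
    by (simp add: \<gamma>_def lookup_minus lookup_single when_def)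
  have "\<alpha> = \<gamma> + e1 v"
    using v by (intro poly_mapping_eqI) (auto simp: l lookup_add lookup_single when_def)
  moreover have "keys \<gamma> = keys \<alpha>"
    using v by (auto simp: in_keys_iff l split: if_splits)
  moreover have "v \<in> keys \<gamma>" using v by (simp add: in_keys_iff l)
  ultimately show ?thesis using that by blast
qed

text \<open>The expansion is a sum of different squarefree monomials with coefficients 0 and 1,
  which \<open>dbl\<close> fixes. By \<open>squarefree_independent\<close> it vanishes only if there
  is no admissible bijection, and \<open>V0\<close> is one.\<close>

lemma perm_generic:
  fixes q :: "nat \<Rightarrow> nat \<Rightarrow> 'k::field mpoly fract"
  assumes fin: "finite R" "finite S"
    and q: "\<And>k v. k \<in> R \<Longrightarrow> v \<in> S \<Longrightarrow> q k v = (if v \<in> D k then pvar k v else 0)"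
    and V0: "bij_betw V0 R S" "\<And>k. k \<in> R \<Longrightarrow> V0 k \<in> D k"
  shows "perm q R S \<noteq> 0"
proof
  assume z: "perm q R S = 0"
  define y :: "(nat \<Rightarrow> nat) \<Rightarrow> 'k mpoly fract" where "y V = (if bij_betw V R S then 1 else 0)" for V
  have "(\<Sum>V\<in>R \<rightarrow>\<^sub>E S. (\<Prod>k\<in>R. q k (V k)) * dbl (y V)) = perm q R S"
    unfolding perm_def by (subst sum.inter_filter) (auto simp: y_def fin finite_PiE intro!: sum.cong)
  moreover have "(\<Sum>V\<in>R \<rightarrow>\<^sub>E S. (\<Prod>k\<in>R. q k (V k)) * dbl (y V))
      = (\<Sum>V\<in>Pi\<^sub>E R (\<lambda>k. D k \<inter> S). (\<Prod>k\<in>R. pvar k (V k)) * dbl (y V))"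
  proof (rule sum.mono_neutral_cong_right)
    show "\<forall>V\<in>(R \<rightarrow>\<^sub>E S) - Pi\<^sub>E R (\<lambda>k. D k \<inter> S). (\<Prod>k\<in>R. q k (V k)) * dbl (y V) = 0"
    proof
      fix V assume V: "V \<in> (R \<rightarrow>\<^sub>E S) - Pi\<^sub>E R (\<lambda>k. D k \<inter> S)"
      then obtain k where "k \<in> R" "V k \<notin> D k" "V k \<in> S" by (auto simp: PiE_def Pi_def)
      then have "q k (V k) = 0" using q by simp
      then have "(\<Prod>k\<in>R. q k (V k)) = 0" using fin \<open>k \<in> R\<close> by (intro prod_zero) auto
      then show "(\<Prod>k\<in>R. q k (V k)) * dbl (y V) = 0" by simp
    qed
    show "Pi\<^sub>E R (\<lambda>k. D k \<inter> S) \<subseteq> R \<rightarrow>\<^sub>E S" by (auto simp: PiE_def)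
    fix V assume "V \<in> Pi\<^sub>E R (\<lambda>k. D k \<inter> S)"
    then have "(\<Prod>k\<in>R. q k (V k)) = (\<Prod>k\<in>R. pvar k (V k))"
      by (intro prod.cong) (use q in \<open>auto simp: PiE_def Pi_def\<close>)
    then show "(\<Prod>k\<in>R. q k (V k)) * dbl (y V) = (\<Prod>k\<in>R. pvar k (V k)) * dbl (y V)" by simp
  qed (use fin in \<open>auto intro: finite_PiE\<close>)
  ultimately have "(\<Sum>V\<in>Pi\<^sub>E R (\<lambda>k. D k \<inter> S). (\<Prod>k\<in>R. pvar k (V k)) * dbl (y V)) = 0"
    using z by simp
  then have "y (restrict V0 R) = 0"
    by (rule squarefree_independent[rotated 2]) (use fin V0 in \<open>auto simp: bij_betw_def\<close>)
  then show False using V0 by (simp add: y_def bij_betw_restrict_eq)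
qed

section \<open>Balanced complexes: colours, brackets and the generic point\<close>

locale balanced_cycle =
  fixes n m d :: nat
    and a :: "nat \<Rightarrow> nat"
    and \<Delta> :: "nat set set"
    and \<kappa> :: "nat \<Rightarrow> nat"
    and \<I> :: "nat \<Rightarrow> nat set"
    and \<mu> :: "nat set \<Rightarrow> 'k::field"
  assumes a_pos: "\<And>j. j < m \<Longrightarrow> 0 < a j"
    and a_sum: "(\<Sum>j<m. a j) = d"
    and bal: "balanced n m d a \<Delta> \<kappa>"
    and char_2: "CHAR('k) = 2"
    and cyc: "simplicial_cycle d \<Delta> \<mu>"
    and I_un: "(\<Union>j<m. \<I> j) = {..<d}"
    and I_disj: "disjoint_family_on \<I> {..<m}"
    and I_card: "\<And>j. j < m \<Longrightarrow> card (\<I> j) = a j"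
begin

lemma two_k: "(2::'k) = 0"
  by (metis char_2 of_nat_CHAR of_nat_numeral)

lemma two_K: "(2::'k mpoly fract) = 0"
  by (rule two_eq_0_fract[OF two_k])

abbreviation F :: "'k mpoly fract set" where
  "F \<equiv> ktilde \<Delta> \<kappa> \<I>"

abbreviation Vt :: "nat set" where
  "Vt \<equiv> verts \<Delta>"

abbreviation P :: "nat \<Rightarrow> nat \<Rightarrow> 'k mpoly fract" where
  "P \<equiv> Pcoeff \<Delta> \<kappa> \<I>"

abbreviation Fc :: "nat set set" where
  "Fc \<equiv> facets d \<Delta>"

sublocale F: subfield_set F
  by (rule subfield_ktilde)

lemma P_in_F: "P k v \<in> F"
  by (rule Pcoeff_in_ktilde)

lemma simplicial_complex_Delta: "simplicial_complex n \<Delta>"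
  using bal by (simp add: balanced_def)

lemma Delta_sub: "\<sigma> \<in> \<Delta> \<Longrightarrow> \<tau> \<subseteq> \<sigma> \<Longrightarrow> \<tau> \<in> \<Delta>"
  using simplicial_complex_Delta by (auto simp: simplicial_complex_def)

lemma finite_Delta: "finite \<Delta>"
  using simplicial_complex_Delta by (auto simp: simplicial_complex_def intro: finite_subset)

lemma finite_face: "\<sigma> \<in> \<Delta> \<Longrightarrow> finite \<sigma>"
  using simplicial_complex_Delta by (auto simp: simplicial_complex_def intro: finite_subset)

lemma card_face_le: "\<sigma> \<in> \<Delta> \<Longrightarrow> card \<sigma> \<le> d"
  using bal finite_Delta by (auto simp: balanced_def)

lemma face_subset_Vt: "\<sigma> \<in> \<Delta> \<Longrightarrow> \<sigma> \<subseteq> Vt"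
  using Delta_sub by (auto simp: verts_def)

lemma Vt_lt_n: "v \<in> Vt \<Longrightarrow> v < n"
  using simplicial_complex_Delta by (auto simp: verts_def simplicial_complex_def)

lemma finite_Vt: "finite Vt"
  using Vt_lt_n by (auto intro: finite_subset[of _ "{..<n}"])

lemma n_notin_Vt: "n \<notin> Vt"
  using Vt_lt_n by blast

lemma kappa_lt: "v \<in> Vt \<Longrightarrow> \<kappa> v < m"
  using bal by (auto simp: balanced_def)

lemma card_color_le: "\<sigma> \<in> \<Delta> \<Longrightarrow> j < m \<Longrightarrow> card {v \<in> \<sigma>. \<kappa> v = j} \<le> a j"
  using bal by (auto simp: balanced_def)

lemma finite_Fc: "finite Fc"
  using finite_Delta by (simp add: facets_def)

lemma Fc_Delta: "\<sigma> \<in> Fc \<Longrightarrow> \<sigma> \<in> \<Delta>" and Fc_card: "\<sigma> \<in> Fc \<Longrightarrow> card \<sigma> = d"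
  by (auto simp: facets_def)

lemma Fc_finite: "\<sigma> \<in> Fc \<Longrightarrow> finite \<sigma>" and Fc_Vt: "\<sigma> \<in> Fc \<Longrightarrow> \<sigma> \<subseteq> Vt"
  using Fc_Delta finite_face face_subset_Vt by blast+

text \<open>The colour bounds add up to d, the size of a facet, so each of them is attained.\<close>

lemma card_color_facet:
  assumes "\<sigma> \<in> Fc" "j < m"
  shows "card {v \<in> \<sigma>. \<kappa> v = j} = a j"
proof -
  have "(\<Sum>j<m. card {v \<in> \<sigma>. \<kappa> v = j}) = card (\<Union>j<m. {v \<in> \<sigma>. \<kappa> v = j})"
    using Fc_finite[OF assms(1)] by (intro card_UN_disjoint[symmetric]) auto
  also have "(\<Union>j<m. {v \<in> \<sigma>. \<kappa> v = j}) = \<sigma>"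
    using Fc_Vt[OF assms(1)] kappa_lt by auto
  finally have "(\<Sum>j<m. card {v \<in> \<sigma>. \<kappa> v = j}) = (\<Sum>j<m. a j)"
    using Fc_card[OF assms(1)] a_sum by simp
  then show ?thesis
    by (rule sum_mono_inv) (use assms card_color_le Fc_Delta in auto)
qed

text \<open>The rows from \<open>d\<close> on carry the coefficients of generic linear forms
  \<open>\<l>\<^sub>j\<close>, with new indeterminates.\<close>

definition col :: "nat \<Rightarrow> nat" where
  "col k = (if k < d then (THE j. j < m \<and> k \<in> \<I> j) else k - d)"

lemma col_eq: "j < m \<Longrightarrow> k \<in> \<I> j \<Longrightarrow> col k = j"
proof -
  assume *: "j < m" "k \<in> \<I> j"
  then have "k < d" using I_un by blast
  moreover have "(THE j. j < m \<and> k \<in> \<I> j) = j"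
    using * I_disj by (intro the_equality) (auto simp: disjoint_family_on_def)
  ultimately show ?thesis by (simp add: col_def)
qed

lemma col_lt: "k < d \<Longrightarrow> col k < m" and in_I_col: "k < d \<Longrightarrow> k \<in> \<I> (col k)"
  using I_un col_eq by (metis UN_E lessThan_iff)+

lemma in_I_iff: "j < m \<Longrightarrow> k \<in> \<I> j \<longleftrightarrow> k < d \<and> col k = j"
  using col_eq in_I_col I_un by blast

definition C :: "nat \<Rightarrow> nat set" where
  "C k = {v \<in> Vt. \<kappa> v = col k}"

lemma finite_C: "finite (C k)"
  using finite_Vt by (simp add: C_def)

lemma P_eq: "k < d \<Longrightarrow> P k v = (if v \<in> C k then pvar k v else 0)"
  using in_I_iff kappa_lt by (auto simp: Pcoeff_def pindices_def C_def)

text \<open>A pseudo-vertex \<open>n\<close> stands for a generic point of the space.\<close>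

definition Q :: "nat \<Rightarrow> nat \<Rightarrow> 'k mpoly fract" where
  "Q k v = (if v = n then pvar k n else P k v)"

lemma Q_eq: "k < d \<Longrightarrow> Q k v = (if v \<in> insert n (C k) then pvar k v else 0)"
  by (auto simp: Q_def P_eq)

lemma Q_P: "v \<in> Vt \<Longrightarrow> Q k v = P k v"
  using n_notin_Vt by (auto simp: Q_def)

text \<open>Rows and vertices of a facet are equally many in each colour, so they can be matched
  colour by colour. This exhibits a nonzero term of the bracket.\<close>

lemma facet_assignment:
  assumes "\<sigma> \<in> Fc"
  obtains V where "bij_betw V {..<d} \<sigma>" "\<And>k. k < d \<Longrightarrow> V k \<in> C k"
proof -
  have "\<exists>f. bij_betw f (\<I> j) {v \<in> \<sigma>. \<kappa> v = j}" if "j < m" for j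
  proof (rule finite_same_card_bij)
    show "finite (\<I> j)" using that I_un by (auto intro: finite_subset[of _ "{..<d}"])
    show "finite {v \<in> \<sigma>. \<kappa> v = j}" using Fc_finite[OF assms] by simp
    show "card (\<I> j) = card {v \<in> \<sigma>. \<kappa> v = j}"
      using card_color_facet[OF assms that] I_card that by simp
  qed
  then obtain f where f: "\<And>j. j < m \<Longrightarrow> bij_betw (f j) (\<I> j) {v \<in> \<sigma>. \<kappa> v = j}" by metis
  define V where "V k = f (col k) k" for k
  have "bij_betw V (\<I> j) {v \<in> \<sigma>. \<kappa> v = j}" if "j < m" for j
    using f[OF that] by (rule bij_betw_cong[THEN iffD1, rotated]) (use that in \<open>auto simp: V_def col_eq\<close>)
  then have "bij_betw V (\<Union>j<m. \<I> j) (\<Union>j<m. {v \<in> \<sigma>. \<kappa> v = j})"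
    by (intro bij_betw_UNION_disjoint) (auto simp: disjoint_family_on_def)
  moreover have "(\<Union>j<m. {v \<in> \<sigma>. \<kappa> v = j}) = \<sigma>"
    using Fc_Vt[OF assms] kappa_lt by auto
  ultimately have "bij_betw V {..<d} \<sigma>" by (simp add: I_un)
  moreover have "V k \<in> C k" if "k < d" for k
  proof -
    have "V k \<in> {v \<in> \<sigma>. \<kappa> v = col k}"
      unfolding V_def using f[OF col_lt[OF that]] in_I_col[OF that] by (rule bij_betwE[rule_format])
    then show ?thesis using Fc_Vt[OF assms] by (auto simp: C_def)
  qed
  ultimately show ?thesis using that by blast
qed

definition br :: "nat set \<Rightarrow> 'k mpoly fract" where
  "br \<sigma> = perm Q {..<d} \<sigma>"

text \<open>The numerator in Cramer's rule: the generic point takes the place of the vertex removed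
  from a facet.\<close>

definition brn :: "nat set \<Rightarrow> 'k mpoly fract" where
  "brn \<tau> = perm Q {..<d} (insert n \<tau>)"

lemma bracket_eq_br:
  assumes "\<sigma> \<in> Fc"
  shows "bracket d \<Delta> \<kappa> \<I> \<sigma> = br \<sigma>"
proof -
  let ?xs = "sorted_list_of_set \<sigma>"
  have "bracket d \<Delta> \<kappa> \<I> \<sigma> = det (mat d d (\<lambda>(i, j). P ([0..<d] ! i) (?xs ! j)))"
    unfolding bracket_def by (rule arg_cong[where f = det]) (auto intro!: eq_matI)
  also have "\<dots> = perm P {..<d} \<sigma>"
    using Fc_finite[OF assms] Fc_card[OF assms]
    by (intro det_eq_perm[OF two_K]) (auto simp: lessThan_atLeast0)
  also have "\<dots> = br \<sigma>"
    unfolding br_def perm_def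
    by (intro sum.cong prod.cong) (use Q_P Fc_Vt[OF assms] in \<open>auto simp: PiE_def Pi_def\<close>)
  finally show ?thesis .
qed

lemma br_nonzero:
  assumes "\<sigma> \<in> Fc"
  shows "br \<sigma> \<noteq> 0"
proof -
  obtain V where V: "bij_betw V {..<d} \<sigma>" "\<And>k. k < d \<Longrightarrow> V k \<in> C k"
    using facet_assignment assms by metis
  then show ?thesis
    unfolding br_def
    by (intro perm_generic[where D = "\<lambda>k. insert n (C k)"])
      (use Fc_finite[OF assms] in \<open>auto simp: Q_eq\<close>)
qed

text \<open>The generic point has an indeterminate in every row, whatever the colour, so it may take
  over the row assigned to v.\<close>

lemma brn_nonzero:
  assumes "\<sigma> \<in> Fc" "v \<in> \<sigma>"
  shows "brn (\<sigma> - {v}) \<noteq> 0"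
proof -
  obtain V where V: "bij_betw V {..<d} \<sigma>" "\<And>k. k < d \<Longrightarrow> V k \<in> C k"
    using facet_assignment assms by metis
  then obtain k where k: "k < d" "V k = v" using assms by (metis bij_betw_iff_bijections lessThan_iff)
  have "bij_betw V ({..<d} - {k}) (\<sigma> - {v})"
    using V(1) k assms by (intro bij_betw_DiffI) (auto simp: bij_betw_def)
  then have "bij_betw (V(k := n)) ({..<d} - {k}) (\<sigma> - {v})"
    by (rule bij_betw_cong[THEN iffD1, rotated]) auto
  moreover have "bij_betw (V(k := n)) {k} {n}" by (simp add: bij_betw_def)
  ultimately have "bij_betw (V(k := n)) (({..<d} - {k}) \<union> {k}) ((\<sigma> - {v}) \<union> {n})"
    using Fc_Vt[OF assms(1)] n_notin_Vt by (intro bij_betw_combine) auto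
  then have "bij_betw (V(k := n)) {..<d} (insert n (\<sigma> - {v}))"
    using k by (simp add: insert_absorb Un_commute)
  then show ?thesis
    unfolding brn_def
    by (rule perm_generic[where D = "\<lambda>k. insert n (C k)", rotated 3])
      (use V assms Fc_finite in \<open>auto simp: Q_eq\<close>)
qed

text \<open>The coordinates of the generic point in the basis of the \<open>p(v)\<close>, \<open>v \<in> \<sigma>\<close>, by Cramer's
  rule.\<close>

definition u :: "nat set \<Rightarrow> nat \<Rightarrow> 'k mpoly fract" where
  "u \<sigma> v = brn (\<sigma> - {v}) / br \<sigma>"

lemma u_nonzero: "\<sigma> \<in> Fc \<Longrightarrow> v \<in> \<sigma> \<Longrightarrow> u \<sigma> v \<noteq> 0"
  by (simp add: u_def br_nonzero brn_nonzero)

text \<open>The rows of the inverse matrix are functionals dual to the vertices of the facet. Their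
  values at the generic point are its coordinates, which Cramer's rule identifies with the quotients
  \<open>u\<close>.\<close>

lemma facet_dual_basis:
  assumes "\<sigma> \<in> Fc"
  obtains w where
    "\<And>v v'. v \<in> \<sigma> \<Longrightarrow> v' \<in> \<sigma> \<Longrightarrow> (\<Sum>k<d. w v k * Q k v') = (if v' = v then 1 else 0)"
    "\<And>v. v \<in> \<sigma> \<Longrightarrow> (\<Sum>k<d. w v k * pvar k n) = u \<sigma> v"
    "\<And>k. k < d \<Longrightarrow> (\<Sum>v\<in>\<sigma>. Q k v * u \<sigma> v) = pvar k n"
proof -
  interpret U: subfield_set "UNIV :: 'k mpoly fract set" by standard auto
  obtain w where w:
    "\<And>v v'. v \<in> \<sigma> \<Longrightarrow> v' \<in> \<sigma> \<Longrightarrow> (\<Sum>k\<in>{..<d}. w v k * Q k v') = (if v' = v then 1 else 0)"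
    "\<And>k k'. k \<in> {..<d} \<Longrightarrow> k' \<in> {..<d} \<Longrightarrow> (\<Sum>v\<in>\<sigma>. Q k v * w v k') = (if k' = k then 1 else 0)"
    by (rule U.perm_inverse[OF two_K, of "{..<d}" \<sigma> Q])
      (use assms Fc_finite Fc_card br_nonzero in \<open>auto simp: br_def\<close>)
  define x where "x v = (\<Sum>k<d. w v k * pvar k n)" for v
  have x: "(\<Sum>v\<in>\<sigma>. Q k v * x v) = pvar k n" if "k < d" for k
  proof -
    have "(\<Sum>v\<in>\<sigma>. Q k v * x v) = (\<Sum>k'<d. (\<Sum>v\<in>\<sigma>. Q k v * w v k') * pvar k' n)"
      unfolding x_def sum_distrib_left sum_distrib_right
      by (subst sum.swap) (simp add: mult.assoc)
    also have "\<dots> = (\<Sum>k'<d. if k' = k then pvar k' n else 0)"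
      using w(2) that by (intro sum.cong) auto
    finally show ?thesis using that by simp
  qed
  have "x v = u \<sigma> v" if v: "v \<in> \<sigma>" for v
  proof -
    have "brn (\<sigma> - {v}) = x v * perm Q {..<d} (insert v (\<sigma> - {v}))"
      unfolding brn_def
    proof (rule perm_cramer[OF two_K])
      show "card {..<d} = Suc (card (\<sigma> - {v}))"
        using v Fc_finite[OF assms] Fc_card[OF assms]
        by (metis card_Suc_Diff1 card_lessThan)
      show "n \<notin> \<sigma> - {v}" using Fc_Vt[OF assms] n_notin_Vt by blast
      show "Q k n = (\<Sum>w\<in>insert v (\<sigma> - {v}). Q k w * x w)" if "k \<in> {..<d}" for k
        using x that v by (simp add: insert_absorb Q_def)
    qed (use Fc_finite[OF assms] in auto)
    then show ?thesis
      using v br_nonzero[OF assms] by (simp add: u_def br_def insert_absorb)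
  qed
  then show ?thesis using w(1) x by (intro that[of w]) (auto simp: x_def cong: sum.cong)
qed

lemma u_sum:
  assumes "\<sigma> \<in> Fc" "k < d"
  shows "(\<Sum>v\<in>\<sigma>. Q k v * u \<sigma> v) = pvar k n"
  by (rule facet_dual_basis[OF assms(1)]) (use assms(2) in blast)

subsection \<open>Lee's formula\<close>

text \<open>The factor at v is \<open>u \<sigma> v\<close> to the exponent minus one. It is written
  as a quotient since this is -1 for vertices of the facet outside the support.\<close>

definition H :: "nat set \<Rightarrow> (nat \<Rightarrow>\<^sub>0 nat) \<Rightarrow> 'k mpoly fract" where
  "H \<sigma> \<alpha> = of_base (\<mu> \<sigma>) / br \<sigma> * (\<Prod>v\<in>\<sigma>. u \<sigma> v ^ lookup \<alpha> v / u \<sigma> v)"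

text \<open>No degree is imposed: the linear relations in degree d come down to the vanishing of G
  in degree d - 1.\<close>

definition G :: "(nat \<Rightarrow>\<^sub>0 nat) \<Rightarrow> 'k mpoly fract" where
  "G \<alpha> = (\<Sum>\<sigma>\<in>{\<sigma> \<in> Fc. keys \<alpha> \<subseteq> \<sigma>}. H \<sigma> \<alpha>)"

lemma H_add_e1:
  assumes "\<sigma> \<in> Fc" "v \<in> \<sigma>"
  shows "H \<sigma> (\<alpha> + e1 v) = u \<sigma> v * H \<sigma> \<alpha>"
proof -
  have "(\<Prod>x\<in>\<sigma> - {v}. u \<sigma> x ^ lookup (\<alpha> + e1 v) x / u \<sigma> x)
      = (\<Prod>x\<in>\<sigma> - {v}. u \<sigma> x ^ lookup \<alpha> x / u \<sigma> x)"
    by (rule prod.cong) (auto simp: lookup_add lookup_single)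
  then show ?thesis
    unfolding H_def prod.remove[OF Fc_finite[OF assms(1)] assms(2)]
    by (simp add: lookup_add)
qed

text \<open>A factor x_v scales the contribution of each facet containing v by
  \<open>u \<sigma> v\<close> and discards the other facets, so a linear form acts on each facet by
  a scalar. For A = \<open>Vt\<close> and f a linear functional applied to the points p(v), this
  scalar is the value of the functional at the generic point, the same for all facets.\<close>

lemma sum_G_swap:
  assumes "A \<subseteq> Vt" "\<And>\<sigma>. \<sigma> \<in> Fc \<Longrightarrow> keys \<beta> \<subseteq> \<sigma> \<Longrightarrow> (\<Sum>x\<in>A \<inter> \<sigma>. f x * u \<sigma> x) = c \<sigma>"
  shows "(\<Sum>x\<in>A. f x * G (\<beta> + e1 x)) = (\<Sum>\<sigma>\<in>{\<sigma> \<in> Fc. keys \<beta> \<subseteq> \<sigma>}. c \<sigma> * H \<sigma> \<beta>)"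
proof -
  let ?S = "{\<sigma> \<in> Fc. keys \<beta> \<subseteq> \<sigma>}"
  have finA: "finite A" using assms(1) finite_Vt finite_subset by blast
  have "(\<Sum>x\<in>A. f x * G (\<beta> + e1 x)) = (\<Sum>x\<in>A. \<Sum>\<sigma>\<in>{\<sigma> \<in> ?S. x \<in> \<sigma>}. f x * H \<sigma> (\<beta> + e1 x))"
    unfolding G_def sum_distrib_left by (intro sum.cong) (auto simp: keys_add_nat)
  also have "\<dots> = (\<Sum>\<sigma>\<in>?S. \<Sum>x\<in>{x \<in> A. x \<in> \<sigma>}. f x * H \<sigma> (\<beta> + e1 x))"
    using finA finite_Fc by (intro sum.swap_restrict) auto
  also have "\<dots> = (\<Sum>\<sigma>\<in>?S. (\<Sum>x\<in>A \<inter> \<sigma>. f x * u \<sigma> x) * H \<sigma> \<beta>)"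
    unfolding sum_distrib_right Int_def
    by (intro sum.cong) (auto simp: H_add_e1)
  also have "\<dots> = (\<Sum>\<sigma>\<in>?S. c \<sigma> * H \<sigma> \<beta>)"
    using assms(2) by (intro sum.cong) auto
  finally show ?thesis .
qed

lemma cycle_sum:
  assumes "\<tau> \<in> \<Delta>" "Suc (card \<tau>) = d"
  shows "(\<Sum>v\<in>{v. v \<notin> \<tau> \<and> insert v \<tau> \<in> \<Delta>}. \<mu> (insert v \<tau>)) = 0"
proof -
  have "(-1::'k) ^ i = 1" for i
    using two_k by (metis add_eq_0_iff one_add_one power_one)
  moreover have "boundary \<Delta> \<mu> \<tau> = 0"
    using cyc assms by (auto simp: simplicial_cycle_def)
  ultimately show ?thesis unfolding boundary_def by simp
qed

text \<open>Induction on the codimension of the support: a repeated vertex \<open>v\<close> is rewritten by a linear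
  functional that is dual to \<open>v\<close> on the support and vanishes at the generic point. This ends at
  squarefree monomials of codimension one, where the sum is a multiple of the boundary of the
  cycle.\<close>

lemma G_eq_0:
  assumes "Suc (total_deg \<beta>) = d"
  shows "G \<beta> = 0"
  using assms
proof (induction "d - card (keys \<beta>)" arbitrary: \<beta> rule: less_induct)
  case less
  let ?\<tau> = "keys \<beta>"
  show ?case
  proof (cases "card ?\<tau> = total_deg \<beta>")
    case True
    have Fs: "{\<sigma> \<in> Fc. ?\<tau> \<subseteq> \<sigma>} = (\<lambda>v. insert v ?\<tau>) ` {v. v \<notin> ?\<tau> \<and> insert v ?\<tau> \<in> \<Delta>}"
    proof (intro equalityI subsetI)
      fix \<sigma> assume "\<sigma> \<in> {\<sigma> \<in> Fc. ?\<tau> \<subseteq> \<sigma>}"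
      then have s: "\<sigma> \<in> Fc" "?\<tau> \<subseteq> \<sigma>" by auto
      have "card (\<sigma> - ?\<tau>) = 1"
        using s True less.prems Fc_card[OF s(1)] by (subst card_Diff_subset) auto
      then obtain v where "\<sigma> - ?\<tau> = {v}" by (rule card_1_singletonE)
      then have "\<sigma> = insert v ?\<tau>" "v \<notin> ?\<tau>" using s by blast+
      then show "\<sigma> \<in> (\<lambda>v. insert v ?\<tau>) ` {v. v \<notin> ?\<tau> \<and> insert v ?\<tau> \<in> \<Delta>}"
        using Fc_Delta[OF s(1)] by blast
    qed (use True less.prems in \<open>auto simp: facets_def\<close>)
    have inj: "inj_on (\<lambda>v. insert v ?\<tau>) {v. v \<notin> ?\<tau> \<and> insert v ?\<tau> \<in> \<Delta>}"
      by (auto simp: inj_on_def)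
    \<comment> \<open>All exponents on the support are 1, so only the new vertex contributes, by 1 /
      u. This cancels the bracket and leaves \<open>brn ?\<tau>\<close>, a denominator common to all
      facets over the support.\<close>
    have Hv: "H (insert v ?\<tau>) \<beta> = of_base (\<mu> (insert v ?\<tau>)) / brn ?\<tau>"
      if v: "v \<notin> ?\<tau>" "insert v ?\<tau> \<in> \<Delta>" for v
    proof -
      let ?s = "insert v ?\<tau>"
      have s: "?s \<in> Fc" using v True less.prems by (auto simp: facets_def)
      have l: "lookup \<beta> w = 1" if "w \<in> ?\<tau>" for w
        using squarefree_eq_ind[OF True] that by (metis lookup_ind finite_keys)
      have "(\<Prod>w\<in>?\<tau>. u ?s w ^ lookup \<beta> w / u ?s w) = 1"
        using l u_nonzero[OF s] by (intro prod.neutral) auto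
      then have "(\<Prod>w\<in>?s. u ?s w ^ lookup \<beta> w / u ?s w) = 1 / u ?s v"
        using v by (simp add: in_keys_iff)
      then have "H ?s \<beta> = of_base (\<mu> ?s) / br ?s * (1 / u ?s v)" by (simp only: H_def)
      moreover have "u ?s v = brn ?\<tau> / br ?s" using v by (simp add: u_def)
      ultimately show ?thesis using br_nonzero[OF s] by simp
    qed
    show ?thesis
    proof (cases "?\<tau> \<in> \<Delta>")
      case \<tau>: True
      have "G \<beta> = (\<Sum>v\<in>{v. v \<notin> ?\<tau> \<and> insert v ?\<tau> \<in> \<Delta>}. of_base (\<mu> (insert v ?\<tau>)) / brn ?\<tau>)"
        unfolding G_def Fs sum.reindex[OF inj] using Hv by (intro sum.cong) auto
      also have "\<dots> = of_base (\<Sum>v\<in>{v. v \<notin> ?\<tau> \<and> insert v ?\<tau> \<in> \<Delta>}. \<mu> (insert v ?\<tau>)) / brn ?\<tau>"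
        by (simp add: of_base_sum sum_divide_distrib)
      also have "\<dots> = 0"
        using cycle_sum[OF \<tau>] True less.prems by simp
      finally show ?thesis .
    next
      case False
      then have "{v. v \<notin> ?\<tau> \<and> insert v ?\<tau> \<in> \<Delta>} = {}" using Delta_sub by blast
      then show ?thesis unfolding G_def Fs by (simp only: image_empty sum.empty)
    qed
  next
    case False
    then have lt: "card ?\<tau> < total_deg \<beta>" using card_keys_le[of \<beta>] by simp
    obtain v \<gamma> where v: "v \<in> keys \<gamma>" "\<beta> = \<gamma> + e1 v" "keys \<gamma> = ?\<tau>"
      using repeated_vertex[OF lt] by metis
    show ?thesis
    proof (cases "\<exists>\<sigma>0 \<in> Fc. ?\<tau> \<subseteq> \<sigma>0")
      case True
      then obtain \<sigma>0 where s0: "\<sigma>0 \<in> Fc" "?\<tau> \<subseteq> \<sigma>0" by blast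
      obtain w where w:
        "\<And>v v'. v \<in> \<sigma>0 \<Longrightarrow> v' \<in> \<sigma>0 \<Longrightarrow> (\<Sum>k<d. w v k * Q k v') = (if v' = v then 1 else 0)"
        "\<And>v. v \<in> \<sigma>0 \<Longrightarrow> (\<Sum>k<d. w v k * pvar k n) = u \<sigma>0 v"
        by (rule facet_dual_basis[OF s0(1)]) (rule that)
      have "card ?\<tau> < card \<sigma>0" using lt less.prems Fc_card[OF s0(1)] by simp
      then obtain w0 where w0: "w0 \<in> \<sigma>0" "w0 \<notin> ?\<tau>"
        using s0(2) by (metis less_irrefl subsetI subset_antisym)
      have vs: "v \<in> \<sigma>0" "v \<in> ?\<tau>" using v s0 by auto
      \<comment> \<open>The multiple of the functional dual to w0 that cancels the value at the
        generic point. As w0 lies outside the support, the values there are not disturbed.\<close>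
      define c where "c = u \<sigma>0 v / u \<sigma>0 w0"
      define p where "p x = (\<Sum>k<d. (w v k - c * w w0 k) * Q k x)" for x
      have p: "p x = (\<Sum>k<d. w v k * Q k x) - c * (\<Sum>k<d. w w0 k * Q k x)" for x
        by (simp add: p_def left_diff_distrib sum_subtractf sum_distrib_left mult.assoc)
      have p\<tau>: "p x = (if x = v then 1 else 0)" if "x \<in> ?\<tau>" for x
        unfolding p using w(1)[of v x] w(1)[of w0 x] that s0 w0 vs by auto
      have pn: "(\<Sum>k<d. (w v k - c * w w0 k) * pvar k n) = 0"
      proof -
        have "(\<Sum>k<d. (w v k - c * w w0 k) * pvar k n)
            = (\<Sum>k<d. w v k * pvar k n) - c * (\<Sum>k<d. w w0 k * pvar k n)"
          by (simp add: left_diff_distrib sum_subtractf sum_distrib_left mult.assoc)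
        then show ?thesis
          using w(2) vs w0 u_nonzero[OF s0(1) w0(1)] by (simp add: c_def)
      qed
      have key: "(\<Sum>x\<in>(Vt - ?\<tau>) \<inter> \<sigma>. p x * u \<sigma> x) = - u \<sigma> v"
        if s: "\<sigma> \<in> Fc" "?\<tau> \<subseteq> \<sigma>" for \<sigma>
      proof -
        have us: "(\<Sum>x\<in>\<sigma>. Q k x * u \<sigma> x) = pvar k n" if "k < d" for k
          using u_sum[OF s(1) that] .
        have "(\<Sum>x\<in>\<sigma>. p x * u \<sigma> x) = (\<Sum>k<d. (w v k - c * w w0 k) * (\<Sum>x\<in>\<sigma>. Q k x * u \<sigma> x))"
          unfolding p_def sum_distrib_left sum_distrib_right
          by (subst sum.swap) (simp add: mult.assoc)
        also have "\<dots> = 0" using us pn by simp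
        finally have "0 = (\<Sum>x\<in>\<sigma>. p x * u \<sigma> x)" by simp
        also have "\<dots> = (\<Sum>x\<in>\<sigma> - ?\<tau>. p x * u \<sigma> x) + (\<Sum>x\<in>?\<tau>. p x * u \<sigma> x)"
          using s Fc_finite[OF s(1)] by (intro sum.subset_diff) auto
        also have "(\<Sum>x\<in>?\<tau>. p x * u \<sigma> x) = (\<Sum>x\<in>?\<tau>. if x = v then u \<sigma> x else 0)"
          using p\<tau> by (intro sum.cong) auto
        also have "\<dots> = u \<sigma> v" using vs by simp
        finally have "(\<Sum>x\<in>\<sigma> - ?\<tau>. p x * u \<sigma> x) = - u \<sigma> v"
          by (simp add: eq_neg_iff_add_eq_0)
        moreover have "(Vt - ?\<tau>) \<inter> \<sigma> = \<sigma> - ?\<tau>" using Fc_Vt[OF s(1)] by blast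
        ultimately show ?thesis by simp
      qed
      have "(\<Sum>x\<in>Vt - ?\<tau>. p x * G (\<gamma> + e1 x)) = (\<Sum>\<sigma>\<in>{\<sigma> \<in> Fc. ?\<tau> \<subseteq> \<sigma>}. - u \<sigma> v * H \<sigma> \<gamma>)"
        using sum_G_swap[of "Vt - ?\<tau>" \<gamma> p "\<lambda>\<sigma>. - u \<sigma> v"] key v by auto
      also have "\<dots> = (\<Sum>\<sigma>\<in>{\<sigma> \<in> Fc. ?\<tau> \<subseteq> \<sigma>}. - H \<sigma> \<beta>)"
        using vs v(2) by (intro sum.cong) (auto simp: H_add_e1)
      also have "\<dots> = - G \<beta>" by (simp add: G_def sum_negf)
      finally have "G \<beta> = - (\<Sum>x\<in>Vt - ?\<tau>. p x * G (\<gamma> + e1 x))" by simp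
      also have "(\<Sum>x\<in>Vt - ?\<tau>. p x * G (\<gamma> + e1 x)) = 0"
      proof (rule sum.neutral, rule ballI)
        fix x assume x: "x \<in> Vt - ?\<tau>"
        have k: "keys (\<gamma> + e1 x) = insert x ?\<tau>" using v(3) by (subst keys_add_nat) simp
        have "G (\<gamma> + e1 x) = 0"
        proof (rule less.hyps)
          show "d - card (keys (\<gamma> + e1 x)) < d - card ?\<tau>"
            unfolding k using x lt less.prems by (simp add: card_insert_if)
          show "Suc (total_deg (\<gamma> + e1 x)) = d"
            using less.prems v(2) by simp
        qed
        then show "p x * G (\<gamma> + e1 x) = 0" by simp
      qed
      finally show ?thesis by simp
    next
      case False
      then have "{\<sigma> \<in> Fc. ?\<tau> \<subseteq> \<sigma>} = {}" by blast
      then show ?thesis unfolding G_def by (simp only: sum.empty)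
    qed
  qed
qed

definition L :: "(nat \<Rightarrow>\<^sub>0 nat) \<Rightarrow> 'k mpoly fract" where
  "L \<alpha> = (if total_deg \<alpha> = d then G \<alpha> else 0)"

lemma L_nonface: "keys \<alpha> \<notin> \<Delta> \<Longrightarrow> L \<alpha> = 0"
proof -
  assume "keys \<alpha> \<notin> \<Delta>"
  then have "{\<sigma> \<in> Fc. keys \<alpha> \<subseteq> \<sigma>} = {}" using Fc_Delta Delta_sub by blast
  then have "G \<alpha> = 0" unfolding G_def by (simp only: sum.empty)
  then show ?thesis by (simp add: L_def)
qed

lemma L_facet:
  assumes "\<sigma> \<in> Fc"
  shows "L (ind \<sigma>) = of_base (\<mu> \<sigma>) / br \<sigma>"
proof -
  have k: "keys (ind \<sigma>) = \<sigma>" using Fc_finite[OF assms] by (rule keys_ind)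
  have "{\<rho> \<in> Fc. \<sigma> \<subseteq> \<rho>} = {\<sigma>}"
    using assms Fc_card Fc_finite card_subset_eq by blast
  moreover have "(\<Prod>v\<in>\<sigma>. u \<sigma> v ^ lookup (ind \<sigma>) v / u \<sigma> v) = 1"
    using u_nonzero[OF assms] Fc_finite[OF assms] by (intro prod.neutral) (auto simp: lookup_ind)
  ultimately show ?thesis
    using Fc_card[OF assms] by (simp add: L_def G_def k total_deg_ind H_def)
qed

text \<open>Multiplication by theta_k scales the contribution of every facet by the same factor
  \<open>pvar k n\<close>, so the sum is a multiple of G in degree d - 1.\<close>

lemma L_linear_relation:
  assumes "Suc (total_deg \<beta>) = d" "k < d"
  shows "(\<Sum>v\<in>Vt. P k v * L (\<beta> + e1 v)) = 0"
proof -
  have "(\<Sum>v\<in>Vt. P k v * L (\<beta> + e1 v)) = (\<Sum>v\<in>Vt. P k v * G (\<beta> + e1 v))"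
    using assms by (simp add: L_def)
  also have "\<dots> = (\<Sum>\<sigma>\<in>{\<sigma> \<in> Fc. keys \<beta> \<subseteq> \<sigma>}. pvar k n * H \<sigma> \<beta>)"
  proof (rule sum_G_swap)
    fix \<sigma> assume s: "\<sigma> \<in> Fc"
    have "(\<Sum>x\<in>Vt \<inter> \<sigma>. P k x * u \<sigma> x) = (\<Sum>x\<in>\<sigma>. Q k x * u \<sigma> x)"
      using Fc_Vt[OF s] by (intro sum.cong) (auto simp: Q_P)
    also have "\<dots> = pvar k n" using u_sum[OF s assms(2)] .
    finally show "(\<Sum>x\<in>Vt \<inter> \<sigma>. P k x * u \<sigma> x) = pvar k n" .
  qed simp
  also have "\<dots> = pvar k n * G \<beta>" by (simp add: G_def sum_distrib_left)
  finally show ?thesis using G_eq_0[OF assms(1)] by simp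
qed

subsection \<open>Reduction to facets\<close>

definition mdeg :: "(nat \<Rightarrow>\<^sub>0 nat) \<Rightarrow> nat \<Rightarrow> nat" where
  "mdeg \<alpha> j = (\<Sum>v\<in>{v \<in> {..<n}. \<kappa> v = j}. lookup \<alpha> v)"

lemma mdeg_0 [simp]: "mdeg 0 j = 0"
  by (simp add: mdeg_def)

lemma mdeg_add [simp]: "mdeg (\<alpha> + \<beta>) j = mdeg \<alpha> j + mdeg \<beta> j"
  by (simp add: mdeg_def lookup_add sum.distrib)

lemma mdeg_e1: "v < n \<Longrightarrow> mdeg (e1 v) j = (if \<kappa> v = j then 1 else 0)"
  by (simp add: mdeg_def lookup_single when_def sum.delta)

lemma mdeg_sum: "mdeg (sum f A) j = (\<Sum>i\<in>A. mdeg (f i) j)"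
  by (induction A rule: infinite_finite_induct) auto

lemma lookup_le_mdeg: "v < n \<Longrightarrow> lookup \<alpha> v \<le> mdeg \<alpha> (\<kappa> v)"
  unfolding mdeg_def by (rule member_le_sum) auto

lemma mdeg_ind:
  assumes "\<sigma> \<in> Fc" "j < m"
  shows "mdeg (ind \<sigma>) j = a j"
proof -
  have "mdeg (ind \<sigma>) j = (\<Sum>v\<in>\<sigma>. if \<kappa> v = j then 1 else 0)"
    unfolding ind_def mdeg_sum
    by (intro sum.cong mdeg_e1) (use Fc_Vt[OF assms(1)] Vt_lt_n in auto)
  also have "\<dots> = card {v \<in> \<sigma>. \<kappa> v = j}"
    using Fc_finite[OF assms(1)] by (simp add: sum.If_cases Int_def)
  finally show ?thesis using card_color_facet[OF assms] by simp
qed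

text \<open>A repeated vertex of colour j is exchanged using theta rows of colour j only. The
  support has at most a_j vertices of this colour, so as many rows of \<open>\<I> j\<close> give an
  invertible block, and a combination of them is 1 at v and 0 on the rest of the support. Staying in
  one colour keeps the multidegree, and the coefficients stay in F. The set S is left open: S = F
  gives values in F, S = {0} gives vanishing and uniqueness.\<close>

lemma reduction:
  assumes nonface: "\<And>\<alpha>. total_deg \<alpha> = d \<Longrightarrow> keys \<alpha> \<notin> \<Delta> \<Longrightarrow> l \<alpha> = 0"
    and rel: "\<And>\<beta> k. Suc (total_deg \<beta>) = d \<Longrightarrow> k < d \<Longrightarrow> (\<Sum>v\<in>Vt. P k v * l (\<beta> + e1 v)) = 0"
    and S: "0 \<in> S" "\<And>x y. x \<in> S \<Longrightarrow> y \<in> S \<Longrightarrow> x + y \<in> S"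
      "\<And>c x. c \<in> F \<Longrightarrow> x \<in> S \<Longrightarrow> c * x \<in> S"
    and facet: "\<And>\<sigma>. \<sigma> \<in> Fc \<Longrightarrow> (\<And>j. j < m \<Longrightarrow> mdeg (ind \<sigma>) j = c j) \<Longrightarrow> l (ind \<sigma>) \<in> S"
    and deg: "total_deg \<alpha> = d" "\<And>j. j < m \<Longrightarrow> mdeg \<alpha> j = c j"
  shows "l \<alpha> \<in> S"
  using deg
proof (induction "d - card (keys \<alpha>)" arbitrary: \<alpha> rule: less_induct)
  case less
  let ?\<tau> = "keys \<alpha>"
  have S_sum: "(\<Sum>x\<in>A. f x) \<in> S" if "\<And>x. x \<in> A \<Longrightarrow> f x \<in> S" for A and f :: "nat \<Rightarrow> 'k mpoly fract"
    using that by (induction A rule: infinite_finite_induct) (auto intro: S)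
  show ?case
  proof (cases "?\<tau> \<in> \<Delta>")
    case False
    then show ?thesis using nonface less.prems S by simp
  next
    case \<tau>: True
    show ?thesis
    proof (cases "card ?\<tau> = d")
      case True
      then have "\<alpha> = ind ?\<tau>" using squarefree_eq_ind less.prems by simp
      moreover have "?\<tau> \<in> Fc" using \<tau> True by (simp add: facets_def)
      ultimately show ?thesis using facet less.prems by metis
    next
      case False
      then have lt: "card ?\<tau> < total_deg \<alpha>" using card_face_le[OF \<tau>] less.prems by simp
      obtain v \<gamma> where v: "v \<in> keys \<gamma>" "\<alpha> = \<gamma> + e1 v" "keys \<gamma> = ?\<tau>"
        using repeated_vertex[OF lt] by metis
      have v\<tau>: "v \<in> ?\<tau>" using v by simp
      have vV: "v \<in> Vt" using v\<tau> face_subset_Vt[OF \<tau>] by blast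
      define j where "j = \<kappa> v"
      have jm: "j < m" using kappa_lt[OF vV] by (simp add: j_def)
      define T where "T = {x \<in> ?\<tau>. \<kappa> x = j}"
      have finT: "finite T" by (simp add: T_def)
      have "card T \<le> card (\<I> j)" using card_color_le[OF \<tau> jm] I_card[OF jm] by (simp add: T_def)
      then obtain R where R: "R \<subseteq> \<I> j" "card R = card T" "finite R"
        using obtain_subset_with_card_n by metis
      have Rd: "k < d" "col k = j" if "k \<in> R" for k using that R in_I_iff[OF jm] by auto
      obtain V0 where V0: "bij_betw V0 R T"
        using finite_same_card_bij[OF R(3) finT R(2)] by blast
      have TC: "T \<subseteq> C k" if "k \<in> R" for k
        using Rd[OF that] face_subset_Vt[OF \<tau>] by (auto simp: C_def T_def)
      have nz: "perm P R T \<noteq> 0"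
      proof (rule perm_generic[OF R(3) finT _ V0, where D = C])
        show "V0 k \<in> C k" if "k \<in> R" for k
          using TC[OF that] bij_betwE[OF V0] that by blast
      qed (use Rd in \<open>simp add: P_eq\<close>)
      obtain w where wF: "\<And>v k. v \<in> T \<Longrightarrow> k \<in> R \<Longrightarrow> w v k \<in> F"
        and w: "\<And>v v'. v \<in> T \<Longrightarrow> v' \<in> T \<Longrightarrow> (\<Sum>k\<in>R. w v k * P k v') = (if v' = v then 1 else 0)"
        by (rule F.perm_inverse[OF two_K R(3) finT R(2) nz P_in_F]) (rule that)
      define p where "p x = (\<Sum>k\<in>R. w v k * P k x)" for x
      have vT: "v \<in> T" using v\<tau> by (simp add: T_def j_def)
      have pF: "p x \<in> F" for x
        unfolding p_def using wF vT P_in_F by (intro F.sum_closed F.mult_closed) auto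
      have p0: "p x = 0" if "\<kappa> x \<noteq> j" for x
        unfolding p_def using that Rd by (intro sum.neutral) (auto simp: P_eq C_def)
      have p\<tau>: "p x = (if x = v then 1 else 0)" if "x \<in> ?\<tau>" for x
      proof (cases "\<kappa> x = j")
        case True
        then show ?thesis using that w vT by (simp add: T_def p_def)
      next
        case False
        then show ?thesis using p0 by (auto simp: j_def)
      qed
      have "(\<Sum>x\<in>Vt. p x * l (\<gamma> + e1 x)) = (\<Sum>k\<in>R. w v k * (\<Sum>x\<in>Vt. P k x * l (\<gamma> + e1 x)))"
        unfolding p_def sum_distrib_left sum_distrib_right
        by (subst sum.swap) (simp add: mult.assoc)
      also have "\<dots> = 0" using rel[of \<gamma>] Rd less.prems v(2) by simp
      finally have "0 = (\<Sum>x\<in>Vt. p x * l (\<gamma> + e1 x))" by simp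
      also have "\<dots> = (\<Sum>x\<in>Vt - ?\<tau>. p x * l (\<gamma> + e1 x)) + (\<Sum>x\<in>?\<tau>. p x * l (\<gamma> + e1 x))"
        using finite_Vt face_subset_Vt[OF \<tau>] by (intro sum.subset_diff) auto
      also have "(\<Sum>x\<in>?\<tau>. p x * l (\<gamma> + e1 x)) = (\<Sum>x\<in>?\<tau>. if x = v then l (\<gamma> + e1 x) else 0)"
        using p\<tau> by (intro sum.cong) auto
      also have "\<dots> = l \<alpha>" using v\<tau> v(2) by simp
      finally have "l \<alpha> = (\<Sum>x\<in>Vt - ?\<tau>. - p x * l (\<gamma> + e1 x))"
        by (simp add: sum_negf eq_neg_iff_add_eq_0 add.commute)
      also have "\<dots> \<in> S"
      proof (rule S_sum)
        fix x assume x: "x \<in> Vt - ?\<tau>"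
        have k: "keys (\<gamma> + e1 x) = insert x ?\<tau>"
          using v(3) by (subst keys_add_nat) simp
        show "- p x * l (\<gamma> + e1 x) \<in> S"
        proof (cases "\<kappa> x = j")
          case True
          have "l (\<gamma> + e1 x) \<in> S"
          proof (rule less.hyps)
            show "d - card (keys (\<gamma> + e1 x)) < d - card ?\<tau>"
              unfolding k using x lt less.prems by (simp add: card_insert_if)
            show "total_deg (\<gamma> + e1 x) = d" using less.prems v(2) by simp
            show "mdeg (\<gamma> + e1 x) i = c i" if "i < m" for i
              using less.prems(2)[OF that] v(2) True vV x Vt_lt_n by (simp add: mdeg_e1 j_def)
          qed
          then show ?thesis using pF F.uminus_closed S(3) by blast
        next
          case False
          then show ?thesis using p0 S by simp
        qed
      qed
      finally show ?thesis .
    qed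
  qed
qed

lemma br_in_F: "\<sigma> \<in> Fc \<Longrightarrow> br \<sigma> \<in> F"
  unfolding br_def by (rule F.perm_closed) (use Q_P Fc_Vt P_in_F in \<open>metis subsetD\<close>)

text \<open>The indeterminates of the generic point occur in the formula but are not in F. The facet
  values and the coefficients of the relations are, and these determine everything.\<close>

lemma L_in_F: "L \<alpha> \<in> F"
proof (cases "total_deg \<alpha> = d")
  case True
  show ?thesis
  proof (rule reduction[of L F "mdeg \<alpha>"])
    fix \<sigma> assume "\<sigma> \<in> Fc"
    then show "L (ind \<sigma>) \<in> F"
      unfolding L_facet[OF \<open>\<sigma> \<in> Fc\<close>] by (intro F.divide_closed br_in_F of_base_in_ktilde)
  qed (use True L_nonface L_linear_relation in \<open>auto intro: F.zero_closed F.add_closed F.mult_closed\<close>)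
next
  case False
  then show ?thesis using F.zero_closed by (simp add: L_def)
qed

text \<open>Facets have multidegree a and the reduction preserves multidegrees, so any other
  multidegree reduces to no facet at all.\<close>

lemma L_nonzero:
  assumes "L \<alpha> \<noteq> 0"
  shows "total_deg \<alpha> = d" "keys \<alpha> \<in> \<Delta>" "keys \<alpha> \<subseteq> Vt"
    "\<And>j. j < m \<Longrightarrow> mdeg \<alpha> j = a j"
proof -
  show deg: "total_deg \<alpha> = d" using assms by (metis L_def)
  show "keys \<alpha> \<in> \<Delta>" using assms L_nonface by blast
  then show "keys \<alpha> \<subseteq> Vt" by (rule face_subset_Vt)
  fix j assume j: "j < m"
  show "mdeg \<alpha> j = a j"
  proof (rule ccontr)
    assume ne: "mdeg \<alpha> j \<noteq> a j"
    have "L \<alpha> \<in> {0}"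
    proof (rule reduction[of L "{0}" "mdeg \<alpha>"])
      fix \<sigma> assume "\<sigma> \<in> Fc" "\<And>j. j < m \<Longrightarrow> mdeg (ind \<sigma>) j = mdeg \<alpha> j"
      then show "L (ind \<sigma>) \<in> {0}" using mdeg_ind j ne by metis
    qed (use deg L_nonface L_linear_relation in auto)
    then show False using assms by simp
  qed
qed

lemma L_unique:
  assumes "\<And>\<alpha>. total_deg \<alpha> = d \<Longrightarrow> keys \<alpha> \<notin> \<Delta> \<Longrightarrow> l \<alpha> = 0"
    and "\<And>\<beta> k. Suc (total_deg \<beta>) = d \<Longrightarrow> k < d \<Longrightarrow> (\<Sum>v\<in>Vt. P k v * l (\<beta> + e1 v)) = 0"
    and "\<And>\<sigma>. \<sigma> \<in> Fc \<Longrightarrow> l (ind \<sigma>) = of_base (\<mu> \<sigma>) / br \<sigma>"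
    and "total_deg \<alpha> = d"
  shows "l \<alpha> = L \<alpha>"
proof -
  have "l \<alpha> - L \<alpha> \<in> {0}"
    by (rule reduction[of "\<lambda>\<alpha>. l \<alpha> - L \<alpha>" "{0}" "mdeg \<alpha>"])
      (use assms L_nonface L_linear_relation in \<open>auto simp: L_facet right_diff_distrib sum_subtractf\<close>)
  then show ?thesis by simp
qed

subsection \<open>A self-similarity of the functional\<close>

definition E :: "(nat \<Rightarrow>\<^sub>0 nat) \<Rightarrow> 'k mpoly fract" where
  "E \<gamma> = (if \<exists>\<beta>. \<gamma> = \<beta> + \<beta> then dbl (L (THE \<beta>. \<gamma> = \<beta> + \<beta>)) else 0)"

lemma E_double: "E (\<beta> + \<beta>) = dbl (L \<beta>)"
  unfolding E_def by (simp add: add_self_inj)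

lemma E_nonzero:
  assumes "E \<gamma> \<noteq> 0"
  obtains \<beta> where "\<gamma> = \<beta> + \<beta>" "L \<beta> \<noteq> 0"
proof -
  obtain \<beta> where \<beta>: "\<gamma> = \<beta> + \<beta>" using assms by (auto simp: E_def split: if_splits)
  then show ?thesis using assms that E_double by auto
qed

lemma E_in_range: "\<exists>y. E \<gamma> = dbl y"
  by (cases "E \<gamma> = 0") (auto elim!: E_nonzero simp: E_double intro: exI[of _ 0])

lemma E_nonface: "keys \<alpha> \<notin> \<Delta> \<Longrightarrow> E (\<delta> + \<alpha>) = 0"
proof (rule ccontr)
  assume *: "keys \<alpha> \<notin> \<Delta>" "E (\<delta> + \<alpha>) \<noteq> 0"
  then obtain \<beta> where \<beta>: "\<delta> + \<alpha> = \<beta> + \<beta>" "L \<beta> \<noteq> 0" by (metis E_nonzero)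
  have "keys \<delta> \<union> keys \<alpha> = keys \<beta>"
    using arg_cong[OF \<beta>(1), of keys] by (simp add: keys_add_nat)
  then show False using L_nonzero(2)[OF \<beta>(2)] Delta_sub * by blast
qed

text \<open>For k < d this is theta_k, while \<open>row (d + j)\<close> is the generic linear form
  of colour j.\<close>

definition row :: "nat \<Rightarrow> 'k mpoly fract mpoly" where
  "row k = (\<Sum>v\<in>C k. Poly_Mapping.single (e1 v) (pvar k v))"

lemma single_eq_const_mult:
  "Poly_Mapping.single \<alpha> (c::'b::comm_ring_1) = const c * mon \<alpha>"
  by (simp add: const_def mult_single)

lemma row_eq: "k < d \<Longrightarrow> row k = (\<Sum>v\<in>Vt. Poly_Mapping.single (e1 v) (P k v))"
  unfolding row_def using finite_Vt
  by (intro sum.mono_neutral_cong_left) (auto simp: P_eq C_def)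

lemma theta_eq_row: "k < d \<Longrightarrow> theta \<Delta> \<kappa> \<I> k = row k"
  unfolding theta_def row_eq X_def by (simp add: const_def mult_single)

lemma prod_single:
  "(\<Prod>i\<in>A. Poly_Mapping.single (f i) (c i)) =
    Poly_Mapping.single (\<Sum>i\<in>A. f i) (\<Prod>i\<in>A. c i :: 'a::comm_semiring_1)"
  by (induction A rule: infinite_finite_induct) (auto simp: mult_single)

lemma prod_row:
  assumes "finite Z"
  shows "(\<Prod>k\<in>Z. row k) =
    (\<Sum>V\<in>Pi\<^sub>E Z C. Poly_Mapping.single (\<Sum>k\<in>Z. e1 (V k)) (\<Prod>k\<in>Z. pvar k (V k)))"
  unfolding row_def using assms finite_C by (simp add: prod_sum_PiE prod_single)

lemma lin_single_mult:
  "lin l (Poly_Mapping.single \<alpha> (c::'b::comm_ring_1) * f) = c * lin (\<lambda>\<beta>. l (\<alpha> + \<beta>)) f"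
  by (subst lin_mult) (simp add: lin_def sum_distrib_left mult_ac)

text \<open>An assignment V picks one vertex from each row; the coefficients that arise are the
  squarefree monomials of \<open>squarefree_independent\<close>.\<close>

lemma lin_E_prod_row:
  assumes "finite Z"
  shows "lin E ((\<Prod>k\<in>Z. row k) * f) =
    (\<Sum>V\<in>Pi\<^sub>E Z C. (\<Prod>k\<in>Z. pvar k (V k)) * lin (\<lambda>\<beta>. E ((\<Sum>k\<in>Z. e1 (V k)) + \<beta>)) f)"
  unfolding prod_row[OF assms] sum_distrib_right lin_sum lin_single_mult ..

lemma two_poly: "(2::'k mpoly fract mpoly) = 0"
  by (metis two_K single_numeral single_zero)

lemma even_cancel: "(\<exists>\<beta>. \<alpha> + \<alpha> + \<gamma> = \<beta> + \<beta>) \<longleftrightarrow> (\<exists>\<beta>. \<gamma> = \<beta> + (\<beta> :: 'b \<Rightarrow>\<^sub>0 nat))"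
proof
  assume "\<exists>\<beta>. \<alpha> + \<alpha> + \<gamma> = \<beta> + \<beta>"
  then obtain \<beta> where \<beta>: "\<alpha> + \<alpha> + \<gamma> = \<beta> + \<beta>" ..
  have "\<gamma> = (\<beta> - \<alpha>) + (\<beta> - \<alpha>)"
  proof (rule poly_mapping_eqI)
    fix v show "lookup \<gamma> v = lookup ((\<beta> - \<alpha>) + (\<beta> - \<alpha>)) v"
      using arg_cong[OF \<beta>, of "\<lambda>f. lookup f v"] by (simp add: lookup_add lookup_minus)
  qed
  then show "\<exists>\<beta>. \<gamma> = \<beta> + \<beta>" ..
next
  assume "\<exists>\<beta>. \<gamma> = \<beta> + \<beta>"
  then obtain \<beta> where "\<gamma> = \<beta> + \<beta>" ..
  then have "\<alpha> + \<alpha> + \<gamma> = (\<alpha> + \<beta>) + (\<alpha> + \<beta>)" by (simp add: ac_simps)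
  then show "\<exists>\<beta>. \<alpha> + \<alpha> + \<gamma> = \<beta> + \<beta>" ..
qed

text \<open>The square of the row has only even exponents. On a monomial that is not a square, E
  therefore vanishes; on x^(2 beta) the value is \<open>dbl\<close> of L (theta_k x^beta), which is
  zero by the linear relation.\<close>

lemma lin_E_row_square:
  assumes k: "k < d"
  shows "lin E (row k ^ 2 * f) = 0"
proof -
  have sq: "row k ^ 2 = (\<Sum>v\<in>Vt. Poly_Mapping.single (e1 v + e1 v) ((P k v)\<^sup>2))"
    unfolding row_eq[OF k] char_2_square_sum[OF two_poly]
    by (simp add: power2_eq_square mult_single)
  have "lin E (row k ^ 2 * mon \<gamma>) = 0" for \<gamma>
  proof -
    have l: "lin E (row k ^ 2 * mon \<gamma>) = (\<Sum>v\<in>Vt. (P k v)\<^sup>2 * E (e1 v + e1 v + \<gamma>))"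
      unfolding sq by (simp add: sum_distrib_right lin_sum mult_single)
    show ?thesis
    proof (cases "\<exists>\<beta>. \<gamma> = \<beta> + \<beta>")
      case True
      then obtain \<beta> where \<beta>: "\<gamma> = \<beta> + \<beta>" ..
      have "e1 v + e1 v + \<gamma> = (\<beta> + e1 v) + (\<beta> + e1 v)" for v
        by (simp add: \<beta> ac_simps)
      then have "E (e1 v + e1 v + \<gamma>) = dbl (L (\<beta> + e1 v))" for v by (simp only: E_double)
      moreover have "(P k v)\<^sup>2 = dbl (P k v)" for v using k by (simp add: P_eq dbl_pvar)
      ultimately have "lin E (row k ^ 2 * mon \<gamma>) = dbl (\<Sum>v\<in>Vt. P k v * L (\<beta> + e1 v))"
        unfolding l by (simp add: dbl_sum dbl_mult)
      moreover have "(\<Sum>v\<in>Vt. P k v * L (\<beta> + e1 v)) = 0"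
      proof (cases "Suc (total_deg \<beta>) = d")
        case True
        then show ?thesis using L_linear_relation k by blast
      qed (simp add: L_def)
      ultimately show ?thesis by simp
    next
      case False
      then have "E (e1 v + e1 v + \<gamma>) = 0" for v unfolding E_def using even_cancel by auto
      then show ?thesis unfolding l by simp
    qed
  qed
  then show ?thesis by (rule lin_mult_eq_0)
qed

text \<open>The bracket is a sum of products of indeterminates with coefficient 1, and on those
  \<open>dbl\<close> and squaring agree.\<close>

lemma dbl_br: "dbl (br \<sigma>) = (br \<sigma>)\<^sup>2" if "\<sigma> \<in> Fc"
proof -
  have "dbl (Q k v) = (Q k v)\<^sup>2" if "k < d" for k v
    using that by (simp add: Q_eq dbl_pvar)
  then show ?thesis
    unfolding br_def perm_def
    by (simp add: dbl_sum dbl_prod char_2_square_sum[OF two_K] prod_power_distrib)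
qed

definition Theta :: "'k mpoly fract mpoly" where
  "Theta = (\<Prod>k<d. row k)"

lemma lin_E_Theta_mono:
  "lin E (Theta * mon \<alpha>) =
    (\<Sum>V\<in>Pi\<^sub>E {..<d} C. (\<Prod>k<d. pvar k (V k)) * E ((\<Sum>k<d. e1 (V k)) + \<alpha>))"
  unfolding Theta_def by (simp add: lin_E_prod_row mult_single)

text \<open>If E is nonzero, the support is a face containing the facet, hence equal to it, so V
  maps into the facet. The facet contributes exponent 1 at each of its vertices, so parity forces V
  to hit all of them, and d rows hitting d vertices form a bijection.\<close>

lemma E_facet_assignment:
  assumes \<sigma>: "\<sigma> \<in> Fc" and V: "V \<in> Pi\<^sub>E {..<d} C"
  shows "E ((\<Sum>k<d. e1 (V k)) + ind \<sigma>) = (if bij_betw V {..<d} \<sigma> then dbl (L (ind \<sigma>)) else 0)"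
proof (cases "bij_betw V {..<d} \<sigma>")
  case True
  then have "(\<Sum>k<d. e1 (V k)) = ind \<sigma>"
    unfolding ind_def by (rule sum.reindex_bij_betw)
  then show ?thesis using True by (simp add: E_double)
next
  case False
  have "E ((\<Sum>k<d. e1 (V k)) + ind \<sigma>) = 0"
  proof (rule ccontr)
    let ?e = "\<Sum>k<d. e1 (V k)"
    assume "E (?e + ind \<sigma>) \<noteq> 0"
    then obtain \<beta> where \<beta>: "?e + ind \<sigma> = \<beta> + \<beta>" "L \<beta> \<noteq> 0" by (metis E_nonzero)
    have ke: "keys ?e = V ` {..<d}" by (auto simp: keys_sum_nat)
    have k: "V ` {..<d} \<union> \<sigma> = keys \<beta>"
      using arg_cong[OF \<beta>(1), of keys]
      by (simp add: keys_add_nat keys_ind Fc_finite[OF \<sigma>] ke)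
    have "card (keys \<beta>) \<le> card \<sigma>"
      using card_face_le[OF L_nonzero(2)[OF \<beta>(2)]] Fc_card[OF \<sigma>] by simp
    then have "\<sigma> = keys \<beta>"
      using k by (intro card_seteq) auto
    then have sub: "V ` {..<d} \<subseteq> \<sigma>" using k by blast
    have "w \<in> V ` {..<d}" if w: "w \<in> \<sigma>" for w
    proof (rule ccontr)
      assume "w \<notin> V ` {..<d}"
      then have "lookup ?e w = 0" using ke by (metis not_in_keys_iff_lookup_eq_zero)
      then show False
        using arg_cong[OF \<beta>(1), of "\<lambda>f. lookup f w"] w Fc_finite[OF \<sigma>]
        by (simp add: lookup_add lookup_ind) presburger
    qed
    then have im: "V ` {..<d} = \<sigma>" using sub by blast
    then have "inj_on V {..<d}" using Fc_card[OF \<sigma>] by (intro eq_card_imp_inj_on) auto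
    then show False using False im by (simp add: bij_betw_def)
  qed
  then show ?thesis using False by simp
qed

lemma br_eq_sum:
  assumes "\<sigma> \<in> Fc"
  shows "br \<sigma> = (\<Sum>V\<in>Pi\<^sub>E {..<d} C. if bij_betw V {..<d} \<sigma> then \<Prod>k<d. pvar k (V k) else 0)"
proof -
  have "br \<sigma> = (\<Sum>V\<in>{V \<in> Pi\<^sub>E {..<d} C. bij_betw V {..<d} \<sigma>}. \<Prod>k<d. pvar k (V k))"
    unfolding br_def perm_def
  proof (rule sum.mono_neutral_cong_right)
    show "finite {V \<in> {..<d} \<rightarrow>\<^sub>E \<sigma>. bij_betw V {..<d} \<sigma>}"
      using Fc_finite[OF assms] by (simp add: finite_PiE)
    show "{V \<in> Pi\<^sub>E {..<d} C. bij_betw V {..<d} \<sigma>} \<subseteq> {V \<in> {..<d} \<rightarrow>\<^sub>E \<sigma>. bij_betw V {..<d} \<sigma>}"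
      by (auto simp: PiE_def bij_betw_def)
    show "\<forall>V\<in>{V \<in> {..<d} \<rightarrow>\<^sub>E \<sigma>. bij_betw V {..<d} \<sigma>} - {V \<in> Pi\<^sub>E {..<d} C. bij_betw V {..<d} \<sigma>}.
        (\<Prod>k<d. Q k (V k)) = 0"
    proof
      fix V assume V: "V \<in> {V \<in> {..<d} \<rightarrow>\<^sub>E \<sigma>. bij_betw V {..<d} \<sigma>} -
        {V \<in> Pi\<^sub>E {..<d} C. bij_betw V {..<d} \<sigma>}"
      then obtain k where k: "k < d" "V k \<notin> C k" "V k \<in> \<sigma>" by (auto simp: PiE_def Pi_def)
      then have "V k \<in> Vt" using Fc_Vt[OF assms] by blast
      then have "V k \<noteq> n" using n_notin_Vt by metis
      then have "Q k (V k) = 0" using k by (simp add: Q_eq)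
      then show "(\<Prod>k<d. Q k (V k)) = 0" using k(1) by (intro prod_zero) auto
    qed
    fix V assume "V \<in> {V \<in> Pi\<^sub>E {..<d} C. bij_betw V {..<d} \<sigma>}"
    then show "(\<Prod>k<d. Q k (V k)) = (\<Prod>k<d. pvar k (V k))"
      by (intro prod.cong) (auto simp: Q_eq PiE_def Pi_def)
  qed
  then show ?thesis
    by (simp add: sum.inter_filter finite_PiE finite_C)
qed

text \<open>Both sides satisfy the relations characterizing \<open>L\<close>: on the right \<open>\<theta>\<^sub>k\<close> kills everything since
  \<open>\<theta>\<^sub>k\<^sup>2 = \<Sum>\<^sub>v p\<^sub>k\<^sub>,\<^sub>v\<^sup>2 x\<^sub>v\<^sup>2\<close> in characteristic two. This replaces the differential identities of
  Papadakis and Petrotou.\<close>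

lemma L_eq_lin_E: "L \<alpha> = lin E (Theta * mon \<alpha>)"
proof (cases "total_deg \<alpha> = d")
  case True
  have "lin E (Theta * mon \<alpha>) = L \<alpha>"
  proof (rule L_unique[of "\<lambda>\<alpha>. lin E (Theta * mon \<alpha>)", OF _ _ _ True])
    fix \<alpha> :: "nat \<Rightarrow>\<^sub>0 nat" assume "keys \<alpha> \<notin> \<Delta>"
    then show "lin E (Theta * mon \<alpha>) = 0" by (simp add: lin_E_Theta_mono E_nonface)
  next
    fix \<beta> k assume k: "k < d"
    have "(\<Sum>v\<in>Vt. P k v * lin E (Theta * mon (\<beta> + e1 v))) = lin E (Theta * mon \<beta> * row k)"
      unfolding row_eq[OF k] sum_distrib_left lin_sum
    proof (intro sum.cong refl)
      fix v
      show "P k v * lin E (Theta * mon (\<beta> + e1 v)) =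
          lin E (Theta * mon \<beta> * Poly_Mapping.single (e1 v) (P k v))"
        unfolding single_eq_const_mult[of _ "P k v"] mon_add lin_const_mult[symmetric]
        by (simp only: mult_ac)
    qed
    \<comment> \<open>theta_k already occurs in \<open>Theta\<close>, so multiplying by it produces
      its square.\<close>
    also have "Theta * mon \<beta> * row k = row k ^ 2 * ((\<Prod>i\<in>{..<d} - {k}. row i) * mon \<beta>)"
      unfolding Theta_def using k by (simp add: prod.remove[of "{..<d}" k] power2_eq_square mult_ac)
    also have "lin E \<dots> = 0" by (rule lin_E_row_square[OF k])
    finally show "(\<Sum>v\<in>Vt. P k v * lin E (Theta * mon (\<beta> + e1 v))) = 0" .
  next
    fix \<sigma> assume s: "\<sigma> \<in> Fc"
    have "lin E (Theta * mon (ind \<sigma>)) =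
      (\<Sum>V\<in>Pi\<^sub>E {..<d} C. (if bij_betw V {..<d} \<sigma> then \<Prod>k<d. pvar k (V k) else 0) * dbl (L (ind \<sigma>)))"
      unfolding lin_E_Theta_mono by (intro sum.cong) (auto simp: E_facet_assignment[OF s])
    also have "\<dots> = br \<sigma> * dbl (L (ind \<sigma>))"
      by (simp add: br_eq_sum[OF s] sum_distrib_right)
    \<comment> \<open>br * dbl (mu / br) = br * mu / br^2: the bracket is squared, the coefficient
      of the cycle is fixed.\<close>
    also have "\<dots> = of_base (\<mu> \<sigma>) / br \<sigma>"
      using br_nonzero[OF s] by (simp add: L_facet[OF s] dbl_divide dbl_br[OF s] power2_eq_square)
    finally show "lin E (Theta * mon (ind \<sigma>)) = of_base (\<mu> \<sigma>) / br \<sigma>" .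
  qed
  then show ?thesis by simp
next
  case False
  \<comment> \<open>A square on which E is nonzero has total degree 2d, and the rows account for d
    of it.\<close>
  have "E ((\<Sum>k<d. e1 (V k)) + \<alpha>) = 0" for V
  proof (rule ccontr)
    assume "E ((\<Sum>k<d. e1 (V k)) + \<alpha>) \<noteq> 0"
    then obtain \<beta> where \<beta>: "(\<Sum>k<d. e1 (V k)) + \<alpha> = \<beta> + \<beta>" "L \<beta> \<noteq> 0" by (metis E_nonzero)
    show False
      using arg_cong[OF \<beta>(1), of total_deg] L_nonzero(1)[OF \<beta>(2)] False
      by (simp add: total_deg_sum)
  qed
  then show ?thesis using False by (simp add: lin_E_Theta_mono L_def)
qed

lemma lin_L_eq_lin_E: "lin L f = lin E (Theta * f)"
  by (subst lin_mult_sum_mono) (simp add: lin_def[of L] L_eq_lin_E)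

end

subsection \<open>Dual families\<close>

text \<open>Take S maximal among the sets of rows of N with a dual family over F. A row outside the
  span has a nonzero residue in some column, which would allow it to be added. Dual vectors express
  independence and coordinates at once.\<close>

lemma (in subfield_set) exists_dual_family:
  assumes fin: "finite R" "finite D"
    and N: "\<And>r c. r \<in> R \<Longrightarrow> c \<in> D \<Longrightarrow> N r c \<in> F"
  obtains S w where "S \<subseteq> R"
    "\<And>s c. s \<in> S \<Longrightarrow> c \<in> D \<Longrightarrow> w s c \<in> F"
    "\<And>s s'. s \<in> S \<Longrightarrow> s' \<in> S \<Longrightarrow> (\<Sum>c\<in>D. w s c * N s' c) = (if s' = s then 1 else 0)"
    "\<And>r c. r \<in> R \<Longrightarrow> c \<in> D \<Longrightarrow> N r c = (\<Sum>s\<in>S. (\<Sum>c'\<in>D. w s c' * N r c') * N s c)"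
proof -
  define good where "good S w \<longleftrightarrow> S \<subseteq> R \<and> (\<forall>s\<in>S. \<forall>c\<in>D. w s c \<in> F) \<and>
    (\<forall>s\<in>S. \<forall>s'\<in>S. (\<Sum>c\<in>D. w s c * N s' c) = (if s' = s then 1 else 0))"
    for S and w :: "'b \<Rightarrow> 'c \<Rightarrow> 'a"
  define A where "A = {S. \<exists>w. good S w}"
  have "A \<subseteq> Pow R" by (auto simp: A_def good_def)
  then have "finite A" using fin by (simp add: finite_subset)
  moreover have "{} \<in> A" by (auto simp: A_def good_def)
  ultimately obtain S where S: "S \<in> A" "\<And>T. T \<in> A \<Longrightarrow> S \<subseteq> T \<Longrightarrow> T = S"
    using finite_has_maximal[of A] by blast
  then obtain w where w: "good S w" by (auto simp: A_def)
  have SR: "S \<subseteq> R" and wF: "\<And>s c. s \<in> S \<Longrightarrow> c \<in> D \<Longrightarrow> w s c \<in> F"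
    and dual: "\<And>s s'. s \<in> S \<Longrightarrow> s' \<in> S \<Longrightarrow> (\<Sum>c\<in>D. w s c * N s' c) = (if s' = s then 1 else 0)"
    using w by (auto simp: good_def)
  have finS: "finite S" using SR fin finite_subset by blast
  have span: "N r c = (\<Sum>s\<in>S. (\<Sum>c'\<in>D. w s c' * N r c') * N s c)"
    if r: "r \<in> R" and c: "c \<in> D" for r c
  proof (rule ccontr)
    define cf where "cf s = (\<Sum>c'\<in>D. w s c' * N r c')" for s
    define res where "res c = N r c - (\<Sum>s\<in>S. cf s * N s c)" for c
    assume "N r c \<noteq> (\<Sum>s\<in>S. (\<Sum>c'\<in>D. w s c' * N r c') * N s c)"
    then have nz: "res c \<noteq> 0" by (simp add: res_def cf_def)
    have cfF: "cf s \<in> F" if "s \<in> S" for s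
      unfolding cf_def using that wF N r by (intro sum_closed mult_closed) auto
    have resF: "res c \<in> F"
      unfolding res_def using that cfF N SR r c by (intro diff_closed sum_closed mult_closed) auto
    have rS: "r \<notin> S"
    proof
      assume rS: "r \<in> S"
      have "(\<Sum>s\<in>S. cf s * N s c) = (\<Sum>s\<in>S. if s = r then N s c else 0)"
        using dual rS by (intro sum.cong) (auto simp: cf_def)
      then show False using nz rS finS by (simp add: res_def)
    qed
    \<comment> \<open>Evaluation in column c, corrected to vanish on the rows in S and normalized to
      1 on r.\<close>
    define wr where "wr c' = ((if c' = c then 1 else 0) - (\<Sum>s\<in>S. N s c * w s c')) / res c" for c'
    have wr: "(\<Sum>c'\<in>D. wr c' * g c') = (g c - (\<Sum>s\<in>S. N s c * (\<Sum>c'\<in>D. w s c' * g c'))) / res c"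
      for g
    proof -
      have "(\<Sum>c'\<in>D. wr c' * g c') =
          ((\<Sum>c'\<in>D. (if c' = c then 1 else 0) * g c')
            - (\<Sum>c'\<in>D. \<Sum>s\<in>S. N s c * w s c' * g c')) / res c"
        unfolding wr_def
        by (simp add: diff_divide_distrib left_diff_distrib sum_subtractf sum_divide_distrib
            sum_distrib_right)
      also have "(\<Sum>c'\<in>D. (if c' = c then 1 else 0) * g c') = g c"
        using c fin by (simp add: sum.delta if_distrib[of "\<lambda>x. x * _"] cong: if_cong)
      also have "(\<Sum>c'\<in>D. \<Sum>s\<in>S. N s c * w s c' * g c') = (\<Sum>s\<in>S. N s c * (\<Sum>c'\<in>D. w s c' * g c'))"
        by (subst sum.swap) (simp add: sum_distrib_left mult.assoc)
      finally show ?thesis .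
    qed
    have wr_s: "(\<Sum>c'\<in>D. wr c' * N s' c') = 0" if s': "s' \<in> S" for s'
    proof -
      have "(\<Sum>s\<in>S. N s c * (\<Sum>c'\<in>D. w s c' * N s' c')) = (\<Sum>s\<in>S. if s = s' then N s c else 0)"
        using dual s' by (intro sum.cong) auto
      then show ?thesis using s' finS by (simp add: wr)
    qed
    have wr_r: "(\<Sum>c'\<in>D. wr c' * N r c') = 1"
      using nz by (simp add: wr res_def cf_def mult.commute)
    \<comment> \<open>The old dual vectors are corrected by a multiple of \<open>wr\<close> so that
      they vanish on r.\<close>
    define w' where "w' s c' = (if s = r then wr c' else w s c' - cf s * wr c')" for s c'
    have dual': "(\<Sum>c'\<in>D. w' s c' * N s' c') = (if s' = s then 1 else 0)"
      if "s \<in> insert r S" "s' \<in> insert r S" for s s'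
    proof (cases "s = r")
      case True
      then show ?thesis using that wr_s wr_r rS by (auto simp: w'_def)
    next
      case False
      then have "(\<Sum>c'\<in>D. w' s c' * N s' c') =
        (\<Sum>c'\<in>D. w s c' * N s' c') - cf s * (\<Sum>c'\<in>D. wr c' * N s' c')"
        by (simp add: w'_def left_diff_distrib sum_subtractf sum_distrib_left mult.assoc)
      then show ?thesis using False that wr_s wr_r dual by (auto simp: cf_def)
    qed
    have wrF: "wr c' \<in> F" if "c' \<in> D" for c'
      unfolding wr_def using that wF N SR resF c zero_closed one_closed
      by (intro divide_closed diff_closed sum_closed mult_closed) auto
    have "good (insert r S) w'"
      unfolding good_def using dual' SR r wrF wF cfF
      by (auto simp: w'_def intro!: diff_closed mult_closed)
    then have "insert r S \<in> A" by (auto simp: A_def)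
    then show False using S(2) rS by blast
  qed
  show ?thesis by (rule that[OF SR wF dual span])
qed

section \<open>Multidegrees and bases of the graded pieces\<close>

context balanced_cycle
begin

definition Mon :: "(nat \<Rightarrow> nat) \<Rightarrow> (nat \<Rightarrow>\<^sub>0 nat) set" where
  "Mon b = {\<alpha>. keys \<alpha> \<subseteq> Vt \<and> (\<forall>j<m. mdeg \<alpha> j = b j)}"

lemma finite_Mon: "finite (Mon b)"
proof (rule finite_imageD)
  let ?f = "\<lambda>\<alpha>. restrict (lookup \<alpha>) Vt"
  have "?f ` Mon b \<subseteq> Pi\<^sub>E Vt (\<lambda>v. {..b (\<kappa> v)})"
  proof (rule image_subsetI, rule PiE_I)
    fix \<alpha> v assume \<alpha>: "\<alpha> \<in> Mon b" and v: "v \<in> Vt"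
    have "lookup \<alpha> v \<le> b (\<kappa> v)"
      using lookup_le_mdeg[OF Vt_lt_n[OF v], of \<alpha>] \<alpha> kappa_lt[OF v] by (simp add: Mon_def)
    then show "?f \<alpha> v \<in> {..b (\<kappa> v)}" using v by simp
  qed auto
  then show "finite (?f ` Mon b)"
    by (rule finite_subset) (simp add: finite_PiE finite_Vt)
  show "inj_on ?f (Mon b)"
  proof (rule inj_onI, rule poly_mapping_eqI)
    fix \<alpha> \<beta> v assume *: "\<alpha> \<in> Mon b" "\<beta> \<in> Mon b" "?f \<alpha> = ?f \<beta>"
    show "lookup \<alpha> v = lookup \<beta> v"
    proof (cases "v \<in> Vt")
      case True
      then show ?thesis using fun_cong[OF *(3), of v] by simp
    next
      case False
      then have "v \<notin> keys \<alpha>" "v \<notin> keys \<beta>"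
        using * by (auto simp: Mon_def)
      then show ?thesis by (simp add: not_in_keys_iff_lookup_eq_zero)
    qed
  qed
qed

definition homog :: "(nat \<Rightarrow> nat) \<Rightarrow> 'k mpoly fract mpoly \<Rightarrow> bool" where
  "homog b f \<longleftrightarrow> (\<forall>\<alpha>\<in>keys f. \<forall>j<m. mdeg \<alpha> j = b j)"

lemma homog_0 [simp]: "homog b 0"
  by (simp add: homog_def)

lemma homog_single: "(\<And>j. j < m \<Longrightarrow> mdeg \<alpha> j = b j) \<Longrightarrow> homog b (Poly_Mapping.single \<alpha> c)"
  by (simp add: homog_def)

lemma homog_add: "homog b f \<Longrightarrow> homog b g \<Longrightarrow> homog b (f + g)"
  using Poly_Mapping.keys_add[of f g] by (fastforce simp: homog_def)

lemma homog_sum: "(\<And>i. i \<in> A \<Longrightarrow> homog b (f i)) \<Longrightarrow> homog b (sum f A)"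
  by (induction A rule: infinite_finite_induct) (auto intro: homog_add)

lemma homog_mult: "homog b f \<Longrightarrow> homog c g \<Longrightarrow> homog (\<lambda>j. b j + c j) (f * g)"
  using keys_mult[of f g] by (fastforce simp: homog_def)

lemma homog_cong: "homog b f \<Longrightarrow> (\<And>j. j < m \<Longrightarrow> b j = c j) \<Longrightarrow> homog c f"
  by (simp add: homog_def)

lemma homog_power: "homog b f \<Longrightarrow> homog (\<lambda>j. i * b j) (f ^ i)"
proof (induction i)
  case 0
  then show ?case by (simp add: homog_def)
next
  case (Suc i)
  from homog_mult[OF Suc.prems Suc.IH[OF Suc.prems]] show ?case by (simp add: algebra_simps)
qed

lemma homog_prod: "(\<And>i. i \<in> A \<Longrightarrow> homog (b i) (f i)) \<Longrightarrow> homog (\<lambda>j. \<Sum>i\<in>A. b i j) (prod f A)"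
proof (induction A rule: infinite_finite_induct)
  case (insert x A)
  from homog_mult[of "b x" "f x", OF _ insert.IH] insert show ?case by simp
qed (auto simp: homog_def)

lemma homog_prod_powers:
  assumes "\<And>j. j < m \<Longrightarrow> homog (unit_vec_nat j) (f j)"
  shows "homog e (\<Prod>j<m. f j ^ e j)"
proof -
  have "homog (\<lambda>i. \<Sum>j<m. e j * unit_vec_nat j i) (\<Prod>j<m. f j ^ e j)"
    using assms by (intro homog_prod homog_power) auto
  then show ?thesis
    by (rule homog_cong) (simp add: unit_vec_nat_def if_distrib[of "\<lambda>x. _ * x"] sum.delta cong: if_cong)
qed

lemma lin_L_mult_degree:
  assumes "homog b f" "\<And>j. j < m \<Longrightarrow> b j \<le> a j" "lin L (f * mon N) \<noteq> 0"
  shows "N \<in> Mon (\<lambda>j. a j - b j)"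
proof -
  have "lin (\<lambda>\<alpha>. L (\<alpha> + N)) f \<noteq> 0" using assms(3) by (simp add: lin_mult_mono)
  then obtain \<alpha> where \<alpha>: "\<alpha> \<in> keys f" "L (\<alpha> + N) \<noteq> 0"
    unfolding lin_def by (metis (no_types, lifting) mult_zero_right sum.neutral)
  have "keys N \<subseteq> Vt" using L_nonzero(3)[OF \<alpha>(2)] by (simp add: keys_add_nat)
  moreover have "mdeg N j = a j - b j" if "j < m" for j
    using L_nonzero(4)[OF \<alpha>(2) that] assms(1) \<alpha>(1) that by (auto simp: homog_def)
  ultimately show ?thesis by (simp add: Mon_def)
qed

text \<open>For b <= a, the matrix L (r + M) represents the pairing of multidegrees b and a - b. A
  basis S of its row space consists of monomials representing a basis of B(mu) in multidegree b, and
  w yields the coordinates.\<close>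

definition is_basis :: "(nat \<Rightarrow> nat) \<Rightarrow> (nat \<Rightarrow>\<^sub>0 nat) set \<Rightarrow>
    ((nat \<Rightarrow>\<^sub>0 nat) \<Rightarrow> (nat \<Rightarrow>\<^sub>0 nat) \<Rightarrow> 'k mpoly fract) \<Rightarrow> bool" where
  "is_basis b S w \<longleftrightarrow> S \<subseteq> Mon b \<and>
    (\<forall>s\<in>S. \<forall>M\<in>Mon (\<lambda>j. a j - b j). w s M \<in> F) \<and>
    (\<forall>s\<in>S. \<forall>s'\<in>S. (\<Sum>M\<in>Mon (\<lambda>j. a j - b j). w s M * L (s' + M)) = (if s' = s then 1 else 0)) \<and>
    (\<forall>r\<in>Mon b. \<forall>M\<in>Mon (\<lambda>j. a j - b j).
      L (r + M) = (\<Sum>s\<in>S. (\<Sum>M'\<in>Mon (\<lambda>j. a j - b j). w s M' * L (r + M')) * L (s + M)))"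

lemma exists_basis: "\<exists>S w. is_basis b S w"
proof -
  obtain S w where "S \<subseteq> Mon b"
    "\<And>s c. s \<in> S \<Longrightarrow> c \<in> Mon (\<lambda>j. a j - b j) \<Longrightarrow> w s c \<in> F"
    "\<And>s s'. s \<in> S \<Longrightarrow> s' \<in> S \<Longrightarrow>
      (\<Sum>c\<in>Mon (\<lambda>j. a j - b j). w s c * L (s' + c)) = (if s' = s then 1 else 0)"
    "\<And>r c. r \<in> Mon b \<Longrightarrow> c \<in> Mon (\<lambda>j. a j - b j) \<Longrightarrow>
      L (r + c) = (\<Sum>s\<in>S. (\<Sum>c'\<in>Mon (\<lambda>j. a j - b j). w s c' * L (r + c')) * L (s + c))"
    by (rule F.exists_dual_family[of "Mon b" "Mon (\<lambda>j. a j - b j)" "\<lambda>r c. L (r + c)"])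
      (auto simp: finite_Mon L_in_F)
  then have "is_basis b S w" unfolding is_basis_def by blast
  then show ?thesis by blast
qed

definition coord :: "(nat \<Rightarrow> nat) \<Rightarrow> ((nat \<Rightarrow>\<^sub>0 nat) \<Rightarrow> (nat \<Rightarrow>\<^sub>0 nat) \<Rightarrow> 'k mpoly fract) \<Rightarrow>
    (nat \<Rightarrow>\<^sub>0 nat) \<Rightarrow> 'k mpoly fract mpoly \<Rightarrow> 'k mpoly fract" where
  "coord b w s f = (\<Sum>M\<in>Mon (\<lambda>j. a j - b j). w s M * lin L (f * mon M))"

context
  fixes b S w
  assumes b: "\<And>j. j < m \<Longrightarrow> b j \<le> a j" and basis: "is_basis b S w"
begin

lemma basis_finite: "finite S"
  using basis finite_Mon finite_subset unfolding is_basis_def by metis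

lemma basis_hom: "s \<in> S \<Longrightarrow> homog b (Poly_Mapping.single s c)"
  using basis by (intro homog_single) (auto simp: is_basis_def Mon_def)

lemma coord_basis: "s \<in> S \<Longrightarrow> s' \<in> S \<Longrightarrow> coord b w s (mon s') = (if s' = s then 1 else 0)"
  using basis by (simp add: is_basis_def coord_def mult_single)

lemma coord_add: "coord b w s (f + g) = coord b w s f + coord b w s g"
  by (simp add: coord_def distrib_right lin_add distrib_left sum.distrib)

lemma coord_const_mult: "coord b w s (const c * f) = c * coord b w s f"
proof -
  have "lin L (const c * f * mon M) = c * lin L (f * mon M)" for M
    by (simp only: mult.assoc lin_const_mult)
  then show ?thesis by (simp add: coord_def sum_distrib_left mult.left_commute)
qed

lemma coord_sum: "coord b w s (sum f A) = (\<Sum>i\<in>A. coord b w s (f i))"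
  by (simp add: coord_def sum_distrib_right lin_sum sum_distrib_left sum.swap[of _ A])

text \<open>Under \<open>L\<close>, f may be replaced by its expansion in the basis. For a monomial
  r of multidegree b paired with a monomial of multidegree a - b this is the spanning property; in
  all other cases both sides are zero because \<open>L\<close> lives in multidegree a and on the
  vertices.\<close>

lemma coord_expand:
  assumes "homog b f"
  shows "lin L (f * g) = (\<Sum>s\<in>S. coord b w s f * lin L (mon s * g))"
proof -
  have mon: "L (r + N) = (\<Sum>s\<in>S. coord b w s (mon r) * L (s + N))"
    if r: "\<And>j. j < m \<Longrightarrow> mdeg r j = b j" for r N
  proof (cases "r \<in> Mon b \<and> N \<in> Mon (\<lambda>j. a j - b j)")
    case True
    then show ?thesis using basis by (simp add: is_basis_def coord_def mult_single)
  next
    case False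
    have 1: "L (r' + N') = 0" if "\<And>j. j < m \<Longrightarrow> mdeg r' j = b j"
      "\<not> (r' \<in> Mon b \<and> N' \<in> Mon (\<lambda>j. a j - b j))" for r' N'
    proof (rule ccontr)
      assume nz: "L (r' + N') \<noteq> 0"
      have "keys (r' + N') \<subseteq> Vt" by (rule L_nonzero(3)[OF nz])
      moreover have "mdeg N' j = a j - b j" if "j < m" for j
        using L_nonzero(4)[OF nz that] \<open>j < m \<Longrightarrow> mdeg r' j = b j\<close> that by simp
      ultimately show False using that by (auto simp: Mon_def keys_add_nat)
    qed
    show ?thesis
    proof (cases "r \<in> Mon b")
      case True
      have "L (s + N) = 0" if "s \<in> S" for s
        using that False True basis by (intro 1) (auto simp: is_basis_def Mon_def)
      then show ?thesis using 1[OF r] False by simp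
    next
      case nr: False
      have "coord b w s (mon r) = 0" for s
        unfolding coord_def using 1[OF r] nr by (simp add: mult_single)
      then show ?thesis using 1[OF r] False by simp
    qed
  qed
  have coord_f: "coord b w s f = (\<Sum>\<alpha>\<in>keys f. lookup f \<alpha> * coord b w s (mon \<alpha>))" for s
    by (subst poly_mapping_expand[of f])
      (simp add: coord_sum single_eq_const_mult[of _ "lookup f _"] coord_const_mult)
  have N: "lin L (f * mon N) = (\<Sum>s\<in>S. coord b w s f * L (s + N))" for N
  proof -
    have "lin L (f * mon N) = (\<Sum>\<alpha>\<in>keys f. lookup f \<alpha> * L (\<alpha> + N))"
      unfolding lin_mult_mono by (simp only: lin_def)
    also have "\<dots> = (\<Sum>\<alpha>\<in>keys f. lookup f \<alpha> *
        (\<Sum>s\<in>S. coord b w s (mon \<alpha>) * L (s + N)))"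
      using assms mon by (intro sum.cong) (auto simp: homog_def)
    also have "\<dots> = (\<Sum>s\<in>S. coord b w s f * L (s + N))"
      unfolding coord_f sum_distrib_left sum_distrib_right
      by (subst sum.swap) (simp add: mult.assoc)
    finally show ?thesis .
  qed
  have s: "lin L (mon s * g) = (\<Sum>\<beta>\<in>keys g. lookup g \<beta> * L (s + \<beta>))" for s
    by (subst lin_mult_sum_mono) (simp add: mult_single)
  show ?thesis
    unfolding lin_mult_sum_mono[of L f g] N s sum_distrib_left
    by (subst sum.swap) (simp add: mult_ac)
qed

lemma coord_eq_0:
  assumes "homog b f" "\<And>s. s \<in> S \<Longrightarrow> coord b w s f = 0"
  shows "lin L (f * g) = 0"
  using assms by (simp add: coord_expand)

end

subsection \<open>Anisotropy\<close>

lemma char_2_square_add: "(f + g)\<^sup>2 = f\<^sup>2 + (g\<^sup>2 :: 'k mpoly fract mpoly)"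
  using two_poly by (simp add: power2_sum)

lemma square_expand:
  "f\<^sup>2 = (\<Sum>\<alpha>\<in>keys f. Poly_Mapping.single (\<alpha> + \<alpha>) ((lookup f \<alpha>)\<^sup>2))"
  for f :: "'k mpoly fract mpoly"
proof -
  have "f\<^sup>2 = (\<Sum>\<alpha>\<in>keys f. (Poly_Mapping.single \<alpha> (lookup f \<alpha>))\<^sup>2)"
    by (subst poly_mapping_expand[of f]) (rule char_2_square_sum[OF two_poly])
  then show ?thesis by (simp add: power2_eq_square mult_single)
qed

text \<open>Squares of coefficients and values of E are both values of \<open>dbl\<close>, so the
  coefficients of the squarefree monomials are of the kind that
  \<open>squarefree_independent\<close> asks for.\<close>

lemma lin_E_square_in_range: "\<exists>y. lin (\<lambda>\<beta>. E (\<epsilon> + \<beta>)) (h\<^sup>2 * mon N) = dbl y"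
proof -
  have "\<forall>\<alpha>. \<exists>y. (lookup h \<alpha>)\<^sup>2 = dbl y" using square_eq_dbl[OF two_k] by blast
  then obtain y where y: "\<And>\<alpha>. (lookup h \<alpha>)\<^sup>2 = dbl (y \<alpha>)" by metis
  have "\<forall>\<gamma>. \<exists>z. E \<gamma> = dbl z" using E_in_range by blast
  then obtain z where z: "\<And>\<gamma>. E \<gamma> = dbl (z \<gamma>)" by metis
  have "lin (\<lambda>\<beta>. E (\<epsilon> + \<beta>)) (h\<^sup>2 * mon N) =
      dbl (\<Sum>\<alpha>\<in>keys h. y \<alpha> * z (\<epsilon> + (\<alpha> + \<alpha> + N)))"
    unfolding square_expand
    by (simp add: sum_distrib_right lin_sum mult_single y z dbl_sum dbl_mult)
  then show ?thesis by blast
qed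

text \<open>Greedy choice: rows of different colours do not compete for variables, so it suffices to
  have enough degree in each colour.\<close>

lemma assignment_exists:
  assumes "finite Z" "keys \<gamma> \<subseteq> Vt"
    and "\<And>k. k \<in> Z \<Longrightarrow> card {k' \<in> Z. col k' = col k} \<le> mdeg \<gamma> (col k)"
  shows "\<exists>V N. V \<in> Pi\<^sub>E Z C \<and> (\<Sum>k\<in>Z. e1 (V k)) + N = \<gamma>"
  using assms
proof (induction Z arbitrary: \<gamma> rule: finite_induct)
  case empty
  show ?case by (rule exI[of _ "\<lambda>_. undefined"], rule exI[of _ \<gamma>]) simp
next
  case (insert k Z)
  have "0 < card {k' \<in> insert k Z. col k' = col k}"
    using insert.hyps by (auto simp: card_gt_0_iff)
  then have "mdeg \<gamma> (col k) \<noteq> 0" using insert.prems(2)[of k] by simp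
  then obtain v where v: "v < n" "\<kappa> v = col k" "lookup \<gamma> v \<noteq> 0"
    by (auto simp: mdeg_def)
  then have vC: "v \<in> C k" using insert.prems(1) by (auto simp: C_def in_keys_iff)
  define \<gamma>' where "\<gamma>' = \<gamma> - e1 v"
  have \<gamma>: "\<gamma> = \<gamma>' + e1 v"
    unfolding \<gamma>'_def using v(3)
    by (intro poly_mapping_eqI) (auto simp: lookup_add lookup_minus lookup_single when_def)
  have "keys \<gamma>' \<subseteq> Vt" using insert.prems(1) unfolding \<gamma> by (simp add: keys_add_nat)
  moreover have "card {k' \<in> Z. col k' = col i} \<le> mdeg \<gamma>' (col i)" if i: "i \<in> Z" for i
  proof -
    have "card {k' \<in> insert k Z. col k' = col i} =
        card {k' \<in> Z. col k' = col i} + (if col k = col i then 1 else 0)"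
    proof (cases "col k = col i")
      case True
      then have "{k' \<in> insert k Z. col k' = col i} = insert k {k' \<in> Z. col k' = col i}" by auto
      then show ?thesis using True insert.hyps by simp
    next
      case False
      then have "{k' \<in> insert k Z. col k' = col i} = {k' \<in> Z. col k' = col i}" by auto
      then show ?thesis using False by simp
    qed
    then show ?thesis using insert.prems(2)[of i] i v by (simp add: \<gamma> mdeg_e1 split: if_splits)
  qed
  ultimately obtain V N where V: "V \<in> Pi\<^sub>E Z C" "(\<Sum>k\<in>Z. e1 (V k)) + N = \<gamma>'"
    using insert.IH by blast
  have "V(k := v) \<in> Pi\<^sub>E (insert k Z) C" using vC V(1) by (rule PiE_fun_upd)
  moreover have "(\<Sum>i\<in>insert k Z. e1 ((V(k := v)) i)) + N = \<gamma>"
  proof -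
    have "(\<Sum>i\<in>Z. e1 ((V(k := v)) i)) = (\<Sum>i\<in>Z. e1 (V i))"
      using insert.hyps by (intro sum.cong) auto
    then show ?thesis using insert.hyps by (simp add: \<gamma> V(2)[symmetric] ac_simps)
  qed
  ultimately show ?case by blast
qed

text \<open>The hypothesis expands over the assignments V of a vertex to each row, and by
  independence each coefficient E (x_V h^2 x^N) vanishes separately. It remains to pick V and N with
  x_V x^N = x^(2M).\<close>

lemma square_relation:
  assumes J: "J \<subseteq> {..<m}"
    and bJ: "\<And>j. j < m \<Longrightarrow> 2 * b j + (if j \<in> J then 1 else 0) \<le> a j"
    and zero: "\<And>N. lin L (h\<^sup>2 * (\<Prod>j\<in>J. row (d + j)) * mon N) = 0"
    and M: "M \<in> Mon (\<lambda>j. a j - b j)"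
  shows "lin E (h\<^sup>2 * mon (M + M)) = 0"
proof -
  define Z where "Z = {..<d} \<union> (+) d ` J"
  have finJ: "finite J" using J finite_subset by blast
  then have finZ: "finite Z" by (simp add: Z_def)
  have cardZ: "card {k \<in> Z. col k = j} = a j + (if j \<in> J then 1 else 0)" if j: "j < m" for j
  proof -
    have "{k \<in> Z. col k = j} = {k \<in> {..<d}. col k = j} \<union> {k \<in> (+) d ` J. col k = j}"
      unfolding Z_def by blast
    also have "{k \<in> {..<d}. col k = j} = \<I> j" using in_I_iff[OF j] by auto
    also have "{k \<in> (+) d ` J. col k = j} = (if j \<in> J then {d + j} else {})"
      by (auto simp: col_def)
    finally have "{k \<in> Z. col k = j} = \<I> j \<union> (if j \<in> J then {d + j} else {})" .
    moreover have "finite (\<I> j)" "d + j \<notin> \<I> j"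
      using in_I_iff[OF j] by (auto intro: finite_subset[of _ "{..<d}"])
    ultimately show ?thesis using I_card[OF j] by simp
  qed
  have colZ: "col k < m" if "k \<in> Z" for k
    using that J col_lt by (auto simp: Z_def col_def)
  \<comment> \<open>Colour j has a_j rows, plus one if j is in J, and M + M has degree 2(a_j - b_j)
    there; this is the inequality \<open>bJ\<close>.\<close>
  have "card {k' \<in> Z. col k' = col k} \<le> mdeg (M + M) (col k)" if k: "k \<in> Z" for k
    using cardZ[OF colZ[OF k]] bJ[OF colZ[OF k]] M colZ[OF k] by (auto simp: Mon_def)
  then obtain V N where V: "V \<in> Pi\<^sub>E Z C" "(\<Sum>k\<in>Z. e1 (V k)) + N = M + M"
    using assignment_exists[OF finZ, of "M + M"] M by (auto simp: Mon_def keys_add_nat)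
  have split: "(\<Prod>k\<in>Z. row k) = Theta * (\<Prod>j\<in>J. row (d + j))"
    unfolding Z_def Theta_def using finJ
    by (subst prod.union_disjoint) (auto simp: prod.reindex)
  have "\<forall>V. \<exists>y. lin (\<lambda>\<beta>. E ((\<Sum>k\<in>Z. e1 (V k)) + \<beta>)) (h\<^sup>2 * mon N) = dbl y"
    using lin_E_square_in_range by blast
  then obtain y where y: "\<And>V. lin (\<lambda>\<beta>. E ((\<Sum>k\<in>Z. e1 (V k)) + \<beta>)) (h\<^sup>2 * mon N) = dbl (y V)"
    by metis
  have "(\<Sum>V\<in>Pi\<^sub>E Z C. (\<Prod>k\<in>Z. pvar k (V k)) * dbl (y V)) = lin E ((\<Prod>k\<in>Z. row k) * (h\<^sup>2 * mon N))"
    unfolding lin_E_prod_row[OF finZ] y ..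
  also have "\<dots> = lin L (h\<^sup>2 * (\<Prod>j\<in>J. row (d + j)) * mon N)"
    unfolding split lin_L_eq_lin_E by (simp only: mult_ac)
  also have "\<dots> = 0" by (rule zero)
  finally have "y V = 0"
    by (rule squarefree_independent[OF finZ finite_C _ V(1)])
  then have "lin (\<lambda>\<beta>. E ((\<Sum>k\<in>Z. e1 (V k)) + \<beta>)) (h\<^sup>2 * mon N) = 0" using y by simp
  moreover have "lin E (h\<^sup>2 * mon (M + M)) = lin (\<lambda>\<beta>. E ((\<Sum>k\<in>Z. e1 (V k)) + \<beta>)) (h\<^sup>2 * mon N)"
    unfolding lin_mult_mono V(2)[symmetric] by (simp only: ac_simps)
  ultimately show ?thesis by simp
qed

text \<open>The relation between \<open>h\<close> and its square is first obtained for \<open>h\<close> in the kernel of the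
  pairing. A dimension count, here with a dual family, then shows that only the kernel satisfies the
  squared relation; this is what allows coefficients of the cycle outside the prime field.\<close>

lemma anisotropy:
  assumes J: "J \<subseteq> {..<m}"
    and bJ: "\<And>j. j < m \<Longrightarrow> 2 * b j + (if j \<in> J then 1 else 0) \<le> a j"
    and h: "homog b h"
    and zero: "\<And>N. lin L (h\<^sup>2 * (\<Prod>j\<in>J. row (d + j)) * mon N) = 0"
  shows "lin L (h * g) = 0"
proof -
  have b2: "2 * b j \<le> a j" if "j < m" for j using bJ[OF that] by simp
  have b: "b j \<le> a j" if "j < m" for j using b2[OF that] by simp
  obtain S w where basis: "is_basis b S w" using exists_basis by blast
  note [simp] = coord_basis[OF b basis]
  define y where "y s = coord b w s h" for s
  \<comment> \<open>The representative of h in the basis. In characteristic two h + h1 is the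
    difference, whose coordinates are all zero.\<close>
  define h1 where "h1 = (\<Sum>s\<in>S. const (y s) * mon s)"
  have y_h1: "coord b w s h1 = y s" if "s \<in> S" for s
    using that basis_finite[OF b basis]
    by (simp add: h1_def coord_sum[OF b basis] coord_const_mult[OF b basis]
        if_distrib[of "\<lambda>x. _ * x"] cong: if_cong)
  have homog_h1: "homog b h1"
    unfolding h1_def single_eq_const_mult[symmetric]
    by (intro homog_sum basis_hom[OF b basis])
  have "lin E (h1\<^sup>2 * mon (M + M)) = 0" if M: "M \<in> Mon (\<lambda>j. a j - b j)" for M
  proof -
    have hh: "homog b (h + h1)" using h homog_h1 by (rule homog_add)
    have c0: "coord b w s (h + h1) = 0" if "s \<in> S" for s
      using y_h1[OF that] two_K
      by (simp add: coord_add[OF b basis] y_def)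
    have "lin E ((h + h1)\<^sup>2 * mon (M + M)) = 0"
    \<comment> \<open>h + h1 is in the kernel of the pairing, so its relation is obtained with J
      empty, while that of h uses J. Additivity of squares then carries the relation over to
      h1.\<close>
    proof (rule square_relation[of "{}" b])
      fix N
      have "lin L ((h + h1) * ((h + h1) * mon N)) = 0"
        by (rule coord_eq_0[OF b basis hh c0])
      then show "lin L ((h + h1)\<^sup>2 * (\<Prod>j\<in>{}. row (d + j)) * mon N) = 0"
        by (simp add: power2_eq_square mult.assoc)
    qed (use b2 M in auto)
    moreover have "lin E (h\<^sup>2 * mon (M + M)) = 0"
      by (rule square_relation[OF J bJ zero M])
    ultimately show ?thesis by (simp add: char_2_square_add distrib_right lin_add)
  qed
  moreover have "lin E (h1\<^sup>2 * mon (M + M)) = (\<Sum>s\<in>S. (y s)\<^sup>2 * dbl (L (s + M)))" for M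
  proof -
    have "h1\<^sup>2 = (\<Sum>s\<in>S. Poly_Mapping.single (s + s) ((y s)\<^sup>2))"
      unfolding h1_def single_eq_const_mult[symmetric]
      unfolding char_2_square_sum[OF two_poly] by (simp add: power2_eq_square mult_single)
    moreover have "E (s + s + (M + M)) = dbl (L (s + M))" for s
      using E_double[of "s + M"] by (simp add: ac_simps)
    ultimately show ?thesis by (simp add: sum_distrib_right lin_sum mult_single)
  qed
  ultimately have rel: "(\<Sum>s\<in>S. (y s)\<^sup>2 * dbl (L (s + M))) = 0" if "M \<in> Mon (\<lambda>j. a j - b j)" for M
    using that by simp
  have "y s0 = 0" if s0: "s0 \<in> S" for s0
  proof -
    let ?D = "Mon (\<lambda>j. a j - b j)"
    \<comment> \<open>Applying \<open>dbl\<close> to the dual vectors makes them dual to the family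
      dbl (L (s + M)), which isolates the square of y s0.\<close>
    have "0 = (\<Sum>M\<in>?D. dbl (w s0 M) * (\<Sum>s\<in>S. (y s)\<^sup>2 * dbl (L (s + M))))"
      using rel by simp
    also have "\<dots> = (\<Sum>s\<in>S. (y s)\<^sup>2 * dbl (\<Sum>M\<in>?D. w s0 M * L (s + M)))"
      unfolding dbl_sum dbl_mult sum_distrib_left
      by (subst sum.swap) (simp add: mult_ac)
    also have "\<dots> = (\<Sum>s\<in>S. if s = s0 then (y s)\<^sup>2 else 0)"
      using basis s0 by (intro sum.cong) (auto simp: is_basis_def)
    finally show ?thesis using s0 basis_finite[OF b basis] by simp
  qed
  then show ?thesis
    using coord_eq_0[OF b basis h] by (simp add: y_def)
qed

lemma homog_row: "j < m \<Longrightarrow> homog (unit_vec_nat j) (row (d + j))"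
  unfolding row_def
  by (intro homog_sum homog_single) (auto simp: C_def col_def mdeg_e1 Vt_lt_n unit_vec_nat_def)

lemma prod_power_split:
  "(\<Prod>j<m. f j ^ e j) =
    (\<Prod>j<m. f j ^ (e j div 2))\<^sup>2 * (\<Prod>j\<in>{j \<in> {..<m}. odd (e j)}. f j :: 'b::comm_semiring_1)"
proof -
  have "f j ^ e j = (f j ^ (e j div 2))\<^sup>2 * (if odd (e j) then f j else 1)" for j
  proof -
    have "e j = 2 * (e j div 2) + (if odd (e j) then 1 else 0)" by (simp add: odd_two_times_div_two_succ)
    then have "f j ^ e j = f j ^ (2 * (e j div 2)) * f j ^ (if odd (e j) then 1 else 0)"
      by (metis power_add)
    moreover have "f j ^ (2 * (e j div 2)) = (f j ^ (e j div 2))\<^sup>2"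
      by (simp add: power_even_eq)
    ultimately show ?thesis by simp
  qed
  then have "(\<Prod>j<m. f j ^ e j) =
      (\<Prod>j<m. f j ^ (e j div 2))\<^sup>2 * (\<Prod>j<m. if odd (e j) then f j else 1)"
    by (simp add: prod.distrib prod_power_distrib)
  then show ?thesis by (simp only: prod.inter_filter finite_lessThan)
qed

text \<open>Write e = 2f + eps with eps in {0, 1} and h = g ell^f. Then h^2 ell^eps = (g ell^e) g is
  killed, and 2b + e <= a is exactly the bound that \<open>anisotropy\<close> requires of h. So e
  may be replaced by f, whose sum is smaller unless e = 0.\<close>

lemma generic_injective:
  assumes g: "homog b g"
    and "\<And>j. j < m \<Longrightarrow> 2 * b j + e j \<le> a j"
    and "\<And>N. lin L (g * (\<Prod>j<m. row (d + j) ^ e j) * mon N) = 0"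
  shows "lin L (g * mon N) = 0"
  using assms(2,3)
proof (induction "\<Sum>j<m. e j" arbitrary: e N rule: less_induct)
  case less
  show ?case
  proof (cases "\<forall>j<m. e j = 0")
    case True
    then show ?thesis using less.prems(2)[of N] by simp
  next
    case False
    then obtain i where i: "i < m" "e i \<noteq> 0" by blast
    define f where "f j = e j div 2" for j
    define J where "J = {j \<in> {..<m}. odd (e j)}"
    have eq: "e j = 2 * f j + (if j \<in> J then 1 else 0)" if "j < m" for j
      using that by (auto simp: f_def J_def)
    let ?h = "g * (\<Prod>j<m. row (d + j) ^ f j)"
    have "lin L (g * (\<Prod>j<m. row (d + j) ^ f j) * mon N) = 0" for N
    proof (rule anisotropy[of J "\<lambda>j. b j + f j"])
      show "J \<subseteq> {..<m}" by (auto simp: J_def)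
      show "2 * (b j + f j) + (if j \<in> J then 1 else 0) \<le> a j" if "j < m" for j
        using less.prems(1)[OF that] eq[OF that] by simp
      show "homog (\<lambda>j. b j + f j) ?h"
        using homog_row by (intro homog_mult g homog_prod_powers) auto
      fix N
      have "?h\<^sup>2 * (\<Prod>j\<in>J. row (d + j)) * mon N =
          (g * (\<Prod>j<m. row (d + j) ^ e j)) * (g * mon N)"
        unfolding prod_power_split[of "\<lambda>j. row (d + j)" e] f_def J_def
        by (simp add: power2_eq_square mult_ac)
      moreover have "lin L ((g * (\<Prod>j<m. row (d + j) ^ e j)) * (g * mon N)) = 0"
        by (rule lin_mult_eq_0[OF less.prems(2)])
      ultimately show "lin L (?h\<^sup>2 * (\<Prod>j\<in>J. row (d + j)) * mon N) = 0" by (simp only:)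
    qed
    moreover have "(\<Sum>j<m. f j) < (\<Sum>j<m. e j)"
      by (rule sum_strict_mono_ex1) (use i in \<open>auto simp: f_def intro!: bexI[of _ i]\<close>)
    moreover have "2 * b j + f j \<le> a j" if "j < m" for j
      using less.prems(1)[OF that] eq[OF that] by simp
    ultimately show ?thesis by (intro less.hyps[of f])
  qed
qed

end

subsection \<open>Polynomial functions\<close>

text \<open>The coefficients are in K but the arguments are arbitrary, so a polynomial over K can be
  tested at a generic point outside K.\<close>

inductive_set polyfun :: "'a::field set \<Rightarrow> nat set \<Rightarrow> ((nat \<Rightarrow> 'a) \<Rightarrow> 'a) set" for K W where
  const: "c \<in> K \<Longrightarrow> (\<lambda>\<tau>. c) \<in> polyfun K W"
| var: "v \<in> W \<Longrightarrow> (\<lambda>\<tau>. \<tau> v) \<in> polyfun K W"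
| add: "f \<in> polyfun K W \<Longrightarrow> g \<in> polyfun K W \<Longrightarrow> (\<lambda>\<tau>. f \<tau> + g \<tau>) \<in> polyfun K W"
| mult: "f \<in> polyfun K W \<Longrightarrow> g \<in> polyfun K W \<Longrightarrow> (\<lambda>\<tau>. f \<tau> * g \<tau>) \<in> polyfun K W"

lemma polyfun_univariate:
  assumes "h \<in> polyfun K W"
  shows "\<exists>p. \<forall>x. h (\<tau>(v := x)) = poly p x"
  using assms
proof induction
  case (const c)
  show ?case by (rule exI[of _ "[:c:]"]) simp
next
  case (var w)
  show ?case
    by (rule exI[of _ "if w = v then [:0, 1:] else [:\<tau> w:]"]) auto
next
  case (add f g)
  then show ?case by (metis poly_add)
next
  case (mult f g)
  then show ?case by (metis poly_mult)
qed

text \<open>Coordinates are moved into K one at a time: each step has to avoid the finitely many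
  roots of a nonzero univariate polynomial.\<close>

lemma polyfun_nonvanishing:
  assumes "h \<in> polyfun K W" "finite A" "A \<noteq> {} \<Longrightarrow> infinite K" "h \<tau> \<noteq> 0"
  shows "\<exists>\<tau>. (\<forall>v\<in>A. \<tau> v \<in> K) \<and> h \<tau> \<noteq> 0"
  using assms(2,3)
proof (induction A rule: finite_induct)
  case empty
  show ?case using assms(4) by auto
next
  case (insert v A)
  then have inf: "infinite K" by simp
  then obtain \<rho> where \<rho>: "\<forall>v\<in>A. \<rho> v \<in> K" "h \<rho> \<noteq> 0" using insert.IH by auto
  obtain p where p: "\<And>x. h (\<rho>(v := x)) = poly p x"
    using polyfun_univariate[OF assms(1)] by metis
  have "p \<noteq> 0" using p[of "\<rho> v"] \<rho>(2) by auto
  then have "finite {x. poly p x = 0}" by (rule poly_roots_finite)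
  then obtain x where "x \<in> K" "poly p x \<noteq> 0"
    using inf by (metis (mono_tags, lifting) finite_subset mem_Collect_eq subsetI)
  then have "h (\<rho>(v := x)) \<noteq> 0" by (simp add: p del: fun_upd_apply)
  moreover have "\<forall>v'\<in>insert v A. (\<rho>(v := x)) v' \<in> K" using \<rho>(1) \<open>x \<in> K\<close> by simp
  ultimately show ?case by blast
qed

context subfield_set
begin

lemma polyfun_sum: "(\<And>i. i \<in> A \<Longrightarrow> f i \<in> polyfun F W) \<Longrightarrow> (\<lambda>\<tau>. \<Sum>i\<in>A. f i \<tau>) \<in> polyfun F W"
  by (induction A rule: infinite_finite_induct)
    (auto intro: polyfun.const[OF zero_closed] polyfun.add)

lemma polyfun_prod: "(\<And>i. i \<in> A \<Longrightarrow> f i \<in> polyfun F W) \<Longrightarrow> (\<lambda>\<tau>. \<Prod>i\<in>A. f i \<tau>) \<in> polyfun F W"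
  by (induction A rule: infinite_finite_induct)
    (auto intro: polyfun.const[OF one_closed] polyfun.mult)

lemma polyfun_closed:
  assumes "h \<in> polyfun F W" "\<And>v. v \<in> W \<Longrightarrow> \<tau> v \<in> F"
  shows "h \<tau> \<in> F"
  using assms(1) by induction (auto intro: assms(2) add_closed mult_closed)

lemma polyfun_perm:
  assumes "\<And>k v. k \<in> R \<Longrightarrow> v \<in> S \<Longrightarrow> q k v \<in> polyfun F W"
  shows "(\<lambda>\<tau>. perm (\<lambda>k v. q k v \<tau>) R S) \<in> polyfun F W"
  unfolding perm_def
  by (intro polyfun_sum polyfun_prod) (use assms in \<open>auto simp: PiE_def Pi_def\<close>)

lemma lin_closed:
  assumes "\<And>\<alpha>. l \<alpha> \<in> F" "\<And>\<alpha>. lookup f \<alpha> \<in> F"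
  shows "lin l f \<in> F"
  unfolding lin_def using assms by (intro sum_closed mult_closed)

end

context balanced_cycle
begin

subsection \<open>The Gram determinant of the Lefschetz form\<close>

text \<open>One coefficient vector, indexed by the vertices, holds the coefficients of all m forms,
  since each vertex has one colour.\<close>

definition ell :: "(nat \<Rightarrow> 'k mpoly fract) \<Rightarrow> nat \<Rightarrow> 'k mpoly fract mpoly" where
  "ell \<tau> j = (\<Sum>v\<in>{v \<in> Vt. \<kappa> v = j}. Poly_Mapping.single (e1 v) (\<tau> v))"

lemma ell_generic: "ell (\<lambda>v. pvar (d + \<kappa> v) v) j = row (d + j)"
  unfolding ell_def row_def by (intro sum.cong) (auto simp: C_def col_def)

lemma homog_ell: "homog (unit_vec_nat j) (ell \<tau> j)"
  unfolding ell_def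
  by (intro homog_sum homog_single) (auto simp: mdeg_e1 Vt_lt_n unit_vec_nat_def)

definition ell_pow :: "(nat \<Rightarrow> 'k mpoly fract) \<Rightarrow> (nat \<Rightarrow> nat) \<Rightarrow> 'k mpoly fract mpoly" where
  "ell_pow \<tau> e = (\<Prod>j<m. ell \<tau> j ^ e j)"

lemma homog_ell_pow: "homog e (ell_pow \<tau> e)"
  unfolding ell_pow_def by (rule homog_prod_powers) (rule homog_ell)

lemma polyfun_ell_pow: "(\<lambda>\<tau>. lin L (ell_pow \<tau> e * mon N)) \<in> polyfun F Vt"
proof -
  \<comment> \<open>All N are included because multiplication by a linear form turns into a sum over
    shifted N.\<close>
  define good where "good f \<longleftrightarrow> (\<forall>N. (\<lambda>\<tau>. lin L (f \<tau> * mon N)) \<in> polyfun F Vt)"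
    for f :: "(nat \<Rightarrow> 'k mpoly fract) \<Rightarrow> 'k mpoly fract mpoly"
  have good_1: "good (\<lambda>\<tau>. 1)"
    by (auto simp: good_def intro: polyfun.const L_in_F)
  have good_ell: "good (\<lambda>\<tau>. ell \<tau> j * f \<tau>)" if f: "good f" for f j
  proof -
    have "lin L (ell \<tau> j * f \<tau> * mon N) =
        (\<Sum>v\<in>{v \<in> Vt. \<kappa> v = j}. \<tau> v * lin L (f \<tau> * mon (e1 v + N)))" for \<tau> N
    proof -
      have "ell \<tau> j * f \<tau> * mon N =
          (\<Sum>v\<in>{v \<in> Vt. \<kappa> v = j}. const (\<tau> v) * (f \<tau> * mon (e1 v + N)))"
        unfolding ell_def mon_add sum_distrib_right
        by (intro sum.cong refl) (simp only: single_eq_const_mult[of _ "\<tau> _"] mult_ac)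
      then show ?thesis by (simp only: lin_sum lin_const_mult)
    qed
    then show ?thesis
      using f unfolding good_def by (auto intro!: F.polyfun_sum polyfun.mult polyfun.var)
  qed
  have good_pow: "good (\<lambda>\<tau>. ell \<tau> j ^ i * f \<tau>)" if "good f" for f j i
    using that good_ell[of "\<lambda>\<tau>. ell \<tau> j ^ _ * f \<tau>"]
    by (induction i) (auto simp: mult.assoc)
  have "good (\<lambda>\<tau>. \<Prod>j\<in>A. ell \<tau> j ^ e j)" if "finite A" for A
    using that
  proof (induction A rule: finite_induct)
    case empty
    then show ?case using good_1 by simp
  next
    case (insert j A)
    then show ?case using good_pow[OF insert.IH] by simp
  qed
  then show ?thesis unfolding ell_pow_def good_def by blast
qed

text \<open>The Hodge-Riemann type pairing (y, z) |-> Psi (ell^(a-2b) y z) on multidegree b,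
  evaluated on monomials.\<close>

definition form :: "(nat \<Rightarrow> nat) \<Rightarrow> (nat \<Rightarrow> 'k mpoly fract) \<Rightarrow>
    (nat \<Rightarrow>\<^sub>0 nat) \<Rightarrow> (nat \<Rightarrow>\<^sub>0 nat) \<Rightarrow> 'k mpoly fract" where
  "form b \<tau> s s' = lin L (ell_pow \<tau> (\<lambda>j. a j - 2 * b j) * mon (s + s'))"

lemma polyfun_form: "(\<lambda>\<tau>. form b \<tau> s s') \<in> polyfun F Vt"
  unfolding form_def by (rule polyfun_ell_pow)

context
  fixes b S w
  assumes b: "\<And>j. j < m \<Longrightarrow> 2 * b j \<le> a j" and basis: "is_basis b S w"
begin

lemma b_le: "j < m \<Longrightarrow> b j \<le> a j"
  using b by fastforce

text \<open>A monomial that pairs nontrivially with f has multidegree b, and then it expands in the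
  basis monomials.\<close>

lemma dual_test:
  assumes f: "homog (\<lambda>j. a j - b j) f" and zero: "\<And>s. s \<in> S \<Longrightarrow> lin L (f * mon s) = 0"
  shows "lin L (f * g) = 0"
proof (rule lin_mult_eq_0)
  fix N
  show "lin L (f * mon N) = 0"
  proof (rule ccontr)
    assume nz: "lin L (f * mon N) \<noteq> 0"
    have "N \<in> Mon (\<lambda>j. a j - (a j - b j))"
      by (rule lin_L_mult_degree[OF f _ nz]) simp
    then have hN: "homog b (mon N)"
      using b_le by (intro homog_single) (auto simp: Mon_def)
    have "lin L (mon N * f) = (\<Sum>s\<in>S. coord b w s (mon N) * lin L (mon s * f))"
      by (rule coord_expand[OF b_le basis hN])
    also have "\<dots> = 0" using zero by (simp add: mult.commute)
    finally show False using nz by (simp add: mult.commute)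
  qed
qed

lemma homog_ell_pow_mult: "homog b f \<Longrightarrow> homog (\<lambda>j. a j - b j) (ell_pow \<tau> (\<lambda>j. a j - 2 * b j) * f)"
  using homog_mult[OF homog_ell_pow] by (rule homog_cong) (use b in fastforce)+

text \<open>A kernel vector of the Gram matrix gives g of multidegree b with ell^(a-2b) g in the
  kernel of the pairing, by \<open>dual_test\<close>. Then \<open>generic_injective\<close> forces
  all coordinates of g to vanish.\<close>

lemma gram_generic_nonzero: "perm (form b (\<lambda>v. pvar (d + \<kappa> v) v)) S S \<noteq> 0"
proof
  let ?\<tau> = "\<lambda>v. pvar (d + \<kappa> v) v :: 'k mpoly fract"
  let ?l = "ell_pow ?\<tau> (\<lambda>j. a j - 2 * b j)"
  assume z: "perm (form b ?\<tau>) S S = 0"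
  have finS: "finite S" by (rule basis_finite[OF b_le basis])
  obtain c where c: "\<exists>v\<in>S. c v \<noteq> 0" "\<And>k. k \<in> S \<Longrightarrow> (\<Sum>v\<in>S. form b ?\<tau> k v * c v) = 0"
    using perm_zero_kernel[OF two_K finS finS refl z] by blast
  define g where "g = (\<Sum>s\<in>S. const (c s) * mon s)"
  have hg: "homog b g"
    unfolding g_def single_eq_const_mult[symmetric]
    by (intro homog_sum basis_hom[OF b_le basis])
  have lg: "lin L (?l * g * mon s) = 0" if s: "s \<in> S" for s
  proof -
    have "?l * g * mon s = (\<Sum>v\<in>S. const (c v) * (?l * mon (s + v)))"
      unfolding g_def sum_distrib_left sum_distrib_right mon_add
      by (intro sum.cong refl) (simp only: mult_ac)
    then have "lin L (?l * g * mon s) = (\<Sum>v\<in>S. c v * form b ?\<tau> s v)"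
      by (simp only: lin_sum lin_const_mult form_def)
    then show ?thesis using c(2)[OF s] by (simp add: mult.commute)
  qed
  have "lin L (?l * g * mon N) = 0" for N
    by (rule dual_test[OF homog_ell_pow_mult[OF hg] lg])
  then have "lin L (g * (\<Prod>j<m. row (d + j) ^ (a j - 2 * b j)) * mon N) = 0" for N
    by (simp only: ell_pow_def ell_generic mult.commute[of g])
  then have "lin L (g * mon N) = 0" for N
    by (rule generic_injective[OF hg, rotated]) (use b in fastforce)
  then have "coord b w s g = 0" for s by (simp add: coord_def)
  moreover have "coord b w s g = c s" if "s \<in> S" for s
    using that finS coord_basis[OF b_le basis]
    by (simp add: g_def coord_sum[OF b_le basis] coord_const_mult[OF b_le basis]
        if_distrib[of "\<lambda>x. _ * x"] cong: if_cong)
  ultimately show False using c(1) by simp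
qed

lemma gram_inverse:
  assumes \<tau>: "\<And>v. v \<in> Vt \<Longrightarrow> \<tau> v \<in> F" and nz: "perm (form b \<tau>) S S \<noteq> 0"
  obtains w' where "\<And>v k. v \<in> S \<Longrightarrow> k \<in> S \<Longrightarrow> w' v k \<in> F"
    "\<And>v v'. v \<in> S \<Longrightarrow> v' \<in> S \<Longrightarrow> (\<Sum>k\<in>S. w' v k * form b \<tau> k v') = (if v' = v then 1 else 0)"
    "\<And>k k'. k \<in> S \<Longrightarrow> k' \<in> S \<Longrightarrow> (\<Sum>v\<in>S. form b \<tau> k v * w' v k') = (if k' = k then 1 else 0)"
  by (rule F.perm_inverse[OF two_K basis_finite[OF b_le basis] basis_finite[OF b_le basis] refl nz
        F.polyfun_closed[OF polyfun_form \<tau>]]) (assumption+, rule that)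

text \<open>For coefficients in F only the invertible Gram matrix is at hand. Pairing ell^(a-2b) f
  with the basis monomials gives this matrix applied to the coordinates of f.\<close>

lemma lefschetz_injective:
  assumes \<tau>: "\<And>v. v \<in> Vt \<Longrightarrow> \<tau> v \<in> F" and nz: "perm (form b \<tau>) S S \<noteq> 0"
    and f: "homog b f" and zero: "\<And>g. lin L (ell_pow \<tau> (\<lambda>j. a j - 2 * b j) * f * g) = 0"
  shows "lin L (f * g) = 0"
proof (rule coord_eq_0[OF b_le basis f])
  let ?l = "ell_pow \<tau> (\<lambda>j. a j - 2 * b j)"
  obtain w' where w': "\<And>k k'. k \<in> S \<Longrightarrow> k' \<in> S \<Longrightarrow>
      (\<Sum>v\<in>S. form b \<tau> k v * w' v k') = (if k' = k then 1 else 0)"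
    by (rule gram_inverse[OF \<tau> nz], assumption, rule that)
  define y where "y s = coord b w s f" for s
  have rel: "(\<Sum>s\<in>S. y s * form b \<tau> s s') = 0" if "s' \<in> S" for s'
  proof -
    have "0 = lin L (f * (?l * mon s'))"
      using zero[of "mon s'"] by (simp only: mult_ac)
    also have "\<dots> = (\<Sum>s\<in>S. y s * lin L (mon s * (?l * mon s')))"
      unfolding y_def by (rule coord_expand[OF b_le basis f])
    also have "\<dots> = (\<Sum>s\<in>S. y s * form b \<tau> s s')"
      by (simp only: form_def mon_add mult_ac)
    finally show ?thesis by simp
  qed
  fix s assume s: "s \<in> S"
  have "(\<Sum>v\<in>S. (\<Sum>k\<in>S. y k * form b \<tau> k v) * w' v s) = (\<Sum>k\<in>S. y k * (\<Sum>v\<in>S. form b \<tau> k v * w' v s))"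
    unfolding sum_distrib_left sum_distrib_right by (subst sum.swap) (simp add: mult.assoc)
  also have "\<dots> = (\<Sum>k\<in>S. if k = s then y k else 0)"
    using w' s by (intro sum.cong) auto
  finally show "coord b w s f = 0"
    using rel s basis_finite[OF b_le basis] by (simp add: y_def)
qed

text \<open>The equations against the basis monomials form a square linear system. The inverse Gram
  matrix over F solves it, so the preimage has coefficients in F.\<close>

lemma lefschetz_surjective:
  assumes \<tau>: "\<And>v. v \<in> Vt \<Longrightarrow> \<tau> v \<in> F" and nz: "perm (form b \<tau>) S S \<noteq> 0"
    and f: "homog (\<lambda>j. a j - b j) f" "\<And>\<alpha>. lookup f \<alpha> \<in> F"
  obtains c where "\<And>s. s \<in> S \<Longrightarrow> c s \<in> F"
    "\<And>g. lin L ((ell_pow \<tau> (\<lambda>j. a j - 2 * b j) * (\<Sum>s\<in>S. const (c s) * mon s) - f) * g) = 0"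
proof -
  let ?l = "ell_pow \<tau> (\<lambda>j. a j - 2 * b j)"
  obtain w' where w': "\<And>v k. v \<in> S \<Longrightarrow> k \<in> S \<Longrightarrow> w' v k \<in> F"
    "\<And>v v'. v \<in> S \<Longrightarrow> v' \<in> S \<Longrightarrow> (\<Sum>k\<in>S. w' v k * form b \<tau> k v') = (if v' = v then 1 else 0)"
    by (rule gram_inverse[OF \<tau> nz], assumption, rule that)
  define c where "c k = (\<Sum>v\<in>S. lin L (f * mon v) * w' v k)" for k
  have fF: "lin L (f * mon v) \<in> F" for v
    unfolding lin_mult_mono using f(2) L_in_F by (intro F.lin_closed)
  have cF: "c s \<in> F" if "s \<in> S" for s
    unfolding c_def using fF w'(1) that by (intro F.sum_closed F.mult_closed) auto
  let ?g = "\<Sum>s\<in>S. const (c s) * mon s"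
  have hg: "homog b ?g"
    unfolding single_eq_const_mult[symmetric]
    by (intro homog_sum basis_hom[OF b_le basis])
  have neg: "homog (\<lambda>j. a j - b j) (- f)" using f(1) by (simp add: homog_def)
  have h: "homog (\<lambda>j. a j - b j) (?l * ?g - f)"
    using homog_add[OF homog_ell_pow_mult[OF hg] neg] by simp
  have "lin L ((?l * ?g - f) * mon s) = 0" if s: "s \<in> S" for s
  proof -
    have "?l * ?g * mon s = (\<Sum>v\<in>S. const (c v) * (?l * mon (v + s)))"
      unfolding sum_distrib_left sum_distrib_right mon_add
      by (intro sum.cong refl) (simp only: mult_ac)
    then have "lin L (?l * ?g * mon s) = (\<Sum>k\<in>S. c k * form b \<tau> k s)"
      by (simp only: lin_sum lin_const_mult form_def)
    also have "\<dots> = (\<Sum>v\<in>S. lin L (f * mon v) * (\<Sum>k\<in>S. w' v k * form b \<tau> k s))"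
      unfolding c_def sum_distrib_left sum_distrib_right
      by (subst sum.swap) (simp add: mult.assoc)
    also have "\<dots> = (\<Sum>v\<in>S. if v = s then lin L (f * mon v) else 0)"
      using w'(2) s by (intro sum.cong) auto
    also have "\<dots> = lin L (f * mon s)"
      using s basis_finite[OF b_le basis] by simp
    finally show ?thesis by (simp add: left_diff_distrib lin_diff)
  qed
  then have "lin L ((?l * ?g - f) * g) = 0" for g by (rule dual_test[OF h])
  then show ?thesis using cF that by blast
qed

end

definition basis_set :: "(nat \<Rightarrow> nat) \<Rightarrow> (nat \<Rightarrow>\<^sub>0 nat) set" where
  "basis_set b = (SOME S. \<exists>w. is_basis b S w)"

definition basis_dual :: "(nat \<Rightarrow> nat) \<Rightarrow> (nat \<Rightarrow>\<^sub>0 nat) \<Rightarrow> (nat \<Rightarrow>\<^sub>0 nat) \<Rightarrow> 'k mpoly fract" where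
  "basis_dual b = (SOME w. is_basis b (basis_set b) w)"

lemma is_basis_chosen: "is_basis b (basis_set b) (basis_dual b)"
proof -
  have "\<exists>w. is_basis b (basis_set b) w"
    unfolding basis_set_def using exists_basis by (rule someI_ex)
  then show ?thesis unfolding basis_dual_def by (rule someI_ex)
qed

text \<open>Only values below m matter. Setting the others to 0 makes the set finite, so that a
  single product of Gram determinants, hence a single open set, serves all b.\<close>

definition degrees :: "(nat \<Rightarrow> nat) set" where
  "degrees = {b. (\<forall>j<m. 2 * b j \<le> a j) \<and> (\<forall>j\<ge>m. b j = 0)}"

lemma finite_degrees: "finite degrees"
proof -
  have le: "a j \<le> (\<Sum>j<m. a j)" if "j < m" for j
    using that by (intro member_le_sum) auto
  then have "degrees \<subseteq> {b. \<forall>j. (j \<in> {..<m} \<longrightarrow> b j \<in> {..d}) \<and> (j \<notin> {..<m} \<longrightarrow> b j = 0)}"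
  proof (intro subsetI CollectI allI conjI impI)
    fix b j assume b: "b \<in> degrees"
    show "b j \<in> {..d}" if "j \<in> {..<m}"
      using le[of j] that b a_sum by (fastforce simp: degrees_def)
    show "b j = 0" if "j \<notin> {..<m}"
      using that b by (simp add: degrees_def)
  qed
  then show ?thesis
    by (rule finite_subset) (intro finite_set_of_finite_funs, auto)
qed

definition gram :: "(nat \<Rightarrow> 'k mpoly fract) \<Rightarrow> 'k mpoly fract" where
  "gram \<tau> = (\<Prod>b\<in>degrees. perm (form b \<tau>) (basis_set b) (basis_set b))"

lemma polyfun_gram: "gram \<in> polyfun F Vt"
proof -
  have "(\<lambda>\<tau>. perm (form b \<tau>) (basis_set b) (basis_set b)) \<in> polyfun F Vt" for b
    using F.polyfun_perm[of "basis_set b" "basis_set b" "\<lambda>s s' \<tau>. form b \<tau> s s'" Vt] polyfun_form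
    by simp
  then have "(\<lambda>\<tau>. gram \<tau>) \<in> polyfun F Vt"
    unfolding gram_def by (intro F.polyfun_prod)
  then show ?thesis by simp
qed

lemma exists_gram_nonzero: "\<exists>\<tau>. (\<forall>v\<in>Vt. \<tau> v \<in> F) \<and> gram \<tau> \<noteq> 0"
proof (rule polyfun_nonvanishing[OF polyfun_gram finite_Vt])
  \<comment> \<open>Without vertices there are no indeterminates and F may be finite. With one, a_j
    > 0 provides an indeterminate.\<close>
  assume "Vt \<noteq> {}"
  then obtain v where v: "v \<in> Vt" by blast
  then have "card (\<I> (\<kappa> v)) \<noteq> 0" using I_card a_pos kappa_lt by simp
  then obtain k where "k \<in> \<I> (\<kappa> v)" by fastforce
  then have "(k, v) \<in> pindices \<Delta> \<kappa> \<I>" using v by (simp add: pindices_def)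
  then show "infinite F" by (rule infinite_ktilde)
next
  show "gram (\<lambda>v. pvar (d + \<kappa> v) v) \<noteq> 0"
    unfolding gram_def
    using finite_degrees gram_generic_nonzero[OF _ is_basis_chosen]
    by (auto simp: degrees_def)
qed

end

subsection \<open>The polynomial ring over a subfield\<close>

lemma poly_ring_simps [simp]:
  "monoid.mult (poly_ring n K) = (*)" "monoid.one (poly_ring n K) = 1"
  "ring.zero (poly_ring n K) = 0" "ring.add (poly_ring n K) = (+)"
  by (simp_all add: poly_ring_def)

lemma carrier_poly_ring:
  "f \<in> carrier (poly_ring n K) \<longleftrightarrow> indets f \<subseteq> {..<n} \<and> (\<forall>\<alpha>. lookup f \<alpha> \<in> K)"
  by (simp add: poly_ring_def)

lemma indets_single: "indets (Poly_Mapping.single \<alpha> c) = (if c = 0 then {} else keys \<alpha>)"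
  by (simp add: indets_def)

context subfield_set
begin

lemma lookup_mult_closed:
  fixes f g :: "'a mpoly"
  assumes "\<And>\<alpha>. lookup f \<alpha> \<in> F" "\<And>\<alpha>. lookup g \<alpha> \<in> F"
  shows "lookup (f * g) \<gamma> \<in> F"
proof -
  have "f * g = (\<Sum>\<alpha>\<in>keys f. \<Sum>\<beta>\<in>keys g.
      Poly_Mapping.single (\<alpha> + \<beta>) (lookup f \<alpha> * lookup g \<beta>))"
    by (subst poly_mapping_expand[of f], subst poly_mapping_expand[of g])
      (simp add: sum_product mult_single)
  then show ?thesis
    using assms by (simp add: lookup_sum lookup_single when_def)
      (auto intro!: sum_closed mult_closed zero_closed)
qed

lemma poly_ring_0: "0 \<in> carrier (poly_ring n F)"
  by (simp add: carrier_poly_ring zero_closed)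

lemma poly_ring_1: "1 \<in> carrier (poly_ring n F)"
  by (auto simp: carrier_poly_ring lookup_one when_def zero_closed one_closed)

lemma poly_ring_add: "f \<in> carrier (poly_ring n F) \<Longrightarrow> g \<in> carrier (poly_ring n F) \<Longrightarrow>
    f + g \<in> carrier (poly_ring n F)"
  using indets_add[of f g] by (auto simp: carrier_poly_ring lookup_add add_closed)

lemma poly_ring_uminus: "f \<in> carrier (poly_ring n F) \<Longrightarrow> - f \<in> carrier (poly_ring n F)"
  by (auto simp: carrier_poly_ring indets_uminus uminus_closed)

lemma poly_ring_diff: "f \<in> carrier (poly_ring n F) \<Longrightarrow> g \<in> carrier (poly_ring n F) \<Longrightarrow>
    f - g \<in> carrier (poly_ring n F)"
  using poly_ring_add[of f n "- g"] poly_ring_uminus[of g n] by simp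

lemma poly_ring_mult: "f \<in> carrier (poly_ring n F) \<Longrightarrow> g \<in> carrier (poly_ring n F) \<Longrightarrow>
    f * g \<in> carrier (poly_ring n F)"
  using indets_mult[of f g] by (auto simp: carrier_poly_ring intro!: lookup_mult_closed)

lemma poly_ring_single:
  "c \<in> F \<Longrightarrow> keys \<alpha> \<subseteq> {..<n} \<Longrightarrow> Poly_Mapping.single \<alpha> c \<in> carrier (poly_ring n F)"
  by (auto simp: carrier_poly_ring indets_single lookup_single when_def zero_closed)

lemma poly_ring_const: "c \<in> F \<Longrightarrow> const c \<in> carrier (poly_ring n F)"
  unfolding const_def by (rule poly_ring_single) auto

lemma poly_ring_mono: "keys \<alpha> \<subseteq> {..<n} \<Longrightarrow> mon \<alpha> \<in> carrier (poly_ring n F)"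
  using one_closed by (rule poly_ring_single)

lemma poly_ring_sum:
  "(\<And>i. i \<in> A \<Longrightarrow> f i \<in> carrier (poly_ring n F)) \<Longrightarrow> sum f A \<in> carrier (poly_ring n F)"
  by (induction A rule: infinite_finite_induct) (auto intro: poly_ring_0 poly_ring_add)

lemma poly_ring_prod:
  "(\<And>i. i \<in> A \<Longrightarrow> f i \<in> carrier (poly_ring n F)) \<Longrightarrow> prod f A \<in> carrier (poly_ring n F)"
  by (induction A rule: infinite_finite_induct) (auto intro: poly_ring_1 poly_ring_mult)

lemma poly_ring_power:
  "f \<in> carrier (poly_ring n F) \<Longrightarrow> f ^ (i::nat) \<in> carrier (poly_ring n F)"
  by (induction i) (auto intro: poly_ring_1 poly_ring_mult)

lemma cring_poly_ring: "cring (poly_ring n F)"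
proof (intro cringI abelian_groupI comm_monoidI)
  show "\<exists>g\<in>carrier (poly_ring n F). g \<oplus>\<^bsub>poly_ring n F\<^esub> f = \<zero>\<^bsub>poly_ring n F\<^esub>"
    if "f \<in> carrier (poly_ring n F)" for f
    using that by (intro bexI[of _ "- f"]) (auto intro: poly_ring_uminus)
qed (auto simp: algebra_simps intro: poly_ring_0 poly_ring_1 poly_ring_add poly_ring_mult)

lemma a_inv_poly_ring:
  assumes "f \<in> carrier (poly_ring n F)"
  shows "\<ominus>\<^bsub>poly_ring n F\<^esub> f = - f"
proof -
  interpret R: cring "poly_ring n F" by (rule cring_poly_ring)
  have "- f \<oplus>\<^bsub>poly_ring n F\<^esub> f = \<zero>\<^bsub>poly_ring n F\<^esub>" by simp
  then show ?thesis using assms poly_ring_uminus R.minus_equality by metis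
qed

lemma a_minus_poly_ring:
  "f \<in> carrier (poly_ring n F) \<Longrightarrow> g \<in> carrier (poly_ring n F) \<Longrightarrow> f \<ominus>\<^bsub>poly_ring n F\<^esub> g = f - g"
  by (simp add: a_minus_def a_inv_poly_ring)

lemma ideal_poly_ringI:
  assumes "J \<subseteq> carrier (poly_ring n F)" "0 \<in> J"
    "\<And>f g. f \<in> J \<Longrightarrow> g \<in> J \<Longrightarrow> f + g \<in> J"
    "\<And>f g. f \<in> J \<Longrightarrow> g \<in> carrier (poly_ring n F) \<Longrightarrow> g * f \<in> J"
  shows "ideal J (poly_ring n F)"
proof -
  interpret R: cring "poly_ring n F" by (rule cring_poly_ring)
  have neg: "- f \<in> J" if "f \<in> J" for f
    using assms(4)[OF that poly_ring_uminus[OF poly_ring_1]] by simp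
  show ?thesis
  proof (rule idealI[OF R.ring_axioms])
    show "subgroup J (add_monoid (poly_ring n F))"
      by (rule R.add.subgroupI)
        (use assms neg in \<open>auto simp: a_inv_poly_ring simp flip: a_inv_def\<close>)
  qed (use assms in \<open>auto simp: mult.commute\<close>)
qed

end

lemma coset_eq_iff:
  assumes "cring R" "ideal J R" "x \<in> carrier R" "y \<in> carrier R"
  shows "J +>\<^bsub>R\<^esub> x = J +>\<^bsub>R\<^esub> y \<longleftrightarrow> x \<ominus>\<^bsub>R\<^esub> y \<in> J"
  using ring.quotient_eq_iff_same_a_r_cos[OF cring.axioms(1)[OF assms(1)] assms(2-4)] by simp

lemma carrier_Quot: "carrier (R Quot J) = (\<lambda>x. J +>\<^bsub>R\<^esub> x) ` carrier R"
  by (auto simp: FactRing_def A_RCOSETS_def')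

lemma coset_hom:
  assumes "ideal J R" "x \<in> carrier R" "y \<in> carrier R"
  shows "J +>\<^bsub>R\<^esub> (x \<oplus>\<^bsub>R\<^esub> y) = (J +>\<^bsub>R\<^esub> x) \<oplus>\<^bsub>R Quot J\<^esub> (J +>\<^bsub>R\<^esub> y)"
    "J +>\<^bsub>R\<^esub> (x \<otimes>\<^bsub>R\<^esub> y) = (J +>\<^bsub>R\<^esub> x) \<otimes>\<^bsub>R Quot J\<^esub> (J +>\<^bsub>R\<^esub> y)"
    "J +>\<^bsub>R\<^esub> \<one>\<^bsub>R\<^esub> = \<one>\<^bsub>R Quot J\<^esub>"
  using ring_hom_memE[OF ideal.rcos_ring_hom[OF assms(1)]] assms(2,3) by simp_all

text \<open>Needed to bound the ideal generated by the theta_k inside the Stanley-Reisner ring by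
  the image of \<open>ker_L\<close>.\<close>

lemma ideal_image_Quot:
  assumes R: "cring R" and I: "ideal I R" and J: "ideal J R"
  shows "ideal ((\<lambda>x. I +>\<^bsub>R\<^esub> x) ` J) (R Quot I)"
proof -
  interpret R: cring R by (rule R)
  interpret Q: cring "R Quot I" using ideal.quotient_is_cring[OF I R] .
  interpret h: ring_hom_ring R "R Quot I" "\<lambda>x. I +>\<^bsub>R\<^esub> x"
    using ideal.rcos_ring_hom_ring[OF I] .
  have Jc: "x \<in> carrier R" if "x \<in> J" for x using ideal.Icarr[OF J that] .
  show ?thesis
  proof (rule idealI[OF Q.ring_axioms])
    show "subgroup ((\<lambda>x. I +>\<^bsub>R\<^esub> x) ` J) (add_monoid (R Quot I))"
    proof (rule Q.add.subgroupI)
      show "(\<lambda>x. I +>\<^bsub>R\<^esub> x) ` J \<subseteq> carrier (R Quot I)" using Jc by auto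
      show "(\<lambda>x. I +>\<^bsub>R\<^esub> x) ` J \<noteq> {}"
        using additive_subgroup.zero_closed[OF ideal.axioms(1)[OF J]] by blast
    next
      fix y assume "y \<in> (\<lambda>x. I +>\<^bsub>R\<^esub> x) ` J"
      then obtain x where x: "x \<in> J" "y = I +>\<^bsub>R\<^esub> x" by blast
      then have "\<ominus>\<^bsub>R Quot I\<^esub> y = I +>\<^bsub>R\<^esub> (\<ominus>\<^bsub>R\<^esub> x)" using Jc h.hom_a_inv by simp
      moreover have "\<ominus>\<^bsub>R\<^esub> x \<in> J"
        using x additive_subgroup.a_inv_closed[OF ideal.axioms(1)[OF J]] R.is_abelian_group by blast
      ultimately show "\<ominus>\<^bsub>R Quot I\<^esub> y \<in> (\<lambda>x. I +>\<^bsub>R\<^esub> x) ` J" by blast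
    next
      fix y y' assume "y \<in> (\<lambda>x. I +>\<^bsub>R\<^esub> x) ` J" "y' \<in> (\<lambda>x. I +>\<^bsub>R\<^esub> x) ` J"
      then obtain x x' where x: "x \<in> J" "y = I +>\<^bsub>R\<^esub> x" "x' \<in> J" "y' = I +>\<^bsub>R\<^esub> x'" by blast
      then have "y \<oplus>\<^bsub>R Quot I\<^esub> y' = I +>\<^bsub>R\<^esub> (x \<oplus>\<^bsub>R\<^esub> x')" using Jc h.hom_add by simp
      moreover have "x \<oplus>\<^bsub>R\<^esub> x' \<in> J"
        using x additive_subgroup.a_closed[OF ideal.axioms(1)[OF J]] by blast
      ultimately show "y \<oplus>\<^bsub>R Quot I\<^esub> y' \<in> (\<lambda>x. I +>\<^bsub>R\<^esub> x) ` J" by blast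
    qed
  next
    fix y z assume "y \<in> (\<lambda>x. I +>\<^bsub>R\<^esub> x) ` J" "z \<in> carrier (R Quot I)"
    then obtain x x' where x: "x \<in> J" "y = I +>\<^bsub>R\<^esub> x" "x' \<in> carrier R" "z = I +>\<^bsub>R\<^esub> x'"
      by (auto simp: carrier_Quot)
    have "z \<otimes>\<^bsub>R Quot I\<^esub> y = I +>\<^bsub>R\<^esub> (x' \<otimes>\<^bsub>R\<^esub> x)" using x Jc h.hom_mult by simp
    then show "z \<otimes>\<^bsub>R Quot I\<^esub> y \<in> (\<lambda>x. I +>\<^bsub>R\<^esub> x) ` J"
      using ideal.I_l_closed[OF J] x by blast
    have "y \<otimes>\<^bsub>R Quot I\<^esub> z = I +>\<^bsub>R\<^esub> (x \<otimes>\<^bsub>R\<^esub> x')" using x Jc h.hom_mult by simp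
    then show "y \<otimes>\<^bsub>R Quot I\<^esub> z \<in> (\<lambda>x. I +>\<^bsub>R\<^esub> x) ` J"
      using ideal.I_r_closed[OF J] x by blast
  qed
qed

section \<open>The kernel of the pairing as an ideal\<close>

context balanced_cycle
begin

abbreviation R :: "'k mpoly fract mpoly ring" where
  "R \<equiv> poly_ring n F"

interpretation R: cring R
  by (rule F.cring_poly_ring)

text \<open>The test polynomials g range over the big field and all variables; by linearity this
  amounts to testing on monomials. The set turns out to be the ideal defining B(mu).\<close>

definition ker_L :: "'k mpoly fract mpoly set" where
  "ker_L = {f \<in> carrier R. \<forall>g. lin L (f * g) = 0}"

lemma ideal_ker_L: "ideal ker_L R"
proof (rule F.ideal_poly_ringI)
  fix f g assume f: "f \<in> ker_L" and g: "g \<in> carrier R"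
  have "lin L (g * f * h) = 0" for h
  proof -
    have "lin L (f * (g * h)) = 0" using f by (simp add: ker_L_def)
    then show ?thesis by (simp only: mult_ac)
  qed
  then show "g * f \<in> ker_L" using f g F.poly_ring_mult by (simp add: ker_L_def)
qed (auto simp: ker_L_def distrib_right lin_add F.poly_ring_0 F.poly_ring_add)

lemma prod_X: "(\<Prod>v\<in>\<sigma>. X v) = (mon (ind \<sigma>) :: 'k mpoly fract mpoly)"
  by (simp add: X_def ind_def mon_sum)

lemma lin_L_nonface: "keys \<alpha> \<notin> \<Delta> \<Longrightarrow> lin L (mon \<alpha> * g) = 0"
proof -
  assume *: "keys \<alpha> \<notin> \<Delta>"
  have "lin L (mon \<alpha> * mon N) = 0" for N
    using * Delta_sub L_nonface[of "\<alpha> + N"] by (simp add: mult_single keys_add_nat) blast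
  then show ?thesis by (rule lin_mult_eq_0)
qed

definition sr_gens :: "'k mpoly fract mpoly set" where
  "sr_gens = {\<Prod>v\<in>\<tau>. X v | \<tau>. \<tau> \<subseteq> {..<n} \<and> \<tau> \<notin> \<Delta>}"

lemma sr_ideal_eq: "sr_ideal n F \<Delta> = genideal R sr_gens"
  by (simp add: sr_ideal_def sr_gens_def)

lemma sr_gens_ker_L: "sr_gens \<subseteq> ker_L"
proof
  fix f assume "f \<in> sr_gens"
  then obtain \<tau> where \<tau>: "f = mon (ind \<tau>)" "\<tau> \<subseteq> {..<n}" "\<tau> \<notin> \<Delta>"
    unfolding sr_gens_def prod_X by blast
  have "keys (ind \<tau>) = \<tau>" using \<tau>(2) by (intro keys_ind) (auto intro: finite_subset)
  then show "f \<in> ker_L"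
    using \<tau> lin_L_nonface[of "ind \<tau>"] by (auto simp: ker_L_def intro: F.poly_ring_mono)
qed

lemma sr_gens_carrier: "sr_gens \<subseteq> carrier R"
  using sr_gens_ker_L by (auto simp: ker_L_def)

lemma ideal_sr: "ideal (sr_ideal n F \<Delta>) R"
  unfolding sr_ideal_eq by (rule R.genideal_ideal[OF sr_gens_carrier])

lemma sr_ideal_ker_L: "sr_ideal n F \<Delta> \<subseteq> ker_L"
  unfolding sr_ideal_eq by (rule R.genideal_minimal[OF ideal_ker_L sr_gens_ker_L])

lemma mon_in_sr_ideal:
  assumes "keys \<alpha> \<subseteq> {..<n}" "keys \<alpha> \<notin> \<Delta>"
  shows "mon \<alpha> \<in> sr_ideal n F \<Delta>"
proof -
  let ?\<tau> = "keys \<alpha>"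
  have "mon (ind ?\<tau>) \<in> sr_gens" using assms unfolding sr_gens_def prod_X by blast
  then have g: "mon (ind ?\<tau>) \<in> sr_ideal n F \<Delta>"
    unfolding sr_ideal_eq using R.genideal_self[OF sr_gens_carrier] by blast
  have "\<alpha> = (\<alpha> - ind ?\<tau>) + ind ?\<tau>"
    by (rule poly_mapping_eqI) (auto simp: lookup_add lookup_minus lookup_ind in_keys_iff)
  then have "mon \<alpha> = mon (\<alpha> - ind ?\<tau>) * (mon (ind ?\<tau>) :: 'k mpoly fract mpoly)"
    by (metis mon_add)
  moreover have "mon (\<alpha> - ind ?\<tau>) \<in> carrier R"
  proof (rule F.poly_ring_mono)
    have "keys (\<alpha> - ind ?\<tau>) \<subseteq> ?\<tau>"
      using in_keys_iff by (fastforce simp: lookup_minus in_keys_iff)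
    then show "keys (\<alpha> - ind ?\<tau>) \<subseteq> {..<n}" using assms(1) by blast
  qed
  ultimately show ?thesis using ideal.I_l_closed[OF ideal_sr g] by simp
qed

section \<open>The Stanley-Reisner ring and the Artinian reduction\<close>

abbreviation SR :: "'k mpoly fract mpoly set ring" where
  "SR \<equiv> sr_ring n F \<Delta>"

interpretation SR: cring SR
  unfolding sr_ring_def by (rule ideal.quotient_is_cring[OF ideal_sr F.cring_poly_ring])

abbreviation srp :: "'k mpoly fract mpoly \<Rightarrow> 'k mpoly fract mpoly set" where
  "srp \<equiv> sr_proj n F \<Delta>"

lemma srp_carrier: "f \<in> carrier R \<Longrightarrow> srp f \<in> carrier SR"
  by (auto simp: sr_proj_def sr_ring_def carrier_Quot)

lemma srp_eq_iff: "f \<in> carrier R \<Longrightarrow> g \<in> carrier R \<Longrightarrow> srp f = srp g \<longleftrightarrow> f - g \<in> sr_ideal n F \<Delta>"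
  unfolding sr_proj_def
  by (simp add: coset_eq_iff[OF F.cring_poly_ring ideal_sr] F.a_minus_poly_ring)

lemma srp_hom:
  assumes "f \<in> carrier R" "g \<in> carrier R"
  shows "srp (f + g) = srp f \<oplus>\<^bsub>SR\<^esub> srp g" "srp (f * g) = srp f \<otimes>\<^bsub>SR\<^esub> srp g"
  using coset_hom[OF ideal_sr assms] by (simp_all add: sr_proj_def sr_ring_def)

lemma srp_minus:
  assumes "f \<in> carrier R" "g \<in> carrier R"
  shows "srp (f - g) = srp f \<ominus>\<^bsub>SR\<^esub> srp g"
proof -
  interpret h: ring_hom_ring R SR srp
    unfolding sr_proj_def sr_ring_def by (rule ideal.rcos_ring_hom_ring[OF ideal_sr])
  have "srp (f - g) = srp (f \<oplus>\<^bsub>R\<^esub> (\<ominus>\<^bsub>R\<^esub> g))" using assms by (simp add: F.a_inv_poly_ring)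
  also have "\<dots> = srp f \<oplus>\<^bsub>SR\<^esub> (\<ominus>\<^bsub>SR\<^esub> srp g)"
    using assms h.hom_add[OF assms(1) R.a_inv_closed[OF assms(2)]] h.hom_a_inv[OF assms(2)] by simp
  finally show ?thesis by (simp add: a_minus_def)
qed

abbreviation th :: "nat \<Rightarrow> 'k mpoly fract mpoly" where
  "th \<equiv> theta \<Delta> \<kappa> \<I>"

lemma theta_carrier: "th k \<in> carrier R"
  unfolding theta_def X_def
  by (intro F.poly_ring_sum F.poly_ring_mult F.poly_ring_const P_in_F F.poly_ring_mono)
    (auto simp: Vt_lt_n)

lemma theta_in_ker_L: "k < d \<Longrightarrow> th k \<in> ker_L"
proof -
  assume k: "k < d"
  have "lin L (row k * mon N) = 0" for N
  proof -
    have "lin L (row k * mon N) = (\<Sum>v\<in>Vt. P k v * L (N + e1 v))"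
      unfolding row_eq[OF k] by (simp add: sum_distrib_right lin_sum mult_single add.commute)
    also have "\<dots> = 0"
    proof (cases "Suc (total_deg N) = d")
      case True
      then show ?thesis using L_linear_relation k by blast
    qed (simp add: L_def)
    finally show ?thesis .
  qed
  then have "lin L (row k * g) = 0" for g by (rule lin_mult_eq_0)
  then show ?thesis
    using theta_carrier[of k] by (simp add: ker_L_def theta_eq_row[OF k])
qed

abbreviation th_ideal :: "'k mpoly fract mpoly set set" where
  "th_ideal \<equiv> theta_ideal n d \<Delta> \<kappa> \<I>"

lemma theta_gens_carrier: "{srp (th k) | k. k < d} \<subseteq> carrier SR"
  using srp_carrier theta_carrier by blast

lemma ideal_theta: "ideal th_ideal SR"
  unfolding theta_ideal_def by (rule SR.genideal_ideal[OF theta_gens_carrier])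

lemma theta_in_theta_ideal: "k < d \<Longrightarrow> srp (th k) \<in> th_ideal"
  unfolding theta_ideal_def using SR.genideal_self[OF theta_gens_carrier] by blast

lemma theta_ideal_ker_L: "th_ideal \<subseteq> srp ` ker_L"
  unfolding theta_ideal_def
proof (rule SR.genideal_minimal)
  show "ideal (srp ` ker_L) SR"
    unfolding sr_proj_def[abs_def] sr_ring_def
    by (rule ideal_image_Quot[OF F.cring_poly_ring ideal_sr ideal_ker_L])
  show "{srp (th k) | k. k < d} \<subseteq> srp ` ker_L" using theta_in_ker_L by blast
qed

abbreviation A :: "'k mpoly fract mpoly set set ring" where
  "A \<equiv> artinian_reduction n d \<Delta> \<kappa> \<I>"

abbreviation Ap :: "'k mpoly fract mpoly \<Rightarrow> 'k mpoly fract mpoly set set" where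
  "Ap \<equiv> A_proj n d \<Delta> \<kappa> \<I>"

lemma Ap_hom:
  assumes "f \<in> carrier R" "g \<in> carrier R"
  shows "Ap (f + g) = Ap f \<oplus>\<^bsub>A\<^esub> Ap g" "Ap (f * g) = Ap f \<otimes>\<^bsub>A\<^esub> Ap g"
  using coset_hom[OF ideal_theta srp_carrier[OF assms(1)] srp_carrier[OF assms(2)]]
  by (simp_all add: A_proj_def artinian_reduction_def srp_hom assms)

lemma Ap_eq_iff:
  assumes "f \<in> carrier R" "g \<in> carrier R"
  shows "Ap f = Ap g \<longleftrightarrow> srp (f - g) \<in> th_ideal"
  unfolding A_proj_def
  by (simp add: coset_eq_iff[OF SR.cring_axioms ideal_theta] srp_carrier assms srp_minus)

text \<open>This makes \<open>L\<close> well defined on A: the nonface monomials and the theta_k lie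
  in \<open>ker_L\<close>, hence so does everything that becomes zero in A.\<close>

lemma Ap_eq_ker_L:
  assumes "f \<in> carrier R" "g \<in> carrier R" "Ap f = Ap g"
  shows "f - g \<in> ker_L"
proof -
  have fg: "f - g \<in> carrier R" using assms by (intro F.poly_ring_diff)
  obtain h where h: "h \<in> ker_L" "srp (f - g) = srp h"
    using assms Ap_eq_iff theta_ideal_ker_L by blast
  have hc: "h \<in> carrier R" using h by (simp add: ker_L_def)
  have "(f - g) - h \<in> ker_L" using h(2) srp_eq_iff[OF fg hc] sr_ideal_ker_L by blast
  then have "((f - g) - h) + h \<in> ker_L"
    using h(1) additive_subgroup.a_closed[OF ideal.axioms(1)[OF ideal_ker_L]] by fastforce
  then show ?thesis by simp
qed

section \<open>Existence and uniqueness of Psi\<close>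

abbreviation Rd :: "'k mpoly fract mpoly set" where
  "Rd \<equiv> deg_part n F d"

lemma Rd_carrier: "f \<in> Rd \<Longrightarrow> f \<in> carrier R"
  by (simp add: deg_part_def)

lemma Rd_mono: "total_deg \<alpha> = d \<Longrightarrow> keys \<alpha> \<subseteq> {..<n} \<Longrightarrow> mon \<alpha> \<in> Rd"
  by (simp add: deg_part_def F.poly_ring_mono)

lemma Rd_add: "f \<in> Rd \<Longrightarrow> g \<in> Rd \<Longrightarrow> f + g \<in> Rd"
  using Poly_Mapping.keys_add[of f g] by (fastforce simp: deg_part_def intro: F.poly_ring_add)

lemma Rd_const_mult: "c \<in> F \<Longrightarrow> f \<in> Rd \<Longrightarrow> const c * f \<in> Rd"
  using keys_const_mult[of c f]
  by (fastforce simp: deg_part_def intro: F.poly_ring_mult F.poly_ring_const)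

lemma Rd_0: "0 \<in> Rd"
  by (simp add: deg_part_def F.poly_ring_0)

text \<open>The value is independent of the chosen representative by \<open>Ap_eq_ker_L\<close>. Off
  the degree d part it is \<open>undefined\<close>, because linear functionals are required to be
  extensional.\<close>

definition psi :: "'k mpoly fract mpoly set set \<Rightarrow> 'k mpoly fract" where
  "psi y = (if y \<in> A_part n d \<Delta> \<kappa> \<I> d then lin L (SOME f. f \<in> Rd \<and> y = Ap f) else undefined)"

lemma psi_Ap:
  assumes "f \<in> Rd"
  shows "psi (Ap f) = lin L f"
proof -
  have ex: "\<exists>g. g \<in> Rd \<and> Ap f = Ap g" using assms by blast
  let ?g = "SOME g. g \<in> Rd \<and> Ap f = Ap g"
  have g: "?g \<in> Rd" "Ap f = Ap ?g" using someI_ex[OF ex] by blast+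
  have "f - ?g \<in> ker_L" using Ap_eq_ker_L Rd_carrier assms g by blast
  then have "lin L ((f - ?g) * 1) = 0" unfolding ker_L_def by blast
  then have "lin L f = lin L ?g" by (simp add: lin_diff)
  moreover have "Ap f \<in> A_part n d \<Delta> \<kappa> \<I> d" using assms by (simp add: A_part_def)
  ultimately show ?thesis by (simp add: psi_def)
qed

lemma lin_L_in_F: "f \<in> carrier R \<Longrightarrow> lin L f \<in> F"
  using L_in_F by (intro F.lin_closed) (auto simp: carrier_poly_ring)

lemma Fc_lt_n: "\<sigma> \<in> Fc \<Longrightarrow> \<sigma> \<subseteq> {..<n}"
  using Fc_Vt Vt_lt_n by blast

lemma is_Psi_psi: "is_Psi n d \<Delta> \<kappa> \<I> \<mu> psi"
  unfolding is_Psi_def linear_functional_def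
proof (intro conjI ballI)
  show "psi \<in> A_part n d \<Delta> \<kappa> \<I> d \<rightarrow>\<^sub>E F"
  proof (rule PiE_I)
    fix y :: "'k mpoly fract mpoly set set" assume "y \<in> A_part n d \<Delta> \<kappa> \<I> d"
    then show "psi y \<in> F" using psi_Ap lin_L_in_F Rd_carrier by (auto simp: A_part_def)
  qed (simp add: psi_def)
next
  fix x y :: "'k mpoly fract mpoly set set"
  assume "x \<in> A_part n d \<Delta> \<kappa> \<I> d" "y \<in> A_part n d \<Delta> \<kappa> \<I> d"
  then obtain f g where fg: "f \<in> Rd" "x = Ap f" "g \<in> Rd" "y = Ap g" by (auto simp: A_part_def)
  then have "x \<oplus>\<^bsub>A\<^esub> y = Ap (f + g)" using Ap_hom Rd_carrier by simp
  then show "psi (x \<oplus>\<^bsub>A\<^esub> y) = psi x + psi y" using fg Rd_add by (simp add: psi_Ap lin_add)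
next
  fix c and x :: "'k mpoly fract mpoly set set"
  assume c: "c \<in> F" and "x \<in> A_part n d \<Delta> \<kappa> \<I> d"
  then obtain f where f: "f \<in> Rd" "x = Ap f" by (auto simp: A_part_def)
  then have "Ap (const c) \<otimes>\<^bsub>A\<^esub> x = Ap (const c * f)"
    using Ap_hom Rd_carrier F.poly_ring_const c by simp
  then show "psi (Ap (const c) \<otimes>\<^bsub>A\<^esub> x) = c * psi x"
    using f Rd_const_mult c by (simp add: psi_Ap lin_const_mult)
next
  fix \<sigma> assume s: "\<sigma> \<in> Fc"
  have "mon (ind \<sigma>) \<in> Rd"
    using Fc_lt_n[OF s] by (intro Rd_mono) (simp_all add: total_deg_ind Fc_card[OF s] keys_ind Fc_finite[OF s])
  then show "psi (Ap (\<Prod>v\<in>\<sigma>. X v)) = of_base (\<mu> \<sigma>) / bracket d \<Delta> \<kappa> \<I> \<sigma>"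
    by (simp add: prod_X psi_Ap L_facet[OF s] bracket_eq_br[OF s])
qed

text \<open>Any such functional gives a function on monomials that vanishes on nonfaces, satisfies
  the linear relations because each theta_k is zero in A, and has the facet values.
  \<open>L_unique\<close> leaves only \<open>L\<close>.\<close>

lemma is_Psi_unique:
  assumes "is_Psi n d \<Delta> \<kappa> \<I> \<mu> \<psi>"
  shows "\<psi> = psi"
proof -
  have ext: "\<psi> \<in> A_part n d \<Delta> \<kappa> \<I> d \<rightarrow>\<^sub>E F"
    and padd: "\<And>f g. f \<in> Rd \<Longrightarrow> g \<in> Rd \<Longrightarrow> \<psi> (Ap (f + g)) = \<psi> (Ap f) + \<psi> (Ap g)"
    and pmult: "\<And>c f. c \<in> F \<Longrightarrow> f \<in> Rd \<Longrightarrow> \<psi> (Ap (const c * f)) = c * \<psi> (Ap f)"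
    and pfac: "\<And>\<sigma>. \<sigma> \<in> Fc \<Longrightarrow> \<psi> (Ap (mon (ind \<sigma>))) = of_base (\<mu> \<sigma>) / br \<sigma>"
    using assms Ap_hom Rd_carrier F.poly_ring_const
    by (auto simp: is_Psi_def linear_functional_def A_part_def prod_X bracket_eq_br)
  have p0: "\<psi> (Ap 0) = 0" using padd[OF Rd_0 Rd_0] by (metis add.right_neutral add_left_cancel)
  have psum: "\<psi> (Ap (\<Sum>i\<in>B. const (c i) * f i)) = (\<Sum>i\<in>B. c i * \<psi> (Ap (f i)))"
    if "finite B" "\<And>i. i \<in> B \<Longrightarrow> c i \<in> F \<and> f i \<in> Rd"
    for B :: "'i set" and c and f :: "'i \<Rightarrow> 'k mpoly fract mpoly"
  proof -
    have "(\<Sum>i\<in>B. const (c i) * f i) \<in> Rd \<and> ?thesis"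
      using that
    proof (induction B rule: finite_induct)
      case empty
      then show ?case using p0 Rd_0 by simp
    next
      case (insert i B)
      then show ?case by (simp add: padd pmult Rd_add Rd_const_mult)
    qed
    then show ?thesis by blast
  qed
  \<comment> \<open>Monomials with variables outside the polynomial ring get the value 0. Their
    supports are nonfaces, and a relation based at such a monomial has only zero terms.\<close>
  define l where "l \<alpha> = (if keys \<alpha> \<subseteq> {..<n} then \<psi> (Ap (mon \<alpha>)) else 0)" for \<alpha>
  have lL: "l \<alpha> = L \<alpha>" if deg: "total_deg \<alpha> = d" for \<alpha>
  proof (rule L_unique[OF _ _ _ deg])
    fix \<alpha> :: "nat \<Rightarrow>\<^sub>0 nat" assume *: "total_deg \<alpha> = d" "keys \<alpha> \<notin> \<Delta>"
    show "l \<alpha> = 0"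
    proof (cases "keys \<alpha> \<subseteq> {..<n}")
      case True
      then have "srp (mon \<alpha>) = srp 0"
        using mon_in_sr_ideal *(2) by (simp add: srp_eq_iff F.poly_ring_mono F.poly_ring_0)
      then have "Ap (mon \<alpha>) = Ap 0" by (simp add: A_proj_def)
      then show ?thesis using p0 by (simp add: l_def)
    qed (simp add: l_def)
  next
    fix \<beta> k assume \<beta>: "Suc (total_deg \<beta>) = d" and k: "k < d"
    show "(\<Sum>v\<in>Vt. P k v * l (\<beta> + e1 v)) = 0"
    proof (cases "keys \<beta> \<subseteq> {..<n}")
      case True
      then have kv: "keys (\<beta> + e1 v) \<subseteq> {..<n}" if "v \<in> Vt" for v
        using Vt_lt_n[OF that] by (simp add: keys_add_nat)
      have eq: "(\<Sum>v\<in>Vt. const (P k v) * mon (\<beta> + e1 v)) = mon \<beta> * th k"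
        unfolding theta_def X_def mon_add sum_distrib_left
        by (intro sum.cong refl) (simp add: mult_ac)
      have "(\<Sum>v\<in>Vt. P k v * l (\<beta> + e1 v)) = (\<Sum>v\<in>Vt. P k v * \<psi> (Ap (mon (\<beta> + e1 v))))"
        using kv by (intro sum.cong) (auto simp: l_def)
      also have "\<dots> = \<psi> (Ap (mon \<beta> * th k))"
        unfolding eq[symmetric]
      proof (rule psum[symmetric, OF finite_Vt])
        fix v assume "v \<in> Vt"
        then have "mon (\<beta> + e1 v) \<in> Rd" using \<beta> kv by (intro Rd_mono) simp_all
        then show "P k v \<in> F \<and> mon (\<beta> + e1 v) \<in> Rd" using P_in_F by blast
      qed
      also have "Ap (mon \<beta> * th k) = Ap 0"
      proof -
        have m: "mon \<beta> \<in> carrier R" using True by (rule F.poly_ring_mono)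
        have "srp (mon \<beta> * th k) \<in> th_ideal"
          unfolding srp_hom(2)[OF m theta_carrier]
          using ideal.I_l_closed[OF ideal_theta theta_in_theta_ideal[OF k] srp_carrier[OF m]] .
        then show ?thesis
          using F.poly_ring_mult[OF m theta_carrier] by (simp add: Ap_eq_iff F.poly_ring_0)
      qed
      finally show ?thesis using p0 by simp
    next
      case False
      then have "\<not> keys (\<beta> + e1 v) \<subseteq> {..<n}" for v by (auto simp: keys_add_nat)
      then show ?thesis by (simp add: l_def)
    qed
  next
    fix \<sigma> assume s: "\<sigma> \<in> Fc"
    then show "l (ind \<sigma>) = of_base (\<mu> \<sigma>) / br \<sigma>"
      using pfac Fc_lt_n Fc_finite by (simp add: l_def keys_ind)
  qed
  have "\<psi> (Ap f) = psi (Ap f)" if f: "f \<in> Rd" for f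
  proof -
    have kf: "keys \<alpha> \<subseteq> {..<n}" "total_deg \<alpha> = d" if "\<alpha> \<in> keys f" for \<alpha>
      using f that by (auto simp: deg_part_def carrier_poly_ring indets_def)
    have "f = (\<Sum>\<alpha>\<in>keys f. const (lookup f \<alpha>) * mon \<alpha>)"
      unfolding single_eq_const_mult[symmetric] by (rule poly_mapping_expand)
    moreover have "\<psi> (Ap (\<Sum>\<alpha>\<in>keys f. const (lookup f \<alpha>) * mon \<alpha>)) =
        (\<Sum>\<alpha>\<in>keys f. lookup f \<alpha> * \<psi> (Ap (mon \<alpha>)))"
      using Rd_carrier[OF f] kf by (intro psum conjI Rd_mono) (auto simp: carrier_poly_ring)
    ultimately have "\<psi> (Ap f) =
        (\<Sum>\<alpha>\<in>keys f. lookup f \<alpha> * \<psi> (Ap (mon \<alpha>)))"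
      by simp
    also have "\<dots> = lin L f"
      unfolding lin_def
    proof (intro sum.cong refl)
      fix \<alpha> assume "\<alpha> \<in> keys f"
      then show "lookup f \<alpha> * \<psi> (Ap (mon \<alpha>)) = lookup f \<alpha> * L \<alpha>"
        using lL[of \<alpha>] kf by (simp add: l_def)
    qed
    finally show ?thesis using psi_Ap[OF f] by simp
  qed
  moreover have "psi \<in> A_part n d \<Delta> \<kappa> \<I> d \<rightarrow>\<^sub>E F"
    using is_Psi_psi by (simp add: is_Psi_def linear_functional_def)
  ultimately show ?thesis
    using ext by (intro PiE_ext) (auto simp: A_part_def)
qed

lemma Psi_Ap: "f \<in> Rd \<Longrightarrow> Psi n d \<Delta> \<kappa> \<I> \<mu> (Ap f) = lin L f"
  unfolding Psi_def using the_equality[of "is_Psi n d \<Delta> \<kappa> \<I> \<mu>", OF is_Psi_psi is_Psi_unique] psi_Ap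
  by simp

subsection \<open>The Gorensteinification as a quotient by the kernel\<close>

lemma lookup_hom_component:
  "lookup (hom_component k f) \<alpha> = (if total_deg \<alpha> = k then lookup f \<alpha> else 0)"
  by (auto simp: hom_component_def lookup_sum lookup_single when_def in_keys_iff sum.delta')

text \<open>\<open>L\<close> sees only total degree d, so a factor of degree d - k picks out the
  component of degree k.\<close>

lemma lin_L_hom_component:
  assumes "k \<le> d" "\<And>\<beta>. \<beta> \<in> keys g \<Longrightarrow> total_deg \<beta> = d - k"
  shows "lin L (hom_component k f * g) = lin L (f * g)"
proof -
  have "lin L (hom_component k f * mon N) = lin L (f * mon N)" if N: "total_deg N = d - k" for N
  proof -
    have "lin (\<lambda>\<alpha>. L (\<alpha> + N)) (hom_component k f) =
        (\<Sum>\<alpha>\<in>keys f. lookup (hom_component k f) \<alpha> * L (\<alpha> + N))"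
      by (rule lin_superset) (auto simp: in_keys_iff lookup_hom_component split: if_splits)
    also have "\<dots> = lin (\<lambda>\<alpha>. L (\<alpha> + N)) f"
      unfolding lin_def using N assms(1)
      by (intro sum.cong) (auto simp: lookup_hom_component L_def)
    finally show ?thesis by (simp only: lin_mult_mono)
  qed
  then show ?thesis
    unfolding lin_mult_sum_mono[of L _ g] using assms(2) by (intro sum.cong) auto
qed

lemma hom_component_mult_Rd:
  assumes "f \<in> carrier R" "k \<le> d" "g \<in> deg_part n F (d - k)"
  shows "hom_component k f * g \<in> Rd"
proof -
  have sub: "keys (hom_component k f) \<subseteq> {\<alpha> \<in> keys f. total_deg \<alpha> = k}"
    by (auto simp: in_keys_iff lookup_hom_component split: if_splits)
  then have "hom_component k f \<in> carrier R"
    using assms(1) unfolding carrier_poly_ring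
    by (auto simp: indets_def lookup_hom_component F.zero_closed)
  then have "hom_component k f * g \<in> carrier R"
    using assms(3) by (auto simp: deg_part_def intro: F.poly_ring_mult)
  moreover have "total_deg \<gamma> = d" if \<gamma>: "\<gamma> \<in> keys (hom_component k f * g)" for \<gamma>
  proof -
    obtain \<alpha> \<beta> where "\<gamma> = \<alpha> + \<beta>" "\<alpha> \<in> keys (hom_component k f)" "\<beta> \<in> keys g"
      using keys_mult[of "hom_component k f" g] \<gamma> by blast
    then show ?thesis using sub assms(2,3) by (auto simp: deg_part_def)
  qed
  ultimately show ?thesis by (simp add: deg_part_def)
qed

text \<open>The definition tests each component against forms of complementary degree over F; since
  \<open>L\<close> lives in degree d, testing the whole polynomial against all monomials is the
  same.\<close>

lemma gor_ideal_eq: "gor_ideal n d \<Delta> \<kappa> \<I> \<mu> = ker_L"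
proof (intro equalityI subsetI)
  fix f assume f: "f \<in> ker_L"
  then have fR: "f \<in> carrier R" by (simp add: ker_L_def)
  have "Psi n d \<Delta> \<kappa> \<I> \<mu> (Ap (hom_component k f * g)) = 0"
    if k: "k \<le> d" and g: "g \<in> deg_part n F (d - k)" for k g
  proof -
    have "Psi n d \<Delta> \<kappa> \<I> \<mu> (Ap (hom_component k f * g)) = lin L (f * g)"
      using Psi_Ap[OF hom_component_mult_Rd[OF fR k g]] lin_L_hom_component[OF k, of g f] g
      by (simp add: deg_part_def)
    then show ?thesis using f by (simp add: ker_L_def)
  qed
  then show "f \<in> gor_ideal n d \<Delta> \<kappa> \<I> \<mu>" using fR by (simp add: gor_ideal_def)
next
  fix f assume f: "f \<in> gor_ideal n d \<Delta> \<kappa> \<I> \<mu>"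
  then have fR: "f \<in> carrier R" by (simp add: gor_ideal_def)
  have "lin L (f * mon N) = 0" for N
  proof (cases "keys N \<subseteq> {..<n} \<and> total_deg N \<le> d")
    case True
    define k where "k = d - total_deg N"
    have k: "k \<le> d" "d - k = total_deg N" using True by (auto simp: k_def)
    then have g: "mon N \<in> deg_part n F (d - k)" using True by (simp add: deg_part_def F.poly_ring_mono)
    have "lin L (f * mon N) = lin L (hom_component k f * mon N)"
      by (rule lin_L_hom_component[symmetric]) (use k in auto)
    also have "\<dots> = 0"
      using f g k Psi_Ap[OF hom_component_mult_Rd[OF fR k(1) g]] by (auto simp: gor_ideal_def)
    finally show ?thesis .
  next
    case False
    \<comment> \<open>Monomials of degree above d, or with variables outside the ring, are not among
      the test forms, but they pair to zero with everything.\<close>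
    have "L (\<alpha> + N) = 0" for \<alpha>
    proof (rule ccontr)
      assume nz: "L (\<alpha> + N) \<noteq> 0"
      show False
        using False L_nonzero(1)[OF nz] L_nonzero(3)[OF nz] Vt_lt_n by (auto simp: keys_add_nat)
    qed
    then have "lin (\<lambda>\<alpha>. L (\<alpha> + N)) f = 0" by (simp add: lin_def)
    then show ?thesis by (simp only: lin_mult_mono)
  qed
  then show "f \<in> ker_L" using fR lin_mult_eq_0 by (auto simp: ker_L_def)
qed

abbreviation B :: "'k mpoly fract mpoly set ring" where
  "B \<equiv> gorensteinification n d \<Delta> \<kappa> \<I> \<mu>"

abbreviation Bp :: "'k mpoly fract mpoly \<Rightarrow> 'k mpoly fract mpoly set" where
  "Bp \<equiv> B_proj n d \<Delta> \<kappa> \<I> \<mu>"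

abbreviation Bd :: "(nat \<Rightarrow> nat) \<Rightarrow> 'k mpoly fract mpoly set set" where
  "Bd \<equiv> B_part n m d \<Delta> \<kappa> \<I> \<mu>"

abbreviation Rm :: "(nat \<Rightarrow> nat) \<Rightarrow> 'k mpoly fract mpoly set" where
  "Rm \<equiv> multideg_part n m \<kappa> F"

lemma B_eq: "B = R Quot ker_L" and Bp_eq: "Bp f = ker_L +>\<^bsub>R\<^esub> f"
  by (simp_all add: gorensteinification_def B_proj_def gor_ideal_eq)

interpretation B: cring B
  unfolding B_eq by (rule ideal.quotient_is_cring[OF ideal_ker_L F.cring_poly_ring])

lemma Bp_carrier: "f \<in> carrier R \<Longrightarrow> Bp f \<in> carrier B"
  by (auto simp: B_eq Bp_eq carrier_Quot)

lemma Bp_hom: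
  assumes "f \<in> carrier R" "g \<in> carrier R"
  shows "Bp (f + g) = Bp f \<oplus>\<^bsub>B\<^esub> Bp g" "Bp (f * g) = Bp f \<otimes>\<^bsub>B\<^esub> Bp g"
  using coset_hom[OF ideal_ker_L assms] by (simp_all add: B_eq Bp_eq)

lemma Bp_1: "Bp 1 = \<one>\<^bsub>B\<^esub>"
  using coset_hom(3)[OF ideal_ker_L F.poly_ring_1 F.poly_ring_1] by (simp add: B_eq Bp_eq)

lemma Bp_eq_iff:
  assumes "f \<in> carrier R" "g \<in> carrier R"
  shows "Bp f = Bp g \<longleftrightarrow> (\<forall>h. lin L ((f - g) * h) = 0)"
  unfolding Bp_eq coset_eq_iff[OF F.cring_poly_ring ideal_ker_L assms] F.a_minus_poly_ring[OF assms]
  using F.poly_ring_diff[OF assms] by (simp add: ker_L_def)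

lemma Bp_eq_lin: "f \<in> carrier R \<Longrightarrow> g \<in> carrier R \<Longrightarrow> Bp f = Bp g \<Longrightarrow> lin L (f * h) = lin L (g * h)"
  by (simp add: Bp_eq_iff left_diff_distrib lin_diff)

lemma Rm_iff: "f \<in> Rm b \<longleftrightarrow> f \<in> carrier R \<and> homog b f"
  by (simp add: multideg_part_def homog_def mdeg_def)

lemma Rm_carrier: "f \<in> Rm b \<Longrightarrow> f \<in> carrier R"
  by (simp add: Rm_iff)

lemma Bd_cong: "(\<And>j. j < m \<Longrightarrow> b j = c j) \<Longrightarrow> Bd b = Bd c"
  by (simp add: B_part_def multideg_part_def)

lemma Bp_power: "f \<in> carrier R \<Longrightarrow> Bp (f ^ i) = Bp f [^]\<^bsub>B\<^esub> (i::nat)"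
  by (induction i)
    (simp_all add: Bp_1 Bp_hom F.poly_ring_power Bp_carrier B.m_comm)

lemma Bp_prod:
  assumes "finite J" "\<And>j. j \<in> J \<Longrightarrow> f j \<in> carrier R"
  shows "Bp (prod f J) = (\<Otimes>\<^bsub>B\<^esub>j\<in>J. Bp (f j))"
  using assms
proof (induction J rule: finite_induct)
  case (insert j J)
  then show ?case
    by (subst B.finprod_insert) (auto simp: Bp_hom Bp_carrier F.poly_ring_prod)
qed (simp add: Bp_1)

lemma ell_carrier: "(\<And>v. v \<in> Vt \<Longrightarrow> \<tau> v \<in> F) \<Longrightarrow> ell \<tau> j \<in> carrier R"
  unfolding ell_def by (intro F.poly_ring_sum F.poly_ring_single) (auto simp: Vt_lt_n)

lemma ell_pow_carrier: "(\<And>v. v \<in> Vt \<Longrightarrow> \<tau> v \<in> F) \<Longrightarrow> ell_pow \<tau> e \<in> carrier R"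
  unfolding ell_pow_def by (intro F.poly_ring_prod F.poly_ring_power ell_carrier)

lemma monomial_power_ell:
  assumes "\<And>v. v \<in> Vt \<Longrightarrow> \<tau> v \<in> F" "\<And>j. j < m \<Longrightarrow> \<l> j = Bp (ell \<tau> j)"
  shows "monomial_power B m \<l> e = Bp (ell_pow \<tau> e)"
proof -
  have "Bp (ell_pow \<tau> e) = (\<Otimes>\<^bsub>B\<^esub>j\<in>{..<m}. Bp (ell \<tau> j ^ e j))"
    unfolding ell_pow_def using assms(1) by (intro Bp_prod F.poly_ring_power ell_carrier) auto
  also have "\<dots> = monomial_power B m \<l> e"
    unfolding monomial_power_def
    by (rule B.finprod_cong')
      (use assms in \<open>auto simp: Bp_power ell_carrier intro!: B.nat_pow_closed Bp_carrier\<close>)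
  finally show ?thesis by simp
qed

text \<open>The Gram matrices see the forms only through their classes in B. This matters because
  \<open>coords\<close> need not return the coefficient vector from which a form was built.\<close>

lemma gram_cong:
  assumes "\<And>v. v \<in> Vt \<Longrightarrow> \<tau> v \<in> F" "\<And>v. v \<in> Vt \<Longrightarrow> \<tau>' v \<in> F"
    and eq: "\<And>j. j < m \<Longrightarrow> Bp (ell \<tau> j) = Bp (ell \<tau>' j)"
  shows "gram \<tau> = gram \<tau>'"
proof -
  have "Bp (ell_pow \<tau> e) = Bp (ell_pow \<tau>' e)" for e
    using monomial_power_ell[of \<tau> "\<lambda>j. Bp (ell \<tau> j)" e] monomial_power_ell[of \<tau>' "\<lambda>j. Bp (ell \<tau> j)" e]
      assms by simp
  then have "form b \<tau> = form b \<tau>'" for b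
    unfolding form_def using Bp_eq_lin[OF ell_pow_carrier ell_pow_carrier] assms(1,2) by blast
  then show ?thesis by (simp add: gram_def)
qed

subsection \<open>Coordinates of linear forms\<close>

lemma unit_le: "i < m \<Longrightarrow> unit_vec_nat j i \<le> a i"
  using a_pos[of i] by (auto simp: unit_vec_nat_def)

text \<open>It identifies the monomials in a basis of multidegree e_j with variables of colour j, so
  that coordinates become coefficients of a linear form.\<close>

lemma Mon_unit:
  assumes j: "j < m" and \<alpha>: "\<alpha> \<in> Mon (unit_vec_nat j)"
  obtains v where "v \<in> Vt" "\<kappa> v = j" "\<alpha> = e1 v"
proof -
  have cj: "col (d + j) = j" by (simp add: col_def)
  have "\<exists>V N. V \<in> Pi\<^sub>E {d + j} C \<and> (\<Sum>k\<in>{d + j}. e1 (V k)) + N = \<alpha>"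
    by (rule assignment_exists) (use \<alpha> j cj in \<open>auto simp: Mon_def unit_vec_nat_def Collect_conv_if\<close>)
  then obtain v N where v: "v \<in> C (d + j)" "e1 v + N = \<alpha>" by auto
  then have vj: "v \<in> Vt" "\<kappa> v = j" by (simp_all add: C_def cj)
  have "lookup N w = 0" for w
  proof (rule ccontr)
    assume nz: "lookup N w \<noteq> 0"
    then have "w \<in> keys \<alpha>" unfolding v(2)[symmetric] keys_add_nat by (simp add: in_keys_iff)
    then have w: "w \<in> Vt" using \<alpha> by (auto simp: Mon_def)
    have "mdeg \<alpha> (\<kappa> w) = unit_vec_nat j (\<kappa> w)" using \<alpha> kappa_lt[OF w] by (simp add: Mon_def)
    then have "mdeg N (\<kappa> w) = 0"
      unfolding v(2)[symmetric] using vj Vt_lt_n by (auto simp: mdeg_e1 unit_vec_nat_def split: if_splits)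
    then show False using lookup_le_mdeg[OF Vt_lt_n[OF w], of N] nz by simp
  qed
  then have "N = 0" by (simp add: poly_mapping_eqI)
  then show ?thesis using v vj that by simp
qed

definition coordinate :: "nat \<Rightarrow> 'k mpoly fract mpoly set \<Rightarrow> 'k mpoly fract" where
  "coordinate v y = (let b = unit_vec_nat (\<kappa> v) in
     if y \<in> Bd b then coord b (basis_dual b) (e1 v) (SOME f. f \<in> Rm b \<and> y = Bp f) else undefined)"

lemma coordinate_Bp:
  assumes "f \<in> Rm (unit_vec_nat (\<kappa> v))"
  shows "coordinate v (Bp f) = coord (unit_vec_nat (\<kappa> v)) (basis_dual (unit_vec_nat (\<kappa> v))) (e1 v) f"
proof -
  let ?b = "unit_vec_nat (\<kappa> v)"
  have ex: "\<exists>g. g \<in> Rm ?b \<and> Bp f = Bp g" using assms by blast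
  let ?g = "SOME g. g \<in> Rm ?b \<and> Bp f = Bp g"
  have g: "?g \<in> Rm ?b" "Bp f = Bp ?g" using someI_ex[OF ex] by blast+
  have "lin L (?g * mon M) = lin L (f * mon M)" for M
    by (rule Bp_eq_lin) (use g assms Rm_carrier in auto)
  then have "coord ?b (basis_dual ?b) (e1 v) ?g = coord ?b (basis_dual ?b) (e1 v) f"
    by (simp add: coord_def)
  moreover have "Bp f \<in> Bd ?b" using assms by (simp add: B_part_def)
  ultimately show ?thesis by (simp add: coordinate_def Let_def)
qed

lemma coordinate_linear:
  assumes s: "e1 v \<in> basis_set (unit_vec_nat (\<kappa> v))"
  shows "linear_functional B F (B_scalar n d \<Delta> \<kappa> \<I> \<mu>) (Bd (unit_vec_nat (\<kappa> v))) (coordinate v)"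
  unfolding linear_functional_def
proof (intro conjI ballI)
  let ?b = "unit_vec_nat (\<kappa> v)"
  note basis = is_basis_chosen[of ?b]
  show "coordinate v \<in> Bd ?b \<rightarrow>\<^sub>E F"
  proof (rule PiE_I)
    fix y :: "'k mpoly fract mpoly set" assume "y \<in> Bd ?b"
    then obtain f where f: "f \<in> Rm ?b" "y = Bp f" by (auto simp: B_part_def)
    have "lin L (f * mon M) \<in> F" for M
      unfolding lin_mult_mono using Rm_carrier[OF f(1)] L_in_F
      by (intro F.lin_closed) (auto simp: carrier_poly_ring)
    then have "coord ?b (basis_dual ?b) (e1 v) f \<in> F"
      unfolding coord_def using basis s
      by (intro F.sum_closed F.mult_closed) (auto simp: is_basis_def)
    then show "coordinate v y \<in> F" using f coordinate_Bp by simp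
  qed (simp add: coordinate_def)
next
  let ?b = "unit_vec_nat (\<kappa> v)"
  fix x y :: "'k mpoly fract mpoly set" assume "x \<in> Bd ?b" "y \<in> Bd ?b"
  then obtain f g where fg: "f \<in> Rm ?b" "x = Bp f" "g \<in> Rm ?b" "y = Bp g" by (auto simp: B_part_def)
  then have "f + g \<in> Rm ?b" by (simp add: Rm_iff F.poly_ring_add homog_add)
  moreover have "x \<oplus>\<^bsub>B\<^esub> y = Bp (f + g)" using fg Bp_hom Rm_carrier by simp
  ultimately show "coordinate v (x \<oplus>\<^bsub>B\<^esub> y) = coordinate v x + coordinate v y"
    using fg coord_add[OF unit_le is_basis_chosen] by (simp add: coordinate_Bp)
next
  let ?b = "unit_vec_nat (\<kappa> v)"
  fix c and x :: "'k mpoly fract mpoly set" assume c: "c \<in> F" and "x \<in> Bd ?b"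
  then obtain f where f: "f \<in> Rm ?b" "x = Bp f" by (auto simp: B_part_def)
  have "homog ?b (const c * f)" using f keys_const_mult[of c f] by (auto simp: Rm_iff homog_def)
  then have "const c * f \<in> Rm ?b" using f c by (simp add: Rm_iff F.poly_ring_mult F.poly_ring_const)
  moreover have "B_scalar n d \<Delta> \<kappa> \<I> \<mu> c \<otimes>\<^bsub>B\<^esub> x = Bp (const c * f)"
    using f c Bp_hom Rm_carrier F.poly_ring_const by (simp add: B_scalar_def)
  ultimately show "coordinate v (B_scalar n d \<Delta> \<kappa> \<I> \<mu> c \<otimes>\<^bsub>B\<^esub> x) = c * coordinate v x"
    using f coord_const_mult[OF unit_le is_basis_chosen] by (simp add: coordinate_Bp)
qed

text \<open>Coefficients of the representative supported on the basis variables, with 0 at the other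
  vertices. This choice is linear in each form, so polynomials in the coefficients become members of
  \<open>poly_funs\<close>.\<close>

definition coords :: "(nat \<Rightarrow> 'k mpoly fract mpoly set) \<Rightarrow> nat \<Rightarrow> 'k mpoly fract" where
  "coords \<l> v = (if e1 v \<in> basis_set (unit_vec_nat (\<kappa> v)) then coordinate v (\<l> (\<kappa> v)) else 0)"

abbreviation forms :: "(nat \<Rightarrow> 'k mpoly fract mpoly set) set" where
  "forms \<equiv> \<Pi>\<^sub>E j\<in>{..<m}. Bd (unit_vec_nat j)"

lemma coords_in_F:
  assumes "\<l> \<in> forms" "v \<in> Vt"
  shows "coords \<l> v \<in> F"
proof (cases "e1 v \<in> basis_set (unit_vec_nat (\<kappa> v))")
  case True
  have "\<l> (\<kappa> v) \<in> Bd (unit_vec_nat (\<kappa> v))" using assms kappa_lt by auto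
  then show ?thesis
    using coordinate_linear[OF True] True by (auto simp: linear_functional_def coords_def)
qed (simp add: coords_def F.zero_closed)

lemma ell_coords:
  assumes l: "\<l> \<in> forms" and j: "j < m"
  shows "Bp (ell (coords \<l>) j) = \<l> j"
proof -
  let ?b = "unit_vec_nat j" let ?S = "basis_set ?b" let ?w = "basis_dual ?b"
  have "\<l> j \<in> Bd ?b" using l j by auto
  then obtain f where f: "f \<in> Rm ?b" "\<l> j = Bp f" by (auto simp: B_part_def)
  let ?V = "{v \<in> Vt. \<kappa> v = j}"
  have S: "?S = e1 ` {v \<in> ?V. e1 v \<in> ?S}"
  proof (intro equalityI subsetI)
    fix s assume s: "s \<in> ?S"
    then have "s \<in> Mon ?b" using is_basis_chosen[of ?b] by (auto simp: is_basis_def)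
    then obtain v where "v \<in> Vt" "\<kappa> v = j" "s = e1 v" using Mon_unit[OF j] by metis
    then show "s \<in> e1 ` {v \<in> ?V. e1 v \<in> ?S}" using s by blast
  qed auto
  have inj: "inj_on e1 A" for A by (auto simp: inj_on_def single_eq_const_mult[symmetric])
      (metis lookup_single_eq lookup_single_not_eq nat.distinct(1))
  have "lin L (f * g) = lin L (ell (coords \<l>) j * g)" for g
  proof -
    have "lin L (f * g) = (\<Sum>s\<in>?S. coord ?b ?w s f * lin L (mon s * g))"
      by (rule coord_expand[OF unit_le is_basis_chosen]) (use f in \<open>auto simp: Rm_iff\<close>)
    also have "\<dots> = (\<Sum>v\<in>{v \<in> ?V. e1 v \<in> ?S}. coord ?b ?w (e1 v) f * lin L (mon (e1 v) * g))"
      by (subst S, subst sum.reindex[OF inj]) simp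
    also have "\<dots> = (\<Sum>v\<in>{v \<in> ?V. e1 v \<in> ?S}. coords \<l> v * lin L (mon (e1 v) * g))"
      using f coordinate_Bp by (intro sum.cong) (auto simp: coords_def)
    also have "\<dots> = (\<Sum>v\<in>?V. coords \<l> v * lin L (mon (e1 v) * g))"
      using finite_Vt by (intro sum.mono_neutral_left) (auto simp: coords_def)
    also have "\<dots> = lin L (ell (coords \<l>) j * g)"
    proof -
      have "ell (coords \<l>) j * g = (\<Sum>v\<in>?V. const (coords \<l> v) * (mon (e1 v) * g))"
        unfolding ell_def sum_distrib_right
        by (intro sum.cong refl) (simp only: single_eq_const_mult[of _ "coords _ _"] mult.assoc)
      then show ?thesis by (simp only: lin_sum lin_const_mult)
    qed
    finally show ?thesis .
  qed
  then have "Bp f = Bp (ell (coords \<l>) j)"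
    using f Rm_carrier ell_carrier coords_in_F[OF l]
    by (subst Bp_eq_iff) (auto simp: left_diff_distrib lin_diff)
  then show ?thesis using f by simp
qed

lemma polyfun_coords:
  assumes "h \<in> polyfun F Vt"
  shows "(\<lambda>\<l>. h (coords \<l>)) \<in>
    poly_funs B F (B_scalar n d \<Delta> \<kappa> \<I> \<mu>) m (\<lambda>j. Bd (unit_vec_nat j))"
  using assms
proof induction
  case (const c)
  then show ?case by (rule poly_funs.scalar)
next
  case (var v)
  show ?case
  proof (cases "e1 v \<in> basis_set (unit_vec_nat (\<kappa> v))")
    case True
    have "(\<lambda>\<l>. coordinate v (\<l> (\<kappa> v))) \<in>
        poly_funs B F (B_scalar n d \<Delta> \<kappa> \<I> \<mu>) m (\<lambda>j. Bd (unit_vec_nat j))"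
      using kappa_lt[OF var] coordinate_linear[OF True] by (rule poly_funs.linear)
    then show ?thesis using True by (simp add: coords_def)
  next
    case False
    then show ?thesis using poly_funs.scalar[OF F.zero_closed] by (simp add: coords_def)
  qed
next
  case (add f g)
  then show ?case by (intro poly_funs.add)
next
  case (mult f g)
  then show ?case by (intro poly_funs.mult)
qed

subsection \<open>The Lefschetz isomorphisms\<close>

definition good_forms :: "(nat \<Rightarrow> 'k mpoly fract mpoly set) set" where
  "good_forms = {\<l> \<in> forms. gram (coords \<l>) \<noteq> 0}"

lemma zariski_open_good_forms:
  "zariski_open B F (B_scalar n d \<Delta> \<kappa> \<I> \<mu>) m (\<lambda>j. Bd (unit_vec_nat j)) good_forms"
  unfolding zariski_open_def good_forms_def
  by (rule exI[of _ "{\<lambda>\<l>. gram (coords \<l>)}"]) (use polyfun_coords[OF polyfun_gram] in auto)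

text \<open>A coefficient vector over F with nonzero Gram product is turned into classes in B;
  reading off \<open>coords\<close> again may change the vector but, by \<open>gram_cong\<close>,
  not the value.\<close>

lemma good_forms_nonempty: "good_forms \<noteq> {}"
proof -
  obtain \<tau> where \<tau>: "\<And>v. v \<in> Vt \<Longrightarrow> \<tau> v \<in> F" "gram \<tau> \<noteq> 0"
    using exists_gram_nonzero by blast
  define \<l> where "\<l> = (\<lambda>j\<in>{..<m}. Bp (ell \<tau> j))"
  have l: "\<l> \<in> forms"
    using \<tau>(1) by (auto simp: \<l>_def B_part_def Rm_iff homog_ell intro!: imageI ell_carrier)
  have "gram (coords \<l>) = gram \<tau>"
    by (rule gram_cong) (use coords_in_F[OF l] \<tau>(1) ell_coords[OF l] in \<open>auto simp: \<l>_def\<close>)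
  then have "\<l> \<in> good_forms" using l \<tau>(2) by (simp add: good_forms_def)
  then show ?thesis by blast
qed

lemma lefschetz_iso:
  assumes l: "\<l> \<in> good_forms" and bd: "b \<in> degrees"
  shows "linear_iso B F (B_scalar n d \<Delta> \<kappa> \<I> \<mu>) (Bd b) (Bd (\<lambda>j. a j - b j))
    (\<lambda>y. monomial_power B m \<l> (\<lambda>j. a j - 2 * b j) \<otimes>\<^bsub>B\<^esub> y)"
proof -
  have lf: "\<l> \<in> forms" and nz: "gram (coords \<l>) \<noteq> 0" using l by (auto simp: good_forms_def)
  define \<tau> where "\<tau> = coords \<l>"
  have \<tau>: "\<tau> v \<in> F" if "v \<in> Vt" for v using coords_in_F[OF lf that] by (simp add: \<tau>_def)
  let ?l = "ell_pow \<tau> (\<lambda>j. a j - 2 * b j)"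
  let ?S = "basis_set b"
  have b: "2 * b j \<le> a j" if "j < m" for j using bd that by (simp add: degrees_def)
  have b_le: "b j \<le> a j" if "j < m" for j using b[OF that] by simp
  note basis = is_basis_chosen[of b]
  have nzb: "perm (form b \<tau>) ?S ?S \<noteq> 0"
    using nz bd finite_degrees by (auto simp: gram_def \<tau>_def)
  have lR: "?l \<in> carrier R" using \<tau> by (rule ell_pow_carrier)
  have mp: "monomial_power B m \<l> (\<lambda>j. a j - 2 * b j) = Bp ?l"
    by (rule monomial_power_ell) (use \<tau> ell_coords[OF lf] in \<open>auto simp: \<tau>_def\<close>)
  have T: "Bp ?l \<otimes>\<^bsub>B\<^esub> Bp f = Bp (?l * f)" if "f \<in> Rm b" for f
    using Bp_hom(2)[OF lR Rm_carrier[OF that]] by simp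
  have inj: "Bp f = Bp g" if fg: "f \<in> Rm b" "g \<in> Rm b" "Bp (?l * f) = Bp (?l * g)" for f g
  proof -
    have c: "?l * f \<in> carrier R" "?l * g \<in> carrier R"
      using fg lR Rm_carrier F.poly_ring_mult by blast+
    have "homog b (- g)" using fg(2) by (simp add: Rm_iff homog_def)
    then have h: "homog b (f - g)" using homog_add[of b f "- g"] fg(1) by (simp add: Rm_iff)
    have z: "lin L (?l * (f - g) * h) = 0" for h
      using fg(3) Bp_eq_iff[OF c] by (simp add: right_diff_distrib)
    have "lin L ((f - g) * h) = 0" for h
      by (rule lefschetz_injective[OF b basis \<tau> nzb h z])
    then show ?thesis using fg Rm_carrier Bp_eq_iff by blast
  qed
  have into: "?l * f \<in> Rm (\<lambda>j. a j - b j)" if "f \<in> Rm b" for f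
    using homog_ell_pow_mult[OF b basis] that lR F.poly_ring_mult by (auto simp: Rm_iff)
  have surj: "\<exists>g\<in>Rm b. Bp (?l * g) = Bp f" if f: "f \<in> Rm (\<lambda>j. a j - b j)" for f
  proof -
    have fc: "homog (\<lambda>j. a j - b j) f" "lookup f \<alpha> \<in> F" for \<alpha>
      using f by (auto simp: Rm_iff carrier_poly_ring)
    obtain c where c: "\<And>s. s \<in> ?S \<Longrightarrow> c s \<in> F"
      "\<And>g. lin L ((?l * (\<Sum>s\<in>?S. const (c s) * mon s) - f) * g) = 0"
      by (rule lefschetz_surjective[OF b basis \<tau> nzb fc], assumption+, rule that)
    let ?g = "\<Sum>s\<in>?S. const (c s) * mon s"
    have "?g \<in> carrier R"
    proof (intro F.poly_ring_sum F.poly_ring_mult F.poly_ring_const F.poly_ring_mono c(1))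
      fix s assume "s \<in> ?S"
      then have "keys s \<subseteq> Vt" using basis by (auto simp: is_basis_def Mon_def)
      then show "keys s \<subseteq> {..<n}" using Vt_lt_n by blast
    qed
    moreover have "homog b ?g"
      unfolding single_eq_const_mult[symmetric]
      by (intro homog_sum basis_hom[OF b_le basis])
    ultimately have g: "?g \<in> Rm b" by (simp add: Rm_iff)
    then have "Bp (?l * ?g) = Bp f"
      using c(2) Rm_carrier[OF f] Rm_carrier[OF into[OF g]] by (simp add: Bp_eq_iff)
    then show ?thesis using g by blast
  qed
  have bc: "y \<in> carrier B" if "y \<in> Bd b" for y
    using that Rm_carrier Bp_carrier by (auto simp: B_part_def)
  have lB: "Bp ?l \<in> carrier B" using lR by (rule Bp_carrier)
  show ?thesis
    unfolding linear_iso_def mp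
  proof (intro conjI ballI)
    show "bij_betw (\<lambda>y. Bp ?l \<otimes>\<^bsub>B\<^esub> y) (Bd b) (Bd (\<lambda>j. a j - b j))"
      unfolding bij_betw_def
    proof
      show "inj_on (\<lambda>y. Bp ?l \<otimes>\<^bsub>B\<^esub> y) (Bd b)"
      proof (rule inj_onI)
        fix x y assume "x \<in> Bd b" "y \<in> Bd b" and eq: "Bp ?l \<otimes>\<^bsub>B\<^esub> x = Bp ?l \<otimes>\<^bsub>B\<^esub> y"
        then obtain f g where fg: "f \<in> Rm b" "x = Bp f" "g \<in> Rm b" "y = Bp g"
          by (auto simp: B_part_def)
        then have "Bp (?l * f) = Bp (?l * g)" using eq T by simp
        then show "x = y" using inj[OF fg(1,3)] fg(2,4) by simp
      qed
      have "(\<lambda>y. Bp ?l \<otimes>\<^bsub>B\<^esub> y) ` Bd b = (\<lambda>f. Bp (?l * f)) ` Rm b"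
        unfolding B_part_def image_image using T by (intro image_cong) auto
      also have "\<dots> = Bd (\<lambda>j. a j - b j)"
      proof (intro equalityI subsetI)
        fix y assume "y \<in> (\<lambda>f. Bp (?l * f)) ` Rm b"
        then show "y \<in> Bd (\<lambda>j. a j - b j)" using into by (auto simp: B_part_def)
      next
        fix y assume "y \<in> Bd (\<lambda>j. a j - b j)"
        then obtain f where "f \<in> Rm (\<lambda>j. a j - b j)" "y = Bp f" by (auto simp: B_part_def)
        then show "y \<in> (\<lambda>f. Bp (?l * f)) ` Rm b" using surj[of f] by force
      qed
      finally show "(\<lambda>y. Bp ?l \<otimes>\<^bsub>B\<^esub> y) ` Bd b = Bd (\<lambda>j. a j - b j)" .
    qed
  next
    fix x y assume "x \<in> Bd b" "y \<in> Bd b"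
    then show "Bp ?l \<otimes>\<^bsub>B\<^esub> (x \<oplus>\<^bsub>B\<^esub> y) = Bp ?l \<otimes>\<^bsub>B\<^esub> x \<oplus>\<^bsub>B\<^esub> Bp ?l \<otimes>\<^bsub>B\<^esub> y"
      using bc lB B.r_distr by simp
  next
    fix c x assume "c \<in> F" "x \<in> Bd b"
    then show "Bp ?l \<otimes>\<^bsub>B\<^esub> (B_scalar n d \<Delta> \<kappa> \<I> \<mu> c \<otimes>\<^bsub>B\<^esub> x) =
        B_scalar n d \<Delta> \<kappa> \<I> \<mu> c \<otimes>\<^bsub>B\<^esub> (Bp ?l \<otimes>\<^bsub>B\<^esub> x)"
      using bc lB Bp_carrier[OF F.poly_ring_const] by (intro B.m_lcomm) (auto simp: B_scalar_def)
  qed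
qed

lemma lefschetz_iso_all:
  assumes l: "\<l> \<in> good_forms" and b: "\<forall>j<m. 2 * b j \<le> a j"
  shows "linear_iso B F (B_scalar n d \<Delta> \<kappa> \<I> \<mu>) (Bd b) (Bd (\<lambda>j. a j - b j))
    (\<lambda>y. monomial_power B m \<l> (\<lambda>j. a j - 2 * b j) \<otimes>\<^bsub>B\<^esub> y)"
proof -
  \<comment> \<open>\<open>degrees\<close> contains only functions that vanish from m on, while b is
    arbitrary there.\<close>
  define b' where "b' j = (if j < m then b j else 0)" for j
  have "b' \<in> degrees" using b by (simp add: degrees_def b'_def)
  then have "linear_iso B F (B_scalar n d \<Delta> \<kappa> \<I> \<mu>) (Bd b') (Bd (\<lambda>j. a j - b' j))
    (\<lambda>y. monomial_power B m \<l> (\<lambda>j. a j - 2 * b' j) \<otimes>\<^bsub>B\<^esub> y)"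
    by (rule lefschetz_iso[OF l])
  moreover have "Bd b' = Bd b" "Bd (\<lambda>j. a j - b' j) = Bd (\<lambda>j. a j - b j)"
    by (rule Bd_cong, simp add: b'_def)+
  moreover have "monomial_power B m \<l> (\<lambda>j. a j - 2 * b' j) = monomial_power B m \<l> (\<lambda>j. a j - 2 * b j)"
  proof -
    have \<tau>: "coords \<l> v \<in> F" if "v \<in> Vt" for v
      using l that by (intro coords_in_F) (auto simp: good_forms_def)
    have lj: "\<l> j = Bp (ell (coords \<l>) j)" if "j < m" for j
      using l that by (intro ell_coords[symmetric]) (auto simp: good_forms_def)
    have "ell_pow (coords \<l>) (\<lambda>j. a j - 2 * b' j) = ell_pow (coords \<l>) (\<lambda>j. a j - 2 * b j)"
      unfolding ell_pow_def by (intro prod.cong) (auto simp: b'_def)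
    then show ?thesis using monomial_power_ell[of "coords \<l>" \<l>, OF \<tau> lj] by simp
  qed
  ultimately show ?thesis by simp
qed

end

theorem theorem7p6:
  fixes n m d :: nat
    and a :: "nat \<Rightarrow> nat"
    and \<Delta> :: "nat set set"
    and \<kappa> :: "nat \<Rightarrow> nat"
    and \<I> :: "nat \<Rightarrow> nat set"
    and \<mu> :: "nat set \<Rightarrow> 'k::field"
  assumes "\<forall>j<m. 0 < a j"
    and "(\<Sum>j<m. a j) = d"
    and "balanced n m d a \<Delta> \<kappa>"
    and "CHAR('k) = 2"
    and "simplicial_cycle d \<Delta> \<mu>"
    and "(\<Union>j<m. \<I> j) = {..<d}"
    and "disjoint_family_on \<I> {..<m}"
    and "\<forall>j<m. card (\<I> j) = a j"
  defines "B \<equiv> gorensteinification n d \<Delta> \<kappa> \<I> \<mu>"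
    and "B_deg \<equiv> B_part n m d \<Delta> \<kappa> \<I> \<mu>"
    and "F \<equiv> ktilde \<Delta> \<kappa> \<I>"
    and "\<eta> \<equiv> B_scalar n d \<Delta> \<kappa> \<I> \<mu>"
  shows "\<exists>U. zariski_open B F \<eta> m (\<lambda>j. B_deg (unit_vec_nat j)) U \<and> U \<noteq> {} \<and>
           (\<forall>\<l>\<in>U. \<forall>b. (\<forall>j<m. 2 * b j \<le> a j) \<longrightarrow>
              linear_iso B F \<eta> (B_deg b) (B_deg (\<lambda>j. a j - b j))
                (\<lambda>y. monomial_power B m \<l> (\<lambda>j. a j - 2 * b j) \<otimes>\<^bsub>B\<^esub> y))"
proof -
  interpret balanced_cycle n m d a \<Delta> \<kappa> \<I> \<mu>
    using assms(1-8) by unfold_locales auto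
  show ?thesis
    unfolding B_def B_deg_def F_def \<eta>_def
    using zariski_open_good_forms good_forms_nonempty lefschetz_iso_all by blast
qed

end
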